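(* Let $H=(H,m,u,\Delta,\varepsilon,T)$ be a finite dimensional biperfect weak Hopf algebra over a field $k$ with invertible weak antipode $T$. Let $\{e_i\}_{i\in I}$ be a basis of the $k$-vector space $H$ and $\{e^i\}_{i\in I}$ its dual basis in $H^{\ast cop}$. Then the quantum double $D(H)=H^{\ast cop}\infty H$ is quasi-braided with quasi-$R$-matrix $$R=\sum_{i\in I}(1\infty e_i)\otimes(e^i\infty 1)\in D(H)\otimes D(H).$$ Hence $R$ is a solution of the quantum Yang–Baxter equation $R_{12}R_{13}R_{23}=R_{23}R_{13}R_{12}$ in $D(H)\otimes D(H)\otimes D(H)$.
   Context: $k$ is a field. Sweedler notation: $\Delta(x)=\sum_{(x)}x'\otimes x''$, iterated $\sum_{(x)}x'\otimes x''\otimes x'''$. $\ast$ is the convolution product on $\mathrm{Hom}_k(H,H)$. A weak Hopf algebra is a bialgebra $H$ over $k$ together with $T\in \mathrm{Hom}_k(H,H)$ (the weak antipode) such that $id\ast T\ast id=id$ and $T\ast id\ast T=T$. It is perfect if $T$ is an anti-bialgebra morphism (anti-algebra and anti-coalgebra morphism) and $(id\ast T)(H)\subseteq C(H)$ (the center of $H$); coperfect if $T$ is an anti-bialgebra morphism and $\sum_{(x)}x'T(x'')\otimes x'''=\sum_{(x)}x''T(x''')\otimes x'$ for all $x\in H$; biperfect if it is both perfect and coperfect. An almost bialgebra is a vector space that is both a unital algebra and a counital coalgebra with $\Delta(xy)=\Delta(x)\Delta(y)$. An almost bialgebra $D$ is quasi-braided with quasi-$R$-matrix $R\in D\otimes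 D$ if $\Delta^{op}(x)R=R\Delta(x)$ for all $x\in D$, $(\Delta\otimes id)(R)=R_{13}R_{23}$ and $(id\otimes\Delta)(R)=R_{13}R_{12}$ ($R$ need not be invertible). Quantum double. For $H$ a finite dimensional biperfect weak Hopf algebra with invertible weak antipode $T$, $H^{\ast cop}$ is the dual space $H^\ast$ with convolution multiplication $(fg)(a)=\sum_{(a)} f(a')g(a'')$, unit $\varepsilon$ (also written $1$), comultiplication opposite to the dual of $m$ (so $\sum_{(f)}f'(a)f''(b)=f(ba)$), counit $f\mapsto f(1)$, and weak antipode $T^{\ast-1}$. For $a\in H$, $f\in H^{\ast cop}$ (Sweedler notation for $f$ taken in $H^{\ast cop}$) put $a\triangleright f=\sum_{(f)}\langle f'T^{\ast-1}(f'''),a\rangle f''$ and $a\triangleleft f=\sum_{(a)}\langle f,T^{-1}(a''')a'\rangle a''$, where $\langle\ ,\ \rangle$ is evaluation. The quantum double $D(H)=H^{\ast cop}\infty H$ is the vector space $H^{\ast cop}\otimes H$ (with $f\otimes a$ written $f\infty a$) with the almost bialgebra structure having identity $1\infty 1=\varepsilon\infty 1$, product $(f\infty a)(g\infty b)=\sum_{(a)(g)}f(a'\triangleright g')\infty(a''\triangleleft g'')b$, coproduct $\Delta(f\infty a)=\sum_{(a)(f)}(f'\infty a')\otimes(f''\infty a'')$ (with $f',f''$ in $H^{\ast cop}$) and counit $\varepsilon(f\infty a)=f(1)\varepsilon(a)$. *)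

theory Defs
  imports Complex_Main "HOL-Library.Function_Algebras"
begin

section \<open>Vector spaces with a carrier\<close>

text \<open>
  A vector space is a subspace of an ambient vector space structure on a type. Taking the carrier
  to be the whole type covers every vector space; proper carriers are needed for duals and tensor
  products, which are subspaces of function spaces (with pointwise operations).
\<close>

record ('k, 'v) vspace =
  vcarrier :: "'v set"
  vscale :: "'k \<Rightarrow> 'v \<Rightarrow> 'v"

definition is_vspace :: "('k::field, 'v::ab_group_add, 'z) vspace_scheme \<Rightarrow> bool" where
  "is_vspace V \<longleftrightarrow> vector_space (vscale V) \<and> module.subspace (vscale V) (vcarrier V)"

definition finite_dim :: "('k::field, 'v::ab_group_add, 'z) vspace_scheme \<Rightarrow> bool" where
  "finite_dim V \<longleftrightarrow> (\<exists>B. finite B \<and> module.span (vscale V) B = vcarrier V)"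

definition is_basis ::
  "('k::field, 'v::ab_group_add, 'z) vspace_scheme \<Rightarrow> 'i set \<Rightarrow> ('i \<Rightarrow> 'v) \<Rightarrow> bool" where
  "is_basis V I e \<longleftrightarrow> inj_on e I \<and> \<not> module.dependent (vscale V) (e ` I)
     \<and> module.span (vscale V) (e ` I) = vcarrier V"

definition linear_on ::
  "('k, 'v::ab_group_add, 'y) vspace_scheme \<Rightarrow> ('k, 'w::ab_group_add, 'z) vspace_scheme
    \<Rightarrow> ('v \<Rightarrow> 'w) \<Rightarrow> bool" where
  "linear_on V W f \<longleftrightarrow>
     (\<forall>x\<in>vcarrier V. f x \<in> vcarrier W) \<and>
     (\<forall>x\<in>vcarrier V. \<forall>y\<in>vcarrier V. f (x + y) = f x + f y) \<and>
     (\<forall>c. \<forall>x\<in>vcarrier V. f (vscale V c x) = vscale W c (f x))"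

definition bilinear_on ::
  "('k, 'v::ab_group_add, 'x) vspace_scheme \<Rightarrow> ('k, 'w::ab_group_add, 'y) vspace_scheme
    \<Rightarrow> ('k, 'u::ab_group_add, 'z) vspace_scheme \<Rightarrow> ('v \<Rightarrow> 'w \<Rightarrow> 'u) \<Rightarrow> bool" where
  "bilinear_on V W U b \<longleftrightarrow>
     (\<forall>x\<in>vcarrier V. linear_on W U (\<lambda>y. b x y)) \<and>
     (\<forall>y\<in>vcarrier W. linear_on V U (\<lambda>x. b x y))"

definition scalars :: "('k::field, 'k) vspace" where
  "scalars = \<lparr>vcarrier = UNIV, vscale = (*)\<rparr>"

text \<open>Functionals are set to 0 off the carrier, so that they are determined by their restriction.\<close>

definition dual_space ::
  "('k::field, 'v::ab_group_add, 'z) vspace_scheme \<Rightarrow> ('k, 'v \<Rightarrow> 'k) vspace" where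
  "dual_space V = \<lparr>
     vcarrier = {f. linear_on V scalars f \<and> (\<forall>x. x \<notin> vcarrier V \<longrightarrow> f x = 0)},
     vscale = (\<lambda>c f x. c * f x)\<rparr>"


section \<open>Tensor products\<close>

text \<open>
  The pure tensor of \<^term>\<open>x\<close> and \<^term>\<open>y\<close> is evaluation of bilinear forms at the pair, and the
  tensor product is the set of finite sums of pure tensors. (Over a field the bilinear forms
  separate the elements of the tensor product.) The universal property is proved below:
  \<open>bilinear_tens\<close>, \<open>linear_tlift\<close>, \<open>tlift_tens\<close>, \<open>tspace_linear_unique\<close>.
\<close>

type_synonym ('k, 'v, 'w) tensor = "('v \<Rightarrow> 'w \<Rightarrow> 'k) \<Rightarrow> 'k"

definition tens ::
  "('k::field, 'v::ab_group_add, 'y) vspace_scheme \<Rightarrow> ('k, 'w::ab_group_add, 'z) vspace_scheme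
    \<Rightarrow> 'v \<Rightarrow> 'w \<Rightarrow> ('k, 'v, 'w) tensor" where
  "tens V W x y = (\<lambda>\<beta>. if bilinear_on V W scalars \<beta> then \<beta> x y else 0)"

definition tspace ::
  "('k::field, 'v::ab_group_add, 'y) vspace_scheme \<Rightarrow> ('k, 'w::ab_group_add, 'z) vspace_scheme
    \<Rightarrow> ('k, ('k, 'v, 'w) tensor) vspace" where
  "tspace V W = \<lparr>
     vcarrier = {t. \<exists>ps. set ps \<subseteq> vcarrier V \<times> vcarrier W \<and> t = (\<Sum>(x, y)\<leftarrow>ps. tens V W x y)},
     vscale = (\<lambda>c t \<beta>. c * t \<beta>)\<rparr>"

text \<open>
  \<open>tlift V W b\<close> is the linear map on the tensor product induced by a bilinear map \<open>b\<close>: it sends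
  \<open>\<Sum>\<^sub>i x\<^sub>i \<otimes> y\<^sub>i\<close> to \<open>\<Sum>\<^sub>i b x\<^sub>i y\<^sub>i\<close>.
\<close>

definition tlift ::
  "('k::field, 'v::ab_group_add, 'y) vspace_scheme \<Rightarrow> ('k, 'w::ab_group_add, 'z) vspace_scheme
    \<Rightarrow> ('v \<Rightarrow> 'w \<Rightarrow> 'u::ab_group_add) \<Rightarrow> ('k, 'v, 'w) tensor \<Rightarrow> 'u" where
  "tlift V W b t = (THE u. \<exists>ps. set ps \<subseteq> vcarrier V \<times> vcarrier W
     \<and> t = (\<Sum>(x, y)\<leftarrow>ps. tens V W x y) \<and> u = (\<Sum>(x, y)\<leftarrow>ps. b x y))"

lemma is_vspace_ring:
  assumes "is_vspace V"
  shows "vscale V c (x + y) = vscale V c x + vscale V c y"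
    and "vscale V (c + d) x = vscale V c x + vscale V d x"
    and "vscale V c (vscale V d x) = vscale V (c * d) x"
    and "vscale V 1 x = x"
    and "vscale V c 0 = 0"
    and "0 \<in> vcarrier V"
    and "x \<in> vcarrier V \<Longrightarrow> y \<in> vcarrier V \<Longrightarrow> x + y \<in> vcarrier V"
    and "x \<in> vcarrier V \<Longrightarrow> vscale V c x \<in> vcarrier V"
proof -
  interpret vector_space "vscale V" using assms by (simp add: is_vspace_def)
  have S: "subspace (vcarrier V)" using assms by (simp add: is_vspace_def)
  show "vscale V c (x + y) = vscale V c x + vscale V c y"
    and "vscale V (c + d) x = vscale V c x + vscale V d x"
    and "vscale V c (vscale V d x) = vscale V (c * d) x"
    and "vscale V 1 x = x" and "vscale V c 0 = 0"
    by (simp_all add: scale_right_distrib scale_left_distrib)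
  show "0 \<in> vcarrier V"
    and "x \<in> vcarrier V \<Longrightarrow> y \<in> vcarrier V \<Longrightarrow> x + y \<in> vcarrier V"
    and "x \<in> vcarrier V \<Longrightarrow> vscale V c x \<in> vcarrier V"
    using S by (auto simp: subspace_def)
qed

lemma vector_space_fun: "vector_space (\<lambda>c (f :: 'a \<Rightarrow> 'k::field) x. c * f x)"
  by unfold_locales (auto simp: fun_eq_iff algebra_simps)

lemma is_vspace_scalars: "is_vspace scalars"
proof -
  interpret vector_space "(*) :: 'a \<Rightarrow> 'a \<Rightarrow> 'a" by unfold_locales (auto simp: algebra_simps)
  show ?thesis by (auto simp: is_vspace_def scalars_def vector_space_axioms subspace_def)
qed

lemma is_vspace_dual: "is_vspace (dual_space V)"
proof -
  interpret vector_space "\<lambda>c (f :: 'b \<Rightarrow> 'a) x. c * f x" by (rule vector_space_fun)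
  show ?thesis
    by (auto simp: is_vspace_def dual_space_def vector_space_axioms subspace_def linear_on_def
        scalars_def algebra_simps)
qed

lemma bilinear_tens:
  assumes "is_vspace V" "is_vspace W"
  shows "bilinear_on V W (tspace V W) (tens V W)"
proof -
  have mem: "tens V W x y \<in> vcarrier (tspace V W)" if "x \<in> vcarrier V" "y \<in> vcarrier W" for x y
  proof -
    have "set [(x, y)] \<subseteq> vcarrier V \<times> vcarrier W" using that by simp
    moreover have "tens V W x y = (\<Sum>(x, y)\<leftarrow>[(x, y)]. tens V W x y)" by simp
    ultimately show ?thesis unfolding tspace_def by (auto intro!: exI[of _ "[(x, y)]"])
  qed
  show ?thesis
    unfolding bilinear_on_def linear_on_def
    using mem by (auto simp: tens_def tspace_def fun_eq_iff bilinear_on_def linear_on_def scalars_def)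
qed

lemma tspaceE:
  assumes "t \<in> vcarrier (tspace V W)"
  obtains ps where "set ps \<subseteq> vcarrier V \<times> vcarrier W" "t = (\<Sum>(x, y)\<leftarrow>ps. tens V W x y)"
  using assms by (auto simp: tspace_def)

lemma tspaceI:
  assumes "set ps \<subseteq> vcarrier V \<times> vcarrier W"
  shows "(\<Sum>(x, y)\<leftarrow>ps. tens V W x y) \<in> vcarrier (tspace V W)"
  using assms by (auto simp: tspace_def)

lemma scale_sum_tens:
  assumes "is_vspace V" "is_vspace W" "set ps \<subseteq> vcarrier V \<times> vcarrier W"
  shows "vscale (tspace V W) c (\<Sum>(x, y)\<leftarrow>ps. tens V W x y) =
    (\<Sum>(x, y)\<leftarrow>map (\<lambda>(x, y). (vscale V c x, y)) ps. tens V W x y)"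
  using assms(3)
proof (induction ps)
  case Nil
  show ?case by (simp add: tspace_def fun_eq_iff)
next
  case (Cons p ps)
  obtain x y where p: "p = (x, y)" "x \<in> vcarrier V" "y \<in> vcarrier W" using Cons.prems by auto
  have "vscale (tspace V W) c (s + t) = vscale (tspace V W) c s + vscale (tspace V W) c t" for s t
    by (simp add: tspace_def fun_eq_iff algebra_simps)
  moreover have "vscale (tspace V W) c (tens V W x y) = tens V W (vscale V c x) y"
    using bilinear_tens[OF assms(1,2)] p by (simp add: bilinear_on_def linear_on_def)
  ultimately show ?case using Cons p
    by (simp only: list.map sum_list.Cons prod.case set_simps insert_subset)
qed

lemma is_vspace_tspace:
  assumes "is_vspace V" "is_vspace W"
  shows "is_vspace (tspace V W)"
proof -
  interpret vector_space "vscale (tspace V W)"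
    by (simp add: tspace_def vector_space_fun)
  have "subspace (vcarrier (tspace V W))"
    unfolding subspace_def
  proof (intro conjI ballI allI)
    show "0 \<in> vcarrier (tspace V W)" using tspaceI[of "[]" V W] by simp
  next
    fix s t assume "s \<in> vcarrier (tspace V W)" "t \<in> vcarrier (tspace V W)"
    then obtain ps qs where "set ps \<subseteq> vcarrier V \<times> vcarrier W" "set qs \<subseteq> vcarrier V \<times> vcarrier W"
      "s = (\<Sum>(x, y)\<leftarrow>ps. tens V W x y)" "t = (\<Sum>(x, y)\<leftarrow>qs. tens V W x y)"
      by (metis tspaceE)
    then show "s + t \<in> vcarrier (tspace V W)" using tspaceI[of "ps @ qs" V W] by simp
  next
    fix c s assume "s \<in> vcarrier (tspace V W)"
    then obtain ps where ps: "set ps \<subseteq> vcarrier V \<times> vcarrier W"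
      and s: "s = (\<Sum>(x, y)\<leftarrow>ps. tens V W x y)" by (rule tspaceE)
    have "set (map (\<lambda>(x, y). (vscale V c x, y)) ps) \<subseteq> vcarrier V \<times> vcarrier W"
      using ps is_vspace_ring(8)[OF assms(1)] by fastforce
    then show "vscale (tspace V W) c s \<in> vcarrier (tspace V W)"
      unfolding s scale_sum_tens[OF assms ps] by (rule tspaceI)
  qed
  then show ?thesis by (simp add: is_vspace_def vector_space_axioms)
qed

lemma separating_functional:
  assumes "is_vspace U" "u \<noteq> 0"
  obtains \<phi> where "Vector_Spaces.linear (vscale U) (*) \<phi>" "\<phi> u \<noteq> 0"
proof -
  interpret U: vector_space "vscale U" using assms by (simp add: is_vspace_def)
  interpret F: vector_space "(*) :: 'a \<Rightarrow> 'a \<Rightarrow> 'a" by unfold_locales (auto simp: algebra_simps)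
  interpret vector_space_pair "vscale U" "(*) :: 'a \<Rightarrow> 'a \<Rightarrow> 'a" ..
  have "U.independent {u}" using assms(2) by simp
  from linear_independent_extend[OF this, of "\<lambda>_. 1"] show ?thesis using that by auto
qed

lemma tlift_well_defined:
  assumes U: "is_vspace U" and b: "bilinear_on V W U b"
    and ps: "set ps \<subseteq> vcarrier V \<times> vcarrier W" and qs: "set qs \<subseteq> vcarrier V \<times> vcarrier W"
    and eq: "(\<Sum>(x, y)\<leftarrow>ps. tens V W x y) = (\<Sum>(x, y)\<leftarrow>qs. tens V W x y)"
  shows "(\<Sum>(x, y)\<leftarrow>ps. b x y) = (\<Sum>(x, y)\<leftarrow>qs. b x y)"
proof (rule ccontr)
  assume "\<not> ?thesis"
  then have "(\<Sum>(x, y)\<leftarrow>ps. b x y) - (\<Sum>(x, y)\<leftarrow>qs. b x y) \<noteq> 0" by simp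
  then obtain \<phi> where lin: "Vector_Spaces.linear (vscale U) (*) \<phi>"
    and nz: "\<phi> ((\<Sum>(x, y)\<leftarrow>ps. b x y) - (\<Sum>(x, y)\<leftarrow>qs. b x y)) \<noteq> 0"
    by (rule separating_functional[OF U])
  interpret \<phi>: Vector_Spaces.linear "vscale U" "(*)" \<phi> by (rule lin)
  define \<beta> where "\<beta> = (\<lambda>x y. \<phi> (b x y))"
  have \<beta>: "bilinear_on V W scalars \<beta>"
    using b by (auto simp: \<beta>_def bilinear_on_def linear_on_def scalars_def \<phi>.add \<phi>.scale)
  have ev: "(\<Sum>(x, y)\<leftarrow>rs. tens V W x y) \<beta> = \<phi> (\<Sum>(x, y)\<leftarrow>rs. b x y)" for rs
    by (induction rs) (auto simp: tens_def \<beta> \<phi>.add \<phi>.zero, simp add: \<beta>_def)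
  from nz eq ev[of ps] ev[of qs] show False by (simp add: \<phi>.diff)
qed

lemma tlift_sum:
  assumes "is_vspace U" "bilinear_on V W U b" "set ps \<subseteq> vcarrier V \<times> vcarrier W"
  shows "tlift V W b (\<Sum>(x, y)\<leftarrow>ps. tens V W x y) = (\<Sum>(x, y)\<leftarrow>ps. b x y)"
  unfolding tlift_def
proof (rule the_equality)
  show "\<exists>qs. set qs \<subseteq> vcarrier V \<times> vcarrier W
      \<and> (\<Sum>(x, y)\<leftarrow>ps. tens V W x y) = (\<Sum>(x, y)\<leftarrow>qs. tens V W x y)
      \<and> (\<Sum>(x, y)\<leftarrow>ps. b x y) = (\<Sum>(x, y)\<leftarrow>qs. b x y)"
    using assms(3) by blast
next
  fix u
  assume "\<exists>qs. set qs \<subseteq> vcarrier V \<times> vcarrier W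
      \<and> (\<Sum>(x, y)\<leftarrow>ps. tens V W x y) = (\<Sum>(x, y)\<leftarrow>qs. tens V W x y)
      \<and> u = (\<Sum>(x, y)\<leftarrow>qs. b x y)"
  then show "u = (\<Sum>(x, y)\<leftarrow>ps. b x y)"
    using tlift_well_defined[OF assms] by metis
qed

lemma tlift_tens:
  assumes "is_vspace U" "bilinear_on V W U b" "x \<in> vcarrier V" "y \<in> vcarrier W"
  shows "tlift V W b (tens V W x y) = b x y"
  using tlift_sum[OF assms(1,2), of "[(x, y)]"] assms(3,4) by simp

lemma linear_tlift:
  assumes V: "is_vspace V" and W: "is_vspace W" and U: "is_vspace U" and b: "bilinear_on V W U b"
  shows "linear_on (tspace V W) U (tlift V W b)"
  unfolding linear_on_def
proof (intro conjI ballI allI)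
  fix t assume "t \<in> vcarrier (tspace V W)"
  then obtain ps where ps: "set ps \<subseteq> vcarrier V \<times> vcarrier W"
    and t: "t = (\<Sum>(x, y)\<leftarrow>ps. tens V W x y)" by (rule tspaceE)
  have "(\<Sum>(x, y)\<leftarrow>ps. b x y) \<in> vcarrier U"
    using ps b
    by (induction ps) (auto simp: is_vspace_ring[OF U] bilinear_on_def linear_on_def)
  then show "tlift V W b t \<in> vcarrier U" using tlift_sum[OF U b ps] t by simp
next
  fix s t assume "s \<in> vcarrier (tspace V W)" "t \<in> vcarrier (tspace V W)"
  then obtain ps qs where ps: "set ps \<subseteq> vcarrier V \<times> vcarrier W"
      and qs: "set qs \<subseteq> vcarrier V \<times> vcarrier W"
      and st: "s = (\<Sum>(x, y)\<leftarrow>ps. tens V W x y)" "t = (\<Sum>(x, y)\<leftarrow>qs. tens V W x y)"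
    by (metis tspaceE)
  show "tlift V W b (s + t) = tlift V W b s + tlift V W b t"
    using tlift_sum[OF U b ps] tlift_sum[OF U b qs] tlift_sum[OF U b, of "ps @ qs"] ps qs st by simp
next
  fix c t assume "t \<in> vcarrier (tspace V W)"
  then obtain ps where ps: "set ps \<subseteq> vcarrier V \<times> vcarrier W"
    and t: "t = (\<Sum>(x, y)\<leftarrow>ps. tens V W x y)" by (rule tspaceE)
  let ?qs = "map (\<lambda>(x, y). (vscale V c x, y)) ps"
  have qs: "set ?qs \<subseteq> vcarrier V \<times> vcarrier W"
    using ps is_vspace_ring(8)[OF V] by fastforce
  have "(\<Sum>(x, y)\<leftarrow>?qs. b x y) = vscale U c (\<Sum>(x, y)\<leftarrow>ps. b x y)"
    using ps b
    by (induction ps) (auto simp: is_vspace_ring[OF U] bilinear_on_def linear_on_def)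
  then show "tlift V W b (vscale (tspace V W) c t) = vscale U c (tlift V W b t)"
    unfolding t scale_sum_tens[OF V W ps] tlift_sum[OF U b ps] tlift_sum[OF U b qs] .
qed

lemma tspace_linear_unique:
  assumes V: "is_vspace V" and W: "is_vspace W" and U: "is_vspace U"
    and F: "linear_on (tspace V W) U F" and G: "linear_on (tspace V W) U G"
    and FG: "\<And>x y. x \<in> vcarrier V \<Longrightarrow> y \<in> vcarrier W \<Longrightarrow> F (tens V W x y) = G (tens V W x y)"
    and t: "t \<in> vcarrier (tspace V W)"
  shows "F t = G t"
proof -
  obtain ps where ps: "set ps \<subseteq> vcarrier V \<times> vcarrier W"
    and t': "t = (\<Sum>(x, y)\<leftarrow>ps. tens V W x y)" using t by (rule tspaceE)
  have z: "H 0 = 0" if "linear_on (tspace V W) U H" for H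
  proof -
    have "H (0 + 0) = H 0 + H 0"
      using that is_vspace_ring(6)[OF is_vspace_tspace[OF V W]] unfolding linear_on_def by blast
    then show ?thesis by simp
  qed
  have "F (\<Sum>(x, y)\<leftarrow>ps. tens V W x y) = G (\<Sum>(x, y)\<leftarrow>ps. tens V W x y)" using ps
  proof (induction ps)
    case Nil
    show ?case using z[OF F] z[OF G] by (simp only: list.map sum_list.Nil)
  next
    case (Cons p ps)
    obtain x y where p: "p = (x, y)" "x \<in> vcarrier V" "y \<in> vcarrier W" using Cons.prems by auto
    have "tens V W x y \<in> vcarrier (tspace V W)" using tspaceI[of "[(x, y)]" V W] p by simp
    moreover have "(\<Sum>(x, y)\<leftarrow>ps. tens V W x y) \<in> vcarrier (tspace V W)"
      using tspaceI[of ps V W] Cons.prems by simp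
    ultimately have "F (tens V W x y + (\<Sum>(x, y)\<leftarrow>ps. tens V W x y)) =
        G (tens V W x y + (\<Sum>(x, y)\<leftarrow>ps. tens V W x y))"
      using F G Cons FG[OF p(2,3)] unfolding linear_on_def by auto
    then show ?case by (simp only: p(1) list.map sum_list.Cons prod.case)
  qed
  then show ?thesis by (simp add: t')
qed


section \<open>Algebras, coalgebras, bialgebras\<close>

record ('k, 'v) alg = "('k, 'v) vspace" +
  mul :: "'v \<Rightarrow> 'v \<Rightarrow> 'v"
  unity :: "'v"

record ('k, 'v) bialg = "('k, 'v) alg" +
  comul :: "'v \<Rightarrow> ('k, 'v, 'v) tensor"
  counit :: "'v \<Rightarrow> 'k"

definition is_algebra :: "('k::field, 'v::ab_group_add, 'z) alg_scheme \<Rightarrow> bool" where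
  "is_algebra A \<longleftrightarrow> is_vspace A \<and> bilinear_on A A A (mul A) \<and> unity A \<in> vcarrier A \<and>
     (\<forall>x\<in>vcarrier A. \<forall>y\<in>vcarrier A. \<forall>z\<in>vcarrier A. mul A (mul A x y) z = mul A x (mul A y z)) \<and>
     (\<forall>x\<in>vcarrier A. mul A (unity A) x = x \<and> mul A x (unity A) = x)"

definition center :: "('k, 'v, 'z) alg_scheme \<Rightarrow> 'v set" where
  "center A = {z \<in> vcarrier A. \<forall>x\<in>vcarrier A. mul A z x = mul A x z}"

definition tensor_alg ::
  "('k::field, 'v::ab_group_add, 'y) alg_scheme \<Rightarrow> ('k, 'w::ab_group_add, 'z) alg_scheme
    \<Rightarrow> ('k, ('k, 'v, 'w) tensor) alg" where
  "tensor_alg A B = \<lparr>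
     vcarrier = vcarrier (tspace A B),
     vscale = vscale (tspace A B),
     mul = (\<lambda>s t. tlift A B (\<lambda>a b. tlift A B (\<lambda>c d. tens A B (mul A a c) (mul B b d)) t) s),
     unity = tens A B (unity A) (unity B)\<rparr>"

text \<open>
  Sweedler sums: \<open>sw2 C b x\<close> is \<open>\<Sum>\<^sub>(\<^sub>x\<^sub>) b x' x''\<close> for bilinear \<open>b\<close>, and \<open>sw3 C b x\<close> is
  \<open>\<Sum>\<^sub>(\<^sub>x\<^sub>) b x' x'' x'''\<close> for trilinear \<open>b\<close>.
\<close>

definition sw2 ::
  "('k::field, 'v::ab_group_add, 'z) bialg_scheme \<Rightarrow> ('v \<Rightarrow> 'v \<Rightarrow> 'u::ab_group_add) \<Rightarrow> 'v \<Rightarrow> 'u" where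
  "sw2 C b x = tlift C C b (comul C x)"

definition sw3 ::
  "('k::field, 'v::ab_group_add, 'z) bialg_scheme \<Rightarrow> ('v \<Rightarrow> 'v \<Rightarrow> 'v \<Rightarrow> 'u::ab_group_add)
    \<Rightarrow> 'v \<Rightarrow> 'u" where
  "sw3 C b x = sw2 C (\<lambda>x1 y. sw2 C (\<lambda>x2 x3. b x1 x2 x3) y) x"

definition tens3 ::
  "('k::field, 'v::ab_group_add, 'z) vspace_scheme
    \<Rightarrow> 'v \<Rightarrow> 'v \<Rightarrow> 'v \<Rightarrow> ('k, 'v, ('k, 'v, 'v) tensor) tensor" where
  "tens3 V x y z = tens V (tspace V V) x (tens V V y z)"

definition is_coalgebra :: "('k::field, 'v::ab_group_add, 'z) bialg_scheme \<Rightarrow> bool" where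
  "is_coalgebra C \<longleftrightarrow> is_vspace C \<and> linear_on C (tspace C C) (comul C) \<and>
     linear_on C scalars (counit C) \<and>
     (\<forall>x\<in>vcarrier C.
        sw2 C (\<lambda>y x3. sw2 C (\<lambda>x1 x2. tens3 C x1 x2 x3) y) x =
        sw2 C (\<lambda>x1 y. sw2 C (\<lambda>x2 x3. tens3 C x1 x2 x3) y) x) \<and>
     (\<forall>x\<in>vcarrier C.
        sw2 C (\<lambda>x1 x2. vscale C (counit C x1) x2) x = x \<and>
        sw2 C (\<lambda>x1 x2. vscale C (counit C x2) x1) x = x)"

definition almost_bialgebra :: "('k::field, 'v::ab_group_add, 'z) bialg_scheme \<Rightarrow> bool" where
  "almost_bialgebra D \<longleftrightarrow> is_algebra D \<and> is_coalgebra D \<and>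
     (\<forall>x\<in>vcarrier D. \<forall>y\<in>vcarrier D.
        comul D (mul D x y) = mul (tensor_alg D D) (comul D x) (comul D y))"

definition is_bialgebra :: "('k::field, 'v::ab_group_add, 'z) bialg_scheme \<Rightarrow> bool" where
  "is_bialgebra H \<longleftrightarrow> almost_bialgebra H \<and>
     comul H (unity H) = unity (tensor_alg H H) \<and>
     (\<forall>x\<in>vcarrier H. \<forall>y\<in>vcarrier H. counit H (mul H x y) = counit H x * counit H y) \<and>
     counit H (unity H) = 1"

definition comul_op ::
  "('k::field, 'v::ab_group_add, 'z) bialg_scheme \<Rightarrow> 'v \<Rightarrow> ('k, 'v, 'v) tensor" where
  "comul_op C x = sw2 C (\<lambda>x1 x2. tens C C x2 x1) x"

definition convol ::
  "('k::field, 'v::ab_group_add, 'z) bialg_scheme \<Rightarrow> ('v \<Rightarrow> 'v) \<Rightarrow> ('v \<Rightarrow> 'v) \<Rightarrow> 'v \<Rightarrow> 'v" where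
  "convol H f g x = sw2 H (\<lambda>x1 x2. mul H (f x1) (g x2)) x"


section \<open>Weak Hopf algebras\<close>

definition weak_hopf :: "('k::field, 'v::ab_group_add, 'z) bialg_scheme \<Rightarrow> ('v \<Rightarrow> 'v) \<Rightarrow> bool" where
  "weak_hopf H T \<longleftrightarrow> is_bialgebra H \<and> linear_on H H T \<and>
     (\<forall>x\<in>vcarrier H. convol H (convol H id T) id x = x) \<and>
     (\<forall>x\<in>vcarrier H. convol H (convol H T id) T x = T x)"

definition anti_bialgebra_morphism ::
  "('k::field, 'v::ab_group_add, 'z) bialg_scheme \<Rightarrow> ('v \<Rightarrow> 'v) \<Rightarrow> bool" where
  "anti_bialgebra_morphism H T \<longleftrightarrow> linear_on H H T \<and>
     (\<forall>x\<in>vcarrier H. \<forall>y\<in>vcarrier H. T (mul H x y) = mul H (T y) (T x)) \<and>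
     T (unity H) = unity H \<and>
     (\<forall>x\<in>vcarrier H. comul H (T x) = sw2 H (\<lambda>x1 x2. tens H H (T x2) (T x1)) x) \<and>
     (\<forall>x\<in>vcarrier H. counit H (T x) = counit H x)"

definition perfect :: "('k::field, 'v::ab_group_add, 'z) bialg_scheme \<Rightarrow> ('v \<Rightarrow> 'v) \<Rightarrow> bool" where
  "perfect H T \<longleftrightarrow> weak_hopf H T \<and> anti_bialgebra_morphism H T \<and>
     convol H id T ` vcarrier H \<subseteq> center H"

definition coperfect :: "('k::field, 'v::ab_group_add, 'z) bialg_scheme \<Rightarrow> ('v \<Rightarrow> 'v) \<Rightarrow> bool" where
  "coperfect H T \<longleftrightarrow> weak_hopf H T \<and> anti_bialgebra_morphism H T \<and>
     (\<forall>x\<in>vcarrier H.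
        sw3 H (\<lambda>x1 x2 x3. tens H H (mul H x1 (T x2)) x3) x =
        sw3 H (\<lambda>x1 x2 x3. tens H H (mul H x2 (T x3)) x1) x)"

definition biperfect :: "('k::field, 'v::ab_group_add, 'z) bialg_scheme \<Rightarrow> ('v \<Rightarrow> 'v) \<Rightarrow> bool" where
  "biperfect H T \<longleftrightarrow> perfect H T \<and> coperfect H T"


section \<open>Quasi-braided almost bialgebras\<close>

definition R12 ::
  "('k::field, 'v::ab_group_add, 'z) bialg_scheme \<Rightarrow> ('k, 'v, 'v) tensor
    \<Rightarrow> ('k, 'v, ('k, 'v, 'v) tensor) tensor" where
  "R12 D R = tlift D D (\<lambda>r s. tens3 D r s (unity D)) R"

definition R13 ::
  "('k::field, 'v::ab_group_add, 'z) bialg_scheme \<Rightarrow> ('k, 'v, 'v) tensor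
    \<Rightarrow> ('k, 'v, ('k, 'v, 'v) tensor) tensor" where
  "R13 D R = tlift D D (\<lambda>r s. tens3 D r (unity D) s) R"

definition R23 ::
  "('k::field, 'v::ab_group_add, 'z) bialg_scheme \<Rightarrow> ('k, 'v, 'v) tensor
    \<Rightarrow> ('k, 'v, ('k, 'v, 'v) tensor) tensor" where
  "R23 D R = tlift D D (\<lambda>r s. tens3 D (unity D) r s) R"

definition mul3 ::
  "('k::field, 'v::ab_group_add, 'z) bialg_scheme \<Rightarrow> ('k, 'v, ('k, 'v, 'v) tensor) tensor
    \<Rightarrow> ('k, 'v, ('k, 'v, 'v) tensor) tensor \<Rightarrow> ('k, 'v, ('k, 'v, 'v) tensor) tensor" where
  "mul3 D = mul (tensor_alg D (tensor_alg D D))"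

definition quasi_braided ::
  "('k::field, 'v::ab_group_add, 'z) bialg_scheme \<Rightarrow> ('k, 'v, 'v) tensor \<Rightarrow> bool" where
  "quasi_braided D R \<longleftrightarrow> almost_bialgebra D \<and> R \<in> vcarrier (tspace D D) \<and>
     (\<forall>x\<in>vcarrier D. mul (tensor_alg D D) (comul_op D x) R = mul (tensor_alg D D) R (comul D x)) \<and>
     tlift D D (\<lambda>r s. sw2 D (\<lambda>r1 r2. tens3 D r1 r2 s) r) R = mul3 D (R13 D R) (R23 D R) \<and>
     tlift D D (\<lambda>r s. sw2 D (\<lambda>s1 s2. tens3 D r s1 s2) s) R = mul3 D (R13 D R) (R12 D R)"

definition yang_baxter ::
  "('k::field, 'v::ab_group_add, 'z) bialg_scheme \<Rightarrow> ('k, 'v, 'v) tensor \<Rightarrow> bool" where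
  "yang_baxter D R \<longleftrightarrow>
     mul3 D (mul3 D (R12 D R) (R13 D R)) (R23 D R) = mul3 D (mul3 D (R23 D R) (R13 D R)) (R12 D R)"


section \<open>The quantum double\<close>

definition dual_cop ::
  "('k::field, 'v::ab_group_add, 'z) bialg_scheme \<Rightarrow> ('k, 'v \<Rightarrow> 'k) bialg" where
  "dual_cop H = \<lparr>
     vcarrier = vcarrier (dual_space H),
     vscale = vscale (dual_space H),
     mul = (\<lambda>f g a. if a \<in> vcarrier H then sw2 H (\<lambda>a1 a2. f a1 * g a2) a else 0),
     unity = (\<lambda>a. if a \<in> vcarrier H then counit H a else 0),
     comul = (\<lambda>f. THE t. t \<in> vcarrier (tspace (dual_space H) (dual_space H)) \<and>
        (\<forall>a\<in>vcarrier H. \<forall>b\<in>vcarrier H.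
           tlift (dual_space H) (dual_space H) (\<lambda>f1 f2. f1 a * f2 b) t = f (mul H b a))),
     counit = (\<lambda>f. f (unity H))\<rparr>"

definition transpose ::
  "('k, 'v, 'z) bialg_scheme \<Rightarrow> ('v \<Rightarrow> 'v) \<Rightarrow> ('v \<Rightarrow> 'k::zero) \<Rightarrow> ('v \<Rightarrow> 'k)" where
  "transpose H T f = (\<lambda>a. if a \<in> vcarrier H then f (T a) else 0)"

definition left_act ::
  "('k::field, 'v::ab_group_add, 'z) bialg_scheme \<Rightarrow> ('v \<Rightarrow> 'v) \<Rightarrow> 'v \<Rightarrow> ('v \<Rightarrow> 'k) \<Rightarrow> ('v \<Rightarrow> 'k)" where
  "left_act H T a f = sw3 (dual_cop H) (\<lambda>f1 f2 f3.
     vscale (dual_cop H)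
       (mul (dual_cop H) f1 (inv_into (vcarrier (dual_cop H)) (transpose H T) f3) a) f2) f"

definition right_act ::
  "('k::field, 'v::ab_group_add, 'z) bialg_scheme \<Rightarrow> ('v \<Rightarrow> 'v) \<Rightarrow> 'v \<Rightarrow> ('v \<Rightarrow> 'k) \<Rightarrow> 'v" where
  "right_act H T a f = sw3 H (\<lambda>a1 a2 a3.
     vscale H (f (mul H (inv_into (vcarrier H) T a3) a1)) a2) a"

definition infty ::
  "('k::field, 'v::ab_group_add, 'z) bialg_scheme \<Rightarrow> ('v \<Rightarrow> 'k) \<Rightarrow> 'v
    \<Rightarrow> ('k, 'v \<Rightarrow> 'k, 'v) tensor" where
  "infty H f a = tens (dual_cop H) H f a"

definition quantum_double ::
  "('k::field, 'v::ab_group_add, 'z) bialg_scheme \<Rightarrow> ('v \<Rightarrow> 'v)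
    \<Rightarrow> ('k, ('k, 'v \<Rightarrow> 'k, 'v) tensor) bialg" where
  "quantum_double H T = (let K = dual_cop H; V = tspace K H in \<lparr>
     vcarrier = vcarrier V,
     vscale = vscale V,
     mul = (\<lambda>s t. tlift K H (\<lambda>f a. tlift K H (\<lambda>g b.
        sw2 H (\<lambda>a1 a2. sw2 K (\<lambda>g1 g2.
          infty H (mul K f (left_act H T a1 g1)) (mul H (right_act H T a2 g2) b)) g) a) t) s),
     unity = infty H (unity K) (unity H),
     comul = tlift K H (\<lambda>f a. sw2 H (\<lambda>a1 a2. sw2 K (\<lambda>f1 f2.
        tens V V (infty H f1 a1) (infty H f2 a2)) f) a),
     counit = tlift K H (\<lambda>f a. f (unity H) * counit H a)\<rparr>)"

definition is_dual_basis ::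
  "('k::field, 'v::ab_group_add, 'z) vspace_scheme \<Rightarrow> 'i set \<Rightarrow> ('i \<Rightarrow> 'v) \<Rightarrow> ('i \<Rightarrow> 'v \<Rightarrow> 'k)
    \<Rightarrow> bool" where
  "is_dual_basis V I e e' \<longleftrightarrow> (\<forall>i\<in>I. e' i \<in> vcarrier (dual_space V) \<and>
     (\<forall>j\<in>I. e' i (e j) = (if i = j then 1 else 0)))"

end

theory Submission
  imports Defs
begin

text \<open>
  Evaluating the first factor identifies \<open>D(H)\<close> with \<open>End(H)\<close>: \<open>f \<infinity> a\<close> becomes \<open>x \<mapsto> f(x) a\<close>. Write
  \<open>S\<close> for the inverse of \<open>T\<close>. Coperfectness, centrality of \<open>\<Sum> x'' S(x')\<close> and \<open>S(x''') x'' S(x') = S(x)\<close>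
  collapse the two actions in the product of \<open>D(H)\<close>, so that
  \<open>(f \<infinity> a)(g \<infinity> b) = \<Sum> f g(S(a''') ? a') \<infinity> a'' b\<close>,
  which is the formula of the classical Drinfeld double; in terms of endomorphisms
  \<open>(s t)(x) = \<Sum> s(x')'' t(S(s(x')''') x'' s(x')')\<close>. Likewise \<open>R\<close> becomes \<open>(x, y) \<mapsto> \<epsilon>(x) y \<otimes> 1\<close> and the
  coproduct of \<open>s\<close> becomes \<open>(x, y) \<mapsto> \<Delta>(s(y x))\<close>. Every identity in a tensor power of \<open>D(H)\<close> is checked by
  evaluating at elements of \<open>H\<close>, where it follows from a few identities between Sweedler sums in \<open>H\<close>.
  The classical cancellations \<open>S(x'') x' = \<epsilon>(x) 1\<close> are not available; they are replaced by
  the lemmas \<open>S_id_S_shift\<close> and \<open>twist_cancel\<close>.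
\<close>

section \<open>Tensor products\<close>

text \<open>Sweedler identities are reduced to scalars: linear functionals separate the points of
  \<open>H\<close>, so an identity is proved after an arbitrary multilinear form is applied, as an
  equation between values of \<open>cop\<close>. Structure maps live on a subspace of a type;
  composing them with a projection avoids membership conditions under nested sums.

  The exchange of an element of \<open>H\<close> with an element of the dual is
  \<open>twist\<close>. Once the product has the classical form, associativity comes from S
  reversing products and coproducts. The weak antipode axioms, centrality and coperfectness enter
  through \<open>twist_TW\<close>, behind the collapse of the actions and the multiplicativity of
  the coproduct, and through \<open>twist_cancel\<close>, behind the commutation of R with the
  coproduct and the Yang-Baxter equation. Each follows the same pattern: coperfectness carries a
  block x'' S(x') to other legs of the coproduct, centrality carries it past the factor in its way,
  and S(x''') x'' S(x') = S(x) or x''' S(x'') x' = x absorbs it.\<close>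

lemma sum_fun_apply: "(sum f A) x = (\<Sum>a\<in>A. f a x)"
  by (induction A rule: infinite_finite_induct) simp_all

lemma linear_onD:
  assumes "linear_on V W f"
  shows "x \<in> vcarrier V \<Longrightarrow> f x \<in> vcarrier W"
    and "x \<in> vcarrier V \<Longrightarrow> y \<in> vcarrier V \<Longrightarrow> f (x + y) = f x + f y"
    and "x \<in> vcarrier V \<Longrightarrow> f (vscale V c x) = vscale W c (f x)"
  using assms by (auto simp: linear_on_def)

lemma bilinear_onI:
  assumes "\<And>x. x \<in> vcarrier V \<Longrightarrow> linear_on W U (b x)"
    and "\<And>y. y \<in> vcarrier W \<Longrightarrow> linear_on V U (\<lambda>x. b x y)"
  shows "bilinear_on V W U b"
  using assms by (auto simp: bilinear_on_def)

lemma bilinear_onD: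
  assumes "bilinear_on V W U b"
  shows "x \<in> vcarrier V \<Longrightarrow> linear_on W U (b x)"
    and "y \<in> vcarrier W \<Longrightarrow> linear_on V U (\<lambda>x. b x y)"
  using assms by (auto simp: bilinear_on_def)

lemma linear_on_comp:
  assumes "linear_on W U g" "linear_on V W f"
  shows "linear_on V U (\<lambda>x. g (f x))"
  using assms by (simp add: linear_on_def)

lemma linear_on_id: "linear_on V V (\<lambda>x. x)"
  by (simp add: linear_on_def)

lemma linear_on_cong:
  assumes "\<And>x. x \<in> vcarrier V \<Longrightarrow> f x = g x" "is_vspace V"
  shows "linear_on V W f = linear_on V W g"
  using assms is_vspace_ring[OF assms(2)] by (simp add: linear_on_def)

lemma bilinear_on_cong:
  assumes "\<And>x y. x \<in> vcarrier V \<Longrightarrow> y \<in> vcarrier W \<Longrightarrow> b x y = b' x y"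
    and "is_vspace V" "is_vspace W"
  shows "bilinear_on V W U b = bilinear_on V W U b'"
  unfolding bilinear_on_def using assms by (simp cong: linear_on_cong)

lemma linear_on_0:
  assumes "linear_on V W f" "is_vspace V"
  shows "f 0 = 0"
proof -
  have "f (0 + 0) = f 0 + f 0"
    using assms is_vspace_ring(6)[OF assms(2)] unfolding linear_on_def by blast
  then show ?thesis by simp
qed

lemma linear_on_sum:
  assumes "linear_on V W f" "is_vspace V" "\<And>i. i \<in> J \<Longrightarrow> g i \<in> vcarrier V"
  shows "(\<Sum>i\<in>J. g i) \<in> vcarrier V" and "f (\<Sum>i\<in>J. g i) = (\<Sum>i\<in>J. f (g i))"
proof -
  have "(\<Sum>i\<in>J. g i) \<in> vcarrier V \<and> f (\<Sum>i\<in>J. g i) = (\<Sum>i\<in>J. f (g i))"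
    using assms(3)
    by (induction J rule: infinite_finite_induct)
      (auto simp: linear_on_0[OF assms(1,2)] is_vspace_ring[OF assms(2)] linear_onD[OF assms(1)])
  then show "(\<Sum>i\<in>J. g i) \<in> vcarrier V" and "f (\<Sum>i\<in>J. g i) = (\<Sum>i\<in>J. f (g i))" by auto
qed

lemma vspace_sum_closed:
  assumes "is_vspace V" "\<And>i. i \<in> J \<Longrightarrow> g i \<in> vcarrier V"
  shows "(\<Sum>i\<in>J. g i) \<in> vcarrier V"
  using linear_on_sum(1)[OF linear_on_id assms] .

lemma tspace_induct [consumes 1, case_names pure zero add]:
  assumes "t \<in> vcarrier (tspace V W)"
    and pure: "\<And>x y. x \<in> vcarrier V \<Longrightarrow> y \<in> vcarrier W \<Longrightarrow> P (tens V W x y)"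
    and zero: "P 0"
    and add: "\<And>s t. s \<in> vcarrier (tspace V W) \<Longrightarrow> t \<in> vcarrier (tspace V W) \<Longrightarrow> P s \<Longrightarrow> P t \<Longrightarrow> P (s + t)"
  shows "P t"
proof -
  obtain ps where ps: "set ps \<subseteq> vcarrier V \<times> vcarrier W"
    and t: "t = (\<Sum>(x, y)\<leftarrow>ps. tens V W x y)" using assms(1) by (rule tspaceE)
  have "P (\<Sum>(x, y)\<leftarrow>ps. tens V W x y)" using ps
  proof (induction ps)
    case Nil
    show ?case using zero by (simp only: list.map sum_list.Nil)
  next
    case (Cons q ps)
    obtain x y where q: "q = (x, y)" "x \<in> vcarrier V" "y \<in> vcarrier W" using Cons.prems by auto
    have "P (tens V W x y + (\<Sum>(x, y)\<leftarrow>ps. tens V W x y))"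
      using tspaceI[of "[(x, y)]" V W] tspaceI[of ps V W] Cons q pure by (intro add) auto
    then show ?case by (simp only: q(1) list.map sum_list.Cons prod.case)
  qed
  then show ?thesis by (simp only: t)
qed

lemma tens_closed:
  assumes "x \<in> vcarrier V" "y \<in> vcarrier W"
  shows "tens V W x y \<in> vcarrier (tspace V W)"
  using tspaceI[of "[(x, y)]" V W] assms by simp

lemma tspace_eval:
  "((s :: ('k, 'v, 'w) tensor) + t) \<beta> = s \<beta> + t \<beta>" "(0 :: ('k::field, 'v::ab_group_add, 'w::ab_group_add) tensor) \<beta> = 0"
  "vscale (tspace V W) c s \<beta> = c * s \<beta>"
  by (simp_all add: tspace_def)

lemma tens_eval: "bilinear_on V W scalars \<beta> \<Longrightarrow> tens V W x y \<beta> = \<beta> x y"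
  by (simp add: tens_def)

lemma linear_eval: "linear_on (tspace V W) scalars (\<lambda>t. t \<beta>)"
  by (simp add: linear_on_def scalars_def tspace_def)

text \<open>The default value 0 of \<open>tens\<close> off the bilinear forms is inherited by sums.
  Hence a tensor is determined by its values on bilinear forms.\<close>

lemma tspace_not_bilinear:
  assumes "t \<in> vcarrier (tspace V W)" "\<not> bilinear_on V W scalars \<beta>"
  shows "t \<beta> = 0"
  using assms(1) by (induction rule: tspace_induct) (simp_all add: tens_def assms(2))

lemma tspace_eqI:
  assumes "s \<in> vcarrier (tspace V W)" "t \<in> vcarrier (tspace V W)"
    and "\<And>\<beta>. bilinear_on V W scalars \<beta> \<Longrightarrow> s \<beta> = t \<beta>"
  shows "s = t"
proof
  fix \<beta>
  show "s \<beta> = t \<beta>"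
    using assms(3) tspace_not_bilinear[OF assms(1)] tspace_not_bilinear[OF assms(2)]
    by (cases "bilinear_on V W scalars \<beta>") auto
qed

text \<open>A tensor is itself a function of forms, so a functional composed with a lifted map is
  computed by evaluating the tensor at the composed form. This turns Sweedler sums with values in a
  vector space into scalars.\<close>

lemma tlift_eval:
  assumes V: "is_vspace V" and W: "is_vspace W" and U: "is_vspace U" and b: "bilinear_on V W U b"
    and \<phi>: "linear_on U scalars \<phi>" and t: "t \<in> vcarrier (tspace V W)"
  shows "\<phi> (tlift V W b t) = t (\<lambda>x y. \<phi> (b x y))"
proof -
  have "bilinear_on V W scalars (\<lambda>x y. \<phi> (b x y))"
    by (intro bilinear_onI linear_on_comp[OF \<phi>] bilinear_onD[OF b])
  then show ?thesis
    using tspace_linear_unique[OF V W is_vspace_scalars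
        linear_on_comp[OF \<phi> linear_tlift[OF V W U b]] linear_eval _ t]
    by (simp add: tlift_tens[OF U b] tens_eval)
qed

text \<open>The two definite descriptions are compared directly: the lists that represent
  \<open>t\<close> have their entries in the carriers, where \<open>b\<close> and \<open>b'\<close>
  agree.\<close>

lemma tlift_cong:
  assumes "\<And>x y. x \<in> vcarrier V \<Longrightarrow> y \<in> vcarrier W \<Longrightarrow> b x y = b' x y"
  shows "tlift V W b t = tlift V W b' t"
proof -
  have "(\<Sum>(x, y)\<leftarrow>ps. b x y) = (\<Sum>(x, y)\<leftarrow>ps. b' x y)"
    if "set ps \<subseteq> vcarrier V \<times> vcarrier W" for ps
    using that assms by (induction ps) auto
  then have "(set ps \<subseteq> vcarrier V \<times> vcarrier W \<and> t = (\<Sum>(x, y)\<leftarrow>ps. tens V W x y) \<and> u = (\<Sum>(x, y)\<leftarrow>ps. b x y))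
    \<longleftrightarrow> (set ps \<subseteq> vcarrier V \<times> vcarrier W \<and> t = (\<Sum>(x, y)\<leftarrow>ps. tens V W x y) \<and> u = (\<Sum>(x, y)\<leftarrow>ps. b' x y))" for u ps
    by auto
  then show ?thesis unfolding tlift_def by presburger
qed

text \<open>Needed for nested Sweedler sums: the inner lift must be linear in the outer variable
  before the outer one can be taken. The assumption \<open>l\<close> settles pure tensors, and
  additivity in \<open>t\<close> does the rest.\<close>

lemma tlift_linear_param:
  assumes V: "is_vspace V" and W: "is_vspace W" and U: "is_vspace U" and Z: "is_vspace Z"
    and b: "\<And>z. z \<in> vcarrier Z \<Longrightarrow> bilinear_on V W U (b z)"
    and l: "\<And>x y. x \<in> vcarrier V \<Longrightarrow> y \<in> vcarrier W \<Longrightarrow> linear_on Z U (\<lambda>z. b z x y)"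
    and t: "t \<in> vcarrier (tspace V W)"
  shows "linear_on Z U (\<lambda>z. tlift V W (b z) t)"
proof -
  note T = linear_tlift[OF V W U b]
  have "(tlift V W (b (z1 + z2)) t = tlift V W (b z1) t + tlift V W (b z2) t
      \<and> tlift V W (b (vscale Z c z1)) t = vscale U c (tlift V W (b z1) t))"
    if z: "z1 \<in> vcarrier Z" "z2 \<in> vcarrier Z" for z1 z2 c
  proof -
    have z': "z1 + z2 \<in> vcarrier Z" "vscale Z c z1 \<in> vcarrier Z"
      using z is_vspace_ring[OF Z] by auto
    show ?thesis using t
    proof (induction rule: tspace_induct)
      case (pure x y)
      then show ?case using z z'
        by (simp add: tlift_tens[OF U b] linear_onD[OF l])
    next
      case zero
      show ?case using z z'
        by (simp only: linear_on_0[OF T is_vspace_tspace[OF V W]] is_vspace_ring[OF U] add_0)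
    next
      case (add s t)
      then show ?case using z z'
        by (simp only: linear_onD(2)[OF T] is_vspace_ring[OF U] add_ac simp_thms)
    qed
  qed
  moreover have "tlift V W (b z) t \<in> vcarrier U" if "z \<in> vcarrier Z" for z
    using linear_onD(1)[OF T[OF that] t] .
  ultimately show ?thesis unfolding linear_on_def by blast
qed

text \<open>\<open>dual_cop\<close>, \<open>tensor_alg\<close> and \<open>quantum_double\<close> are
  records of other types than the spaces on which they are built. The tensor constructions see only
  carrier and scaling, so results can be moved between these records.\<close>

lemma tspace_same:
  fixes V :: "('k::field, 'v::ab_group_add, 'x) vspace_scheme"
    and V' :: "('k, 'v, 'y) vspace_scheme"
    and W :: "('k, 'w::ab_group_add, 'z) vspace_scheme"
    and W' :: "('k, 'w, 'u) vspace_scheme"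
  assumes "vcarrier V = vcarrier V'" "vscale V = vscale V'"
    "vcarrier W = vcarrier W'" "vscale W = vscale W'"
  shows "tspace V W = tspace V' W'" and "tens V W = tens V' W'" and "tlift V W = tlift V' W'"
proof -
  have l: "linear_on V U f = linear_on V' U f" "linear_on W U g = linear_on W' U g"
    for U :: "('k, 'k) vspace" and f g
    using assms by (simp_all add: linear_on_def)
  show *: "tens V W = tens V' W'"
    using l by (simp add: tens_def bilinear_on_def assms fun_eq_iff)
  show "tspace V W = tspace V' W'" by (simp add: tspace_def * assms)
  show "tlift V W = tlift V' W'" by (simp add: tlift_def * assms fun_eq_iff)
qed

lemma is_vspace_same:
  assumes "vcarrier V = vcarrier V'" "vscale V = vscale V'"
  shows "is_vspace V = is_vspace V'"
  by (simp add: is_vspace_def assms)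

section \<open>Finite frames and coordinates of tensors\<close>

text \<open>A finite frame \<open>E\<close> with coordinate functionals \<open>C\<close>. The
  reconstruction formula is the property that passes to tensor products and allows two tensors to be
  compared on products of coordinate functionals.\<close>

definition coordinates ::
  "('k::field, 'v::ab_group_add, 'z) vspace_scheme \<Rightarrow> 'j set \<Rightarrow> ('j \<Rightarrow> 'v) \<Rightarrow> ('j \<Rightarrow> 'v \<Rightarrow> 'k) \<Rightarrow> bool"
  where "coordinates V J E C \<longleftrightarrow> is_vspace V \<and> finite J \<and>
    (\<forall>j\<in>J. E j \<in> vcarrier V \<and> linear_on V scalars (C j)) \<and>
    (\<forall>x\<in>vcarrier V. x = (\<Sum>j\<in>J. vscale V (C j x) (E j)))"

lemma linear_on_coordinates:
  assumes C: "coordinates V J E C" and f: "linear_on V W f" and x: "x \<in> vcarrier V"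
  shows "f x = (\<Sum>j\<in>J. vscale W (C j x) (f (E j)))"
proof -
  have V: "is_vspace V" and E: "\<And>j. j \<in> J \<Longrightarrow> E j \<in> vcarrier V"
    using C by (auto simp: coordinates_def)
  have "f x = f (\<Sum>j\<in>J. vscale V (C j x) (E j))"
    using C x unfolding coordinates_def by metis
  also have "\<dots> = (\<Sum>j\<in>J. f (vscale V (C j x) (E j)))"
    by (rule linear_on_sum(2)[OF f V]) (simp add: E is_vspace_ring[OF V])
  finally show ?thesis using E by (simp add: linear_onD[OF f])
qed

lemma bilinear_product:
  assumes "linear_on V scalars f" "linear_on W scalars g"
  shows "bilinear_on V W scalars (\<lambda>x y. f x * g y)"
  using assms by (auto simp: bilinear_on_def linear_on_def scalars_def algebra_simps)

text \<open>On a pure tensor this is the expansion of both arguments of the form in their frames;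
  both sides are additive in \<open>t\<close>.\<close>

lemma tensor_coordinates:
  assumes CV: "coordinates V J E C" and CW: "coordinates W L G C'"
    and \<beta>: "bilinear_on V W scalars \<beta>" and t: "t \<in> vcarrier (tspace V W)"
  shows "t \<beta> = (\<Sum>j\<in>J. \<Sum>l\<in>L. t (\<lambda>x y. C j x * C' l y) * \<beta> (E j) (G l))"
  using t
proof (induction rule: tspace_induct)
  case (pure x y)
  have "bilinear_on V W scalars (\<lambda>x y. C j x * C' l y)" if "j \<in> J" "l \<in> L" for j l
    using CV CW that by (intro bilinear_product) (auto simp: coordinates_def)
  then have *: "tens V W x y (\<lambda>x y. C j x * C' l y) = C j x * C' l y" if "j \<in> J" "l \<in> L" for j l
    using that by (simp add: tens_eval)
  have E: "E j \<in> vcarrier V" if "j \<in> J" for j using CV that by (simp add: coordinates_def)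
  have "\<beta> x y = (\<Sum>j\<in>J. C j x * \<beta> (E j) y)"
    using linear_on_coordinates[OF CV bilinear_onD(2)[OF \<beta> pure(2)] pure(1)]
    by (simp add: scalars_def)
  also have "\<dots> = (\<Sum>j\<in>J. C j x * (\<Sum>l\<in>L. C' l y * \<beta> (E j) (G l)))"
    using linear_on_coordinates[OF CW bilinear_onD(1)[OF \<beta> E] pure(2)]
    by (intro sum.cong) (auto simp: scalars_def)
  finally show ?case
    by (simp add: tens_eval[OF \<beta>] * sum_distrib_left mult.assoc)
qed (simp_all add: sum.distrib distrib_right)

lemma tensor_coordinates_eqI:
  assumes CV: "coordinates V J E C" and CW: "coordinates W L G C'"
    and s: "s \<in> vcarrier (tspace V W)" and t: "t \<in> vcarrier (tspace V W)"
    and "\<And>j l. j \<in> J \<Longrightarrow> l \<in> L \<Longrightarrow> s (\<lambda>x y. C j x * C' l y) = t (\<lambda>x y. C j x * C' l y)"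
  shows "s = t"
proof (rule tspace_eqI[OF s t])
  fix \<beta> assume \<beta>: "bilinear_on V W scalars \<beta>"
  show "s \<beta> = t \<beta>"
    using assms(5) by (simp add: tensor_coordinates[OF CV CW \<beta>] s t)
qed

lemma coordinates_tspace:
  assumes CV: "coordinates V J E C" and CW: "coordinates W L G C'"
  shows "coordinates (tspace V W) (J \<times> L) (\<lambda>(j, l). tens V W (E j) (G l))
    (\<lambda>(j, l) t. t (\<lambda>x y. C j x * C' l y))"
proof -
  have V: "is_vspace V" and W: "is_vspace W" and fin: "finite J" "finite L"
    and EG: "\<And>j. j \<in> J \<Longrightarrow> E j \<in> vcarrier V" "\<And>l. l \<in> L \<Longrightarrow> G l \<in> vcarrier W"
    using CV CW by (auto simp: coordinates_def)
  note VW = is_vspace_tspace[OF V W]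
  have "t = (\<Sum>(j, l)\<in>J \<times> L. vscale (tspace V W) (t (\<lambda>x y. C j x * C' l y)) (tens V W (E j) (G l)))"
    if t: "t \<in> vcarrier (tspace V W)" for t
  proof (rule tspace_eqI[OF t])
    show "(\<Sum>(j, l)\<in>J \<times> L. vscale (tspace V W) (t (\<lambda>x y. C j x * C' l y)) (tens V W (E j) (G l)))
      \<in> vcarrier (tspace V W)"
      by (intro vspace_sum_closed[OF VW]) (auto intro!: is_vspace_ring(8)[OF VW] tens_closed EG)
    fix \<beta> assume \<beta>: "bilinear_on V W scalars \<beta>"
    show "t \<beta> = (\<Sum>(j, l)\<in>J \<times> L.
        vscale (tspace V W) (t (\<lambda>x y. C j x * C' l y)) (tens V W (E j) (G l))) \<beta>"
      by (simp add: tensor_coordinates[OF CV CW \<beta> t] sum.cartesian_product case_prod_unfold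
          sum_fun_apply tspace_eval tens_eval[OF \<beta>])
  qed
  then show ?thesis
    using fin EG VW by (auto simp: coordinates_def case_prod_unfold tens_closed linear_eval)
qed

section \<open>Tensor products of algebras\<close>

lemma tensor_mul_bilinear:
  assumes A: "is_vspace A" "bilinear_on A A A (mul A)" and B: "is_vspace B" "bilinear_on B B B (mul B)"
  shows "a \<in> vcarrier A \<Longrightarrow> b \<in> vcarrier B \<Longrightarrow>
      bilinear_on A B (tspace A B) (\<lambda>c d. tens A B (mul A a c) (mul B b d))"
    and "t \<in> vcarrier (tspace A B) \<Longrightarrow> bilinear_on A B (tspace A B)
      (\<lambda>a b. tlift A B (\<lambda>c d. tens A B (mul A a c) (mul B b d)) t)"
proof -
  let ?U = "tspace A B"
  note U = is_vspace_tspace[OF A(1) B(1)]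
  have l: "linear_on A ?U (\<lambda>x. tens A B (f x) d)" if "linear_on A A f" "d \<in> vcarrier B" for f d
    using linear_on_comp[OF bilinear_onD(2)[OF bilinear_tens[OF A(1) B(1)]]] that by blast
  have r: "linear_on B ?U (\<lambda>x. tens A B c (f x))" if "linear_on B B f" "c \<in> vcarrier A" for f c
    using linear_on_comp[OF bilinear_onD(1)[OF bilinear_tens[OF A(1) B(1)]]] that by blast
  note mA = linear_onD(1)[OF bilinear_onD(1)[OF A(2)]] and mB = linear_onD(1)[OF bilinear_onD(1)[OF B(2)]]
  show b1: "bilinear_on A B ?U (\<lambda>c d. tens A B (mul A a c) (mul B b d))"
    if "a \<in> vcarrier A" "b \<in> vcarrier B" for a b
    using that by (intro bilinear_onI l r bilinear_onD[OF A(2)] bilinear_onD[OF B(2)] mA mB)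
  have b2: "bilinear_on A B ?U (\<lambda>a b. tens A B (mul A a c) (mul B b d))"
    if "c \<in> vcarrier A" "d \<in> vcarrier B" for c d
    using that by (intro bilinear_onI l r bilinear_onD[OF A(2)] bilinear_onD[OF B(2)] mA mB)
  show "bilinear_on A B ?U (\<lambda>a b. tlift A B (\<lambda>c d. tens A B (mul A a c) (mul B b d)) t)"
    if "t \<in> vcarrier ?U" for t
    using that by (intro bilinear_onI tlift_linear_param A B U b1 bilinear_onD[OF b2])
qed

lemma tensor_alg_bilinear:
  assumes A: "is_vspace A" "bilinear_on A A A (mul A)" and B: "is_vspace B" "bilinear_on B B B (mul B)"
  shows "bilinear_on (tensor_alg A B) (tensor_alg A B) (tensor_alg A B) (mul (tensor_alg A B))"
    and "a \<in> vcarrier A \<Longrightarrow> b \<in> vcarrier B \<Longrightarrow> c \<in> vcarrier A \<Longrightarrow> d \<in> vcarrier B \<Longrightarrow>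
      mul (tensor_alg A B) (tens A B a b) (tens A B c d) = tens A B (mul A a c) (mul B b d)"
    and "is_vspace (tensor_alg A B)"
proof -
  let ?U = "tspace A B"
  note U = is_vspace_tspace[OF A(1) B(1)]
  show "is_vspace (tensor_alg A B)"
    using U by (subst is_vspace_same[of _ ?U]) (auto simp: tensor_alg_def)
  note b1 = tensor_mul_bilinear(1)[OF A B] and b3 = tensor_mul_bilinear(2)[OF A B]
  have m: "mul (tensor_alg A B) s t =
      tlift A B (\<lambda>a b. tlift A B (\<lambda>c d. tens A B (mul A a c) (mul B b d)) t) s" for s t
    by (simp add: tensor_alg_def)
  have "bilinear_on ?U ?U ?U (mul (tensor_alg A B))"
    unfolding m[abs_def]
  proof (rule bilinear_onI)
    fix s assume "s \<in> vcarrier ?U"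
    then show "linear_on ?U ?U (\<lambda>t. tlift A B (\<lambda>a b. tlift A B (\<lambda>c d. tens A B (mul A a c) (mul B b d)) t) s)"
      by (intro tlift_linear_param A B U b3 linear_tlift b1)
  next
    fix t assume "t \<in> vcarrier ?U"
    then show "linear_on ?U ?U (\<lambda>s. tlift A B (\<lambda>a b. tlift A B (\<lambda>c d. tens A B (mul A a c) (mul B b d)) t) s)"
      by (intro A B U b3 linear_tlift)
  qed
  then show "bilinear_on (tensor_alg A B) (tensor_alg A B) (tensor_alg A B) (mul (tensor_alg A B))"
    by (simp add: bilinear_on_def linear_on_def tensor_alg_def)
  assume "a \<in> vcarrier A" "b \<in> vcarrier B" "c \<in> vcarrier A" "d \<in> vcarrier B"
  then show "mul (tensor_alg A B) (tens A B a b) (tens A B c d) = tens A B (mul A a c) (mul B b d)"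
    unfolding m by (simp add: tlift_tens[OF U b3] tlift_tens[OF U b1] tens_closed)
qed

text \<open>Agreement on the carriers also decides alike whether the two forms are bilinear, so the
  default value 0 does no harm.\<close>

lemma tspace_eval_cong:
  assumes "is_vspace V" "is_vspace W" "t \<in> vcarrier (tspace V W)"
    and "\<And>x y. x \<in> vcarrier V \<Longrightarrow> y \<in> vcarrier W \<Longrightarrow> \<beta> x y = \<gamma> x y"
  shows "t \<beta> = t \<gamma>"
proof -
  have "bilinear_on V W scalars \<beta> = bilinear_on V W scalars \<gamma>"
    using assms by (intro bilinear_on_cong)
  with assms(3) show ?thesis
    using assms(4) by (induction rule: tspace_induct) (simp_all add: tens_def)
qed



text \<open>The product consists of two nested lifts, and the evaluation passes through them one
  after the other. The inner equation holds on the carriers, which is enough for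
  \<open>tspace_eval_cong\<close>.\<close>

lemma tensor_alg_mul_eval:
  assumes A: "is_vspace A" "bilinear_on A A A (mul A)" and B: "is_vspace B" "bilinear_on B B B (mul B)"
    and s: "s \<in> vcarrier (tspace A B)" and t: "t \<in> vcarrier (tspace A B)"
    and \<beta>: "bilinear_on A B scalars \<beta>"
  shows "mul (tensor_alg A B) s t \<beta> = s (\<lambda>a b. t (\<lambda>c d. \<beta> (mul A a c) (mul B b d)))"
proof -
  let ?U = "tspace A B"
  note U = is_vspace_tspace[OF A(1) B(1)]
  note b1 = tensor_mul_bilinear(1)[OF A B] and b3 = tensor_mul_bilinear(2)[OF A B t]
  have "mul (tensor_alg A B) s t \<beta>
      = s (\<lambda>a b. tlift A B (\<lambda>c d. tens A B (mul A a c) (mul B b d)) t \<beta>)"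
    unfolding tensor_alg_def using tlift_eval[OF A(1) B(1) U b3 linear_eval s] by simp
  also have "\<dots> = s (\<lambda>a b. t (\<lambda>c d. \<beta> (mul A a c) (mul B b d)))"
    using tlift_eval[OF A(1) B(1) U b1 linear_eval t]
    by (intro tspace_eval_cong[OF A(1) B(1) s]) (simp add: tens_eval[OF \<beta>])
  finally show ?thesis .
qed

lemma bilinear_mul:
  assumes m: "bilinear_on U U U m" and U: "is_vspace U"
  shows "s \<in> vcarrier U \<Longrightarrow> t \<in> vcarrier U \<Longrightarrow> m s t \<in> vcarrier U"
    and "s \<in> vcarrier U \<Longrightarrow> t \<in> vcarrier U \<Longrightarrow> r \<in> vcarrier U \<Longrightarrow> m (s + t) r = m s r + m t r"
    and "s \<in> vcarrier U \<Longrightarrow> t \<in> vcarrier U \<Longrightarrow> r \<in> vcarrier U \<Longrightarrow> m r (s + t) = m r s + m r t"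
    and "r \<in> vcarrier U \<Longrightarrow> m 0 r = 0" "r \<in> vcarrier U \<Longrightarrow> m r 0 = 0"
  using linear_onD[OF bilinear_onD(1)[OF m]] linear_onD[OF bilinear_onD(2)[OF m]]
    linear_on_0[OF bilinear_onD(1)[OF m] U] linear_on_0[OF bilinear_onD(2)[OF m] U]
  by (simp_all only:)

text \<open>Associativity is additive in each of the three factors, hence reduces to pure tensors by
  three nested inductions. The factors \<open>A\<close> and \<open>B\<close> are kept general so
  that \<open>B\<close> can be a tensor algebra again, as is needed for threefold tensors.\<close>

lemma tensor_alg_assoc:
  assumes A: "is_vspace A" "bilinear_on A A A (mul A)" and B: "is_vspace B" "bilinear_on B B B (mul B)"
    and aA: "\<And>x y z. x \<in> vcarrier A \<Longrightarrow> y \<in> vcarrier A \<Longrightarrow> z \<in> vcarrier A \<Longrightarrow>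
      mul A (mul A x y) z = mul A x (mul A y z)"
    and aB: "\<And>x y z. x \<in> vcarrier B \<Longrightarrow> y \<in> vcarrier B \<Longrightarrow> z \<in> vcarrier B \<Longrightarrow>
      mul B (mul B x y) z = mul B x (mul B y z)"
    and r: "r \<in> vcarrier (tspace A B)" and s: "s \<in> vcarrier (tspace A B)" and t: "t \<in> vcarrier (tspace A B)"
  shows "mul (tensor_alg A B) (mul (tensor_alg A B) r s) t = mul (tensor_alg A B) r (mul (tensor_alg A B) s t)"
proof -
  note m = tensor_alg_bilinear[OF A B]
  have c: "vcarrier (tensor_alg A B) = vcarrier (tspace A B)" by (simp add: tensor_alg_def)
  note add = bilinear_mul[OF m(1,3), unfolded c]
  have mA: "mul A x y \<in> vcarrier A" if "x \<in> vcarrier A" "y \<in> vcarrier A" for x y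
    using linear_onD(1)[OF bilinear_onD(1)[OF A(2)]] that .
  have mB: "mul B x y \<in> vcarrier B" if "x \<in> vcarrier B" "y \<in> vcarrier B" for x y
    using linear_onD(1)[OF bilinear_onD(1)[OF B(2)]] that .
  have z: "0 \<in> vcarrier (tspace A B)" using is_vspace_ring(6)[OF is_vspace_tspace[OF A(1) B(1)]] .
  show ?thesis
    using r
  proof (induction rule: tspace_induct)
    case (pure a b)
    show ?case using s
    proof (induction rule: tspace_induct)
      case (pure a' b')
      show ?case using t
      proof (induction rule: tspace_induct)
        case (pure a'' b'')
        with \<open>a \<in> _\<close> \<open>b \<in> _\<close> \<open>a' \<in> _\<close> \<open>b' \<in> _\<close> show ?case
          by (simp add: m(2) mA mB aA aB)
      qed (use \<open>a \<in> _\<close> \<open>b \<in> _\<close> pure in \<open>simp_all only: add tens_closed\<close>)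
    qed (use t pure in \<open>simp_all only: add tens_closed\<close>)
  qed (use s t in \<open>simp_all only: add\<close>)
qed

section \<open>Sweedler calculus in a biperfect weak Hopf algebra\<close>

locale double_setup =
  fixes H :: "('k::field, 'h::ab_group_add) bialg"
    and T :: "'h \<Rightarrow> 'h"
    and I :: "'i set"
    and e :: "'i \<Rightarrow> 'h"
    and e' :: "'i \<Rightarrow> 'h \<Rightarrow> 'k"
  assumes fin_dim: "finite_dim H"
    and biperf: "biperfect H T"
    and bijT: "bij_betw T (vcarrier H) (vcarrier H)"
    and basis: "is_basis H I e"
    and dual: "is_dual_basis H I e e'"
begin

abbreviation sc where "sc \<equiv> vscale H"
abbreviation cH where "cH \<equiv> vcarrier H"

lemma weak_hopf_HT: "weak_hopf H T" and anti: "anti_bialgebra_morphism H T"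
  and central: "x \<in> cH \<Longrightarrow> convol H id T x \<in> center H"
  and coperf: "x \<in> cH \<Longrightarrow> sw3 H (\<lambda>x1 x2 x3. tens H H (mul H x1 (T x2)) x3) x =
        sw3 H (\<lambda>x1 x2 x3. tens H H (mul H x2 (T x3)) x1) x"
  using biperf by (auto simp: biperfect_def perfect_def coperfect_def)

lemma almost: "is_algebra H" "is_coalgebra H"
  and comul_mul: "x \<in> cH \<Longrightarrow> y \<in> cH \<Longrightarrow> comul H (mul H x y) = mul (tensor_alg H H) (comul H x) (comul H y)"
  and comul_one: "comul H (unity H) = tens H H (unity H) (unity H)"
  and eps_mul: "x \<in> cH \<Longrightarrow> y \<in> cH \<Longrightarrow> counit H (mul H x y) = counit H x * counit H y"
  and eps_one: "counit H (unity H) = 1"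
  and T_linear: "linear_on H H T"
  and convol1: "x \<in> cH \<Longrightarrow> convol H (convol H id T) id x = x"
  and convol2: "x \<in> cH \<Longrightarrow> convol H (convol H T id) T x = T x"
  using weak_hopf_HT by (auto simp: weak_hopf_def is_bialgebra_def almost_bialgebra_def tensor_alg_def)

lemma Hv: "is_vspace H" and mul_bil: "bilinear_on H H H (mul H)" and one_in [simp]: "unity H \<in> cH"
  and mul_assoc: "x \<in> cH \<Longrightarrow> y \<in> cH \<Longrightarrow> z \<in> cH \<Longrightarrow> mul H (mul H x y) z = mul H x (mul H y z)"
  and mul_one: "x \<in> cH \<Longrightarrow> mul H (unity H) x = x" "x \<in> cH \<Longrightarrow> mul H x (unity H) = x"
  using almost(1) by (auto simp: is_algebra_def)

lemma comul_linear: "linear_on H (tspace H H) (comul H)"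
  and eps_linear: "linear_on H scalars (counit H)"
  and coassoc: "x \<in> cH \<Longrightarrow> sw2 H (\<lambda>y x3. sw2 H (\<lambda>x1 x2. tens3 H x1 x2 x3) y) x =
        sw2 H (\<lambda>x1 y. sw2 H (\<lambda>x2 x3. tens3 H x1 x2 x3) y) x"
  and counit: "x \<in> cH \<Longrightarrow> sw2 H (\<lambda>x1 x2. sc (counit H x1) x2) x = x"
    "x \<in> cH \<Longrightarrow> sw2 H (\<lambda>x1 x2. sc (counit H x2) x1) x = x"
  using almost(2) by (auto simp: is_coalgebra_def)

lemma T_mul: "x \<in> cH \<Longrightarrow> y \<in> cH \<Longrightarrow> T (mul H x y) = mul H (T y) (T x)"
  and T_one: "T (unity H) = unity H"
  and T_comul: "x \<in> cH \<Longrightarrow> comul H (T x) = sw2 H (\<lambda>x1 x2. tens H H (T x2) (T x1)) x"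
  and T_eps: "x \<in> cH \<Longrightarrow> counit H (T x) = counit H x"
  using anti by (auto simp: anti_bialgebra_morphism_def)

lemma T_in: "x \<in> cH \<Longrightarrow> T x \<in> cH"
  and mul_in: "x \<in> cH \<Longrightarrow> y \<in> cH \<Longrightarrow> mul H x y \<in> cH"
  and comul_in: "x \<in> cH \<Longrightarrow> comul H x \<in> vcarrier (tspace H H)"
  using linear_onD(1)[OF T_linear] linear_onD(1)[OF bilinear_onD(1)[OF mul_bil]]
    linear_onD(1)[OF comul_linear] by auto

sublocale vector_space sc using Hv by (simp add: is_vspace_def)

section \<open>The finite basis, coordinate functionals and the projection onto the carrier\<close>

lemma finI: "finite I" and e_in: "i \<in> I \<Longrightarrow> e i \<in> cH"
proof -
  from fin_dim obtain B where "finite B" "span B = cH" by (auto simp: finite_dim_def)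
  moreover have "independent (e ` I)" "e ` I \<subseteq> cH" "inj_on e I"
    using basis span_superset[of "e ` I"] by (auto simp: is_basis_def)
  ultimately show "finite I" using independent_span_bound[of B "e ` I"] by (auto dest: finite_imageD)
  show "i \<in> I \<Longrightarrow> e i \<in> cH" using \<open>e ` I \<subseteq> cH\<close> by auto
qed

lemma coordinate_functional_exists:
  "\<exists>g. Vector_Spaces.linear sc (*) g \<and> (\<forall>j\<in>I. g (e j) = (if i = j then 1 else 0))"
proof -
  interpret F: vector_space "(*) :: 'k \<Rightarrow> 'k \<Rightarrow> 'k" by unfold_locales (auto simp: algebra_simps)
  interpret vector_space_pair sc "(*) :: 'k \<Rightarrow> 'k \<Rightarrow> 'k" ..
  have "independent (e ` I)" and inj: "inj_on e I" using basis by (auto simp: is_basis_def)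
  from linear_independent_extend[OF this(1), of "\<lambda>b. if b \<in> e ` I \<and> i = inv_into I e b then 1 else 0"]
  show ?thesis using inj by fastforce
qed

definition coord :: "'i \<Rightarrow> 'h \<Rightarrow> 'k" where
  "coord i = (SOME g. Vector_Spaces.linear sc (*) g \<and> (\<forall>j\<in>I. g (e j) = (if i = j then 1 else 0)))"

lemma coord_add [simp]: "coord i (x + y) = coord i x + coord i y"
  and coord_sc [simp]: "coord i (sc c x) = c * coord i x"
  and coord_e: "j \<in> I \<Longrightarrow> coord i (e j) = (if i = j then 1 else 0)"
proof -
  have *: "Vector_Spaces.linear sc (*) (coord i) \<and> (\<forall>j\<in>I. coord i (e j) = (if i = j then 1 else 0))"
    unfolding coord_def by (rule someI_ex[OF coordinate_functional_exists])
  interpret coord: Vector_Spaces.linear sc "(*)" "coord i" using * by blast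
  show "coord i (x + y) = coord i x + coord i y" "coord i (sc c x) = c * coord i x"
    by (simp_all add: coord.add coord.scale)
  show "j \<in> I \<Longrightarrow> coord i (e j) = (if i = j then 1 else 0)" using * by blast
qed

lemma coord_0 [simp]: "coord i 0 = 0"
  using coord_sc[of i 0 0] by simp

lemma coord_sum [simp]: "coord i (sum f J) = (\<Sum>j\<in>J. coord i (f j))"
  by (induction J rule: infinite_finite_induct) auto

text \<open>A linear projection onto the carrier. All structure maps are made total by precomposing with
  it, so that the laws below hold without membership conditions.\<close>

definition proj :: "'h \<Rightarrow> 'h" where "proj x = (\<Sum>i\<in>I. sc (coord i x) (e i))"

lemma proj_in [simp]: "proj x \<in> cH"
  unfolding proj_def by (intro vspace_sum_closed[OF Hv] is_vspace_ring(8)[OF Hv] e_in)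

lemma proj_add [simp]: "proj (x + y) = proj x + proj y"
  by (simp add: proj_def sum.distrib scale_left_distrib)

lemma proj_sc [simp]: "proj (sc c x) = sc c (proj x)"
  by (simp add: proj_def scale_sum_right)

lemma proj_e: "i \<in> I \<Longrightarrow> proj (e i) = e i"
  using finI by (simp add: proj_def coord_e if_distrib[of "\<lambda>c. sc c _"] cong: if_cong)

lemma proj_id: assumes "x \<in> cH" shows "proj x = x"
proof -
  have "x \<in> span (e ` I)" using assms basis by (simp add: is_basis_def)
  then show ?thesis
    by (induction rule: span_induct) (auto simp: subspace_def proj_e, simp add: proj_def)
qed

lemma proj_proj [simp]: "proj (proj x) = proj x"
  by (simp add: proj_id)

lemma coordinates_H: "coordinates H I e coord"
  unfolding coordinates_def using Hv finI e_in proj_id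
  by (simp add: proj_def linear_on_def scalars_def)

lemma coord_dual: "i \<in> I \<Longrightarrow> x \<in> cH \<Longrightarrow> e' i x = coord i x"
proof -
  assume i: "i \<in> I" and x: "x \<in> cH"
  then have l: "linear_on H scalars (e' i)" and d: "\<And>j. j \<in> I \<Longrightarrow> e' i (e j) = (if i = j then 1 else 0)"
    using dual by (auto simp: is_dual_basis_def dual_space_def)
  have "e' i x = (\<Sum>j\<in>I. coord j x * e' i (e j))"
    using linear_on_coordinates[OF coordinates_H l x] by (simp add: scalars_def)
  also have "\<dots> = (\<Sum>j\<in>I. if i = j then coord j x else 0)"
    by (intro sum.cong) (auto simp: d)
  finally show ?thesis using i finI by simp
qed

text \<open>Linear functionals on the carrier, extended to the whole type along the projection.\<close>

definition lin :: "('h \<Rightarrow> 'k) \<Rightarrow> bool" where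
  "lin F \<longleftrightarrow> (\<forall>x y. F (x + y) = F x + F y) \<and> (\<forall>c x. F (sc c x) = c * F x) \<and> (\<forall>x. F (proj x) = F x)"

lemma linD: assumes "lin F"
  shows "F (x + y) = F x + F y" "F (sc c x) = c * F x" "F (proj x) = F x"
  using assms by (auto simp: lin_def)

lemma lin_0: "lin F \<Longrightarrow> F 0 = 0"
  using linD(2)[of F 0 0] by simp

lemma lin_sum: "lin F \<Longrightarrow> F (sum f J) = (\<Sum>j\<in>J. F (f j))"
  by (induction J rule: infinite_finite_induct) (auto simp: lin_0 linD)

lemma lin_expand: "lin F \<Longrightarrow> F x = (\<Sum>i\<in>I. coord i x * F (e i))"
  using linD(3)[of F x] unfolding proj_def by (simp add: lin_sum linD)

lemma lin_linear_on: "lin F \<Longrightarrow> linear_on H scalars F"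
  by (simp add: lin_def linear_on_def scalars_def)

lemma lin_coord: "i \<in> I \<Longrightarrow> lin (coord i)"
  unfolding lin_def using finI by (simp add: proj_def coord_e if_distrib[of "\<lambda>c. _ * c"] cong: if_cong)

section \<open>Multilinear forms and scalar Sweedler sums\<close>

definition bil :: "('h \<Rightarrow> 'h \<Rightarrow> 'k) \<Rightarrow> bool" where
  "bil F \<longleftrightarrow> (\<forall>x. lin (F x)) \<and> (\<forall>y. lin (\<lambda>x. F x y))"

definition tril :: "('h \<Rightarrow> 'h \<Rightarrow> 'h \<Rightarrow> 'k) \<Rightarrow> bool" where
  "tril F \<longleftrightarrow> (\<forall>x. bil (F x)) \<and> (\<forall>y z. lin (\<lambda>x. F x y z))"

text \<open>These are equations between functions so that they also apply under eta-contraction.\<close>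

lemma bilD: assumes "bil F"
  shows "F (x + y) = (\<lambda>z. F x z + F y z)" "F (sc c x) = (\<lambda>z. c * F x z)" "F (proj x) = F x"
    "F z (x + y) = F z x + F z y" "F z (sc c x) = c * F z x" "F z (proj x) = F z x"
  using assms by (auto simp: bil_def lin_def fun_eq_iff)

lemma trilD: assumes "tril F"
  shows "F (x + y) = (\<lambda>z w. F x z w + F y z w)" "F (sc c x) = (\<lambda>z w. c * F x z w)" "F (proj x) = F x"
    "F z (x + y) = (\<lambda>w. F z x w + F z y w)" "F z (sc c x) = (\<lambda>w. c * F z x w)" "F z (proj x) = F z x"
    "F z w (x + y) = F z w x + F z w y" "F z w (sc c x) = c * F z w x" "F z w (proj x) = F z w x"
  using assms by (auto simp: tril_def bil_def lin_def fun_eq_iff)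

lemma bil_bilinear_on: "bil F \<Longrightarrow> bilinear_on H H scalars F"
  by (simp add: bil_def bilinear_on_def lin_linear_on)

text \<open>\<open>cop x F\<close> is the scalar Sweedler sum \<open>\<Sum> F x' x''\<close>. Because \<open>F\<close> is only evaluated at basis vectors,
  \<open>cop x\<close> is linear and coassociative on arbitrary, not just bilinear, functions.\<close>

definition cop :: "'h \<Rightarrow> ('h \<Rightarrow> 'h \<Rightarrow> 'k) \<Rightarrow> 'k" where
  "cop x F = (\<Sum>(i, j)\<in>I \<times> I. comul H (proj x) (\<lambda>u v. coord i u * coord j v) * F (e i) (e j))"

lemma cop_add [simp]: "cop (x + y) F = cop x F + cop y F"
  by (simp add: cop_def linear_onD(2)[OF comul_linear] distrib_right sum.distrib case_prod_unfold)

lemma cop_sc [simp]: "cop (sc c x) F = c * cop x F"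
  by (simp add: cop_def linear_onD(3)[OF comul_linear] tspace_eval sum_distrib_left mult.assoc
      case_prod_unfold)

lemma cop_proj [simp]: "cop (proj x) F = cop x F"
  by (simp add: cop_def)

lemma lin_cop: "lin (\<lambda>x. cop x F)"
  by (simp add: lin_def)

lemma cop_plus [simp]: "cop x (\<lambda>u v. F u v + G u v) = cop x F + cop x G"
  by (simp add: cop_def distrib_left sum.distrib case_prod_unfold)

lemma cop_mult [simp]: "cop x (\<lambda>u v. c * F u v) = c * cop x F"
    "cop x (\<lambda>u v. F u v * c) = cop x F * c"
  by (simp_all add: cop_def sum_distrib_left sum_distrib_right ac_simps case_prod_unfold)

lemma cop_sum: "cop x (\<lambda>u v. \<Sum>j\<in>J. F j u v) = (\<Sum>j\<in>J. cop x (F j))"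
proof (cases "finite J")
  case True
  then show ?thesis by (induction J) (auto simp: cop_def)
qed (simp add: cop_def)

lemma cop_commute: "cop x (\<lambda>u v. cop y (\<lambda>a b. F u v a b)) = cop y (\<lambda>a b. cop x (\<lambda>u v. F u v a b))"
  unfolding cop_def[of x] by (simp add: case_prod_unfold cop_sum)

lemma cop_cong: "(\<And>u v. u \<in> cH \<Longrightarrow> v \<in> cH \<Longrightarrow> F u v = G u v) \<Longrightarrow> cop x F = cop x G"
  unfolding cop_def by (intro sum.cong) (auto simp: e_in)

lemma comul_cop:
  assumes "x \<in> cH" "bilinear_on H H scalars F"
  shows "comul H x F = cop x F"
  using tensor_coordinates[OF coordinates_H coordinates_H assms(2) comul_in[OF assms(1)]]
  by (simp add: cop_def proj_id assms(1) sum.cartesian_product)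

text \<open>The bridge from \<open>sw2\<close>, with values in an arbitrary space, to the scalar
  sums \<open>cop\<close>. It translates the axioms of \<open>H\<close>, which are stated with
  \<open>sw2\<close>, into equations between values of \<open>cop\<close>.\<close>

lemma sw2_eval:
  assumes "is_vspace U" "bilinear_on H H U b" "linear_on U scalars \<phi>" "x \<in> cH"
  shows "\<phi> (sw2 H b x) = cop x (\<lambda>u v. \<phi> (b u v))"
proof -
  have "bilinear_on H H scalars (\<lambda>x y. \<phi> (b x y))"
    by (intro bilinear_onI linear_on_comp[OF assms(3)] bilinear_onD[OF assms(2)])
  then show ?thesis
    using tlift_eval[OF Hv Hv assms(1,2,3) comul_in[OF assms(4)]] comul_cop[OF assms(4)]
    by (simp add: sw2_def)
qed

lemma sw2_linear:
  assumes "is_vspace U" "bilinear_on H H U b"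
  shows "linear_on H U (sw2 H b)"
  unfolding sw2_def by (rule linear_on_comp[OF linear_tlift[OF Hv Hv assms] comul_linear])

lemma sw2_param:
  assumes U: "is_vspace U" and Z: "is_vspace Z"
    and b: "\<And>z. z \<in> vcarrier Z \<Longrightarrow> bilinear_on H H U (b z)"
    and l: "\<And>x y. x \<in> cH \<Longrightarrow> y \<in> cH \<Longrightarrow> linear_on Z U (\<lambda>z. b z x y)"
    and x: "x \<in> cH"
  shows "linear_on Z U (\<lambda>z. sw2 H (b z) x)"
  unfolding sw2_def by (rule tlift_linear_param[OF Hv Hv U Z b l comul_in[OF x]])

lemma tens3_linear:
  assumes V: "is_vspace V"
  shows "x \<in> vcarrier V \<Longrightarrow> y \<in> vcarrier V \<Longrightarrow> linear_on V (tspace V (tspace V V)) (tens3 V x y)"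
    "x \<in> vcarrier V \<Longrightarrow> z \<in> vcarrier V \<Longrightarrow> linear_on V (tspace V (tspace V V)) (\<lambda>y. tens3 V x y z)"
    "y \<in> vcarrier V \<Longrightarrow> z \<in> vcarrier V \<Longrightarrow> linear_on V (tspace V (tspace V V)) (\<lambda>x. tens3 V x y z)"
proof -
  note VV = is_vspace_tspace[OF V V] and b = bilinear_onD[OF bilinear_tens]
  show "x \<in> vcarrier V \<Longrightarrow> y \<in> vcarrier V \<Longrightarrow> linear_on V (tspace V (tspace V V)) (tens3 V x y)"
    "x \<in> vcarrier V \<Longrightarrow> z \<in> vcarrier V \<Longrightarrow> linear_on V (tspace V (tspace V V)) (\<lambda>y. tens3 V x y z)"
    "y \<in> vcarrier V \<Longrightarrow> z \<in> vcarrier V \<Longrightarrow> linear_on V (tspace V (tspace V V)) (\<lambda>x. tens3 V x y z)"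
    unfolding tens3_def
    by (rule linear_on_comp[OF b(1)[OF V VV]]; (assumption | rule b V)+)
      (rule linear_on_comp[OF b(1)[OF V VV]]; (assumption | rule b V)+ | (rule b V VV tens_closed | assumption)+)+
qed


section \<open>Total structure maps and the inverse antipode\<close>

definition tmul :: "'h \<Rightarrow> 'h \<Rightarrow> 'h" (infixl "\<star>" 75) where "x \<star> y = mul H (proj x) (proj y)"
definition S :: "'h \<Rightarrow> 'h" where "S x = inv_into cH T (proj x)"
definition eps :: "'h \<Rightarrow> 'k" where "eps x = counit H (proj x)"
definition one :: "'h" where "one = unity H"

lemma mul_tmul: "x \<in> cH \<Longrightarrow> y \<in> cH \<Longrightarrow> mul H x y = x \<star> y"
  by (simp add: tmul_def proj_id)

lemma tmul_in [simp]: "x \<star> y \<in> cH"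
  by (simp add: tmul_def mul_in)

lemma S_in [simp]: "S x \<in> cH"
  unfolding S_def using bij_betw_imp_surj_on[OF bijT] by (simp add: inv_into_into)

lemma one_cH [simp]: "one \<in> cH"
  by (simp add: one_def)

lemma T_S: "T (S x) = proj x" and S_T: "x \<in> cH \<Longrightarrow> S (T x) = x"
  using bij_betw_inv_into_right[OF bijT] bij_betw_inv_into_left[OF bijT]
  by (auto simp: S_def proj_id T_in)

lemma T_inj: "x \<in> cH \<Longrightarrow> y \<in> cH \<Longrightarrow> T x = T y \<Longrightarrow> x = y"
  using bijT by (auto simp: bij_betw_def inj_on_def)

lemma tmul_simps [simp]:
  "(x + y) \<star> z = x \<star> z + y \<star> z" "z \<star> (x + y) = z \<star> x + z \<star> y"
  "sc c x \<star> y = sc c (x \<star> y)" "x \<star> sc c y = sc c (x \<star> y)"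
  "proj x \<star> y = x \<star> y" "x \<star> proj y = x \<star> y" "proj (x \<star> y) = x \<star> y"
  by (simp_all add: tmul_def linear_onD(2,3)[OF bilinear_onD(1)[OF mul_bil]]
      linear_onD(2,3)[OF bilinear_onD(2)[OF mul_bil]] proj_id mul_in)

lemma tmul_assoc: "x \<star> y \<star> z = x \<star> (y \<star> z)"
  by (simp add: tmul_def proj_id mul_in mul_assoc)

lemma tmul_one [simp]: "one \<star> x = proj x" "x \<star> one = proj x"
  by (simp_all add: tmul_def one_def proj_id mul_one)

lemma proj_one [simp]: "proj one = one" and proj_S [simp]: "proj (S x) = S x"
  by (simp_all add: proj_id)

text \<open>\<open>T\<close> is injective on the carrier, so additivity, homogeneity and the
  reversal of products are verified after \<open>T\<close> is applied to both sides.\<close>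

lemma S_simps [simp]:
  "S (x + y) = S x + S y" "S (sc c x) = sc c (S x)" "S (proj x) = S x" "S one = one"
  "S (x \<star> y) = S y \<star> S x"
proof -
  note [simp] = is_vspace_ring(7,8)[OF Hv]
  show "S (x + y) = S x + S y"
    by (rule T_inj) (simp_all add: T_S linear_onD(2)[OF T_linear])
  show "S (sc c x) = sc c (S x)"
    by (rule T_inj) (simp_all add: T_S linear_onD(3)[OF T_linear])
  have "T one = one" by (simp add: one_def T_one)
  then show "S one = one" using S_T[of one] by simp
  show "S (proj x) = S x" by (simp add: S_def)
  have "T (S y \<star> S x) = x \<star> y"
    by (simp add: tmul_def proj_id T_mul T_S)
  then show "S (x \<star> y) = S y \<star> S x"
    by (intro T_inj[of "S (x \<star> y)"]) (simp_all add: T_S)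
qed

lemma eps_simps [simp]:
  "eps (x + y) = eps x + eps y" "eps (sc c x) = c * eps x" "eps (proj x) = eps x" "eps one = 1"
  "eps (x \<star> y) = eps x * eps y" "eps (S x) = eps x"
  using T_eps[of "S x"]
  by (simp_all add: eps_def linear_onD[OF eps_linear] proj_id eps_mul mul_in tmul_def T_S)
    (simp_all add: scalars_def one_def proj_id eps_one)

lemma lin_eps: "lin eps" by (simp add: lin_def)

lemma lin_proj: assumes "linear_on H scalars f" shows "lin (\<lambda>x. f (proj x))"
  using assms by (simp add: lin_def linear_on_def scalars_def)

lemma counit_cop [simp]:
  assumes "lin F"
  shows "cop x (\<lambda>u v. eps u * F v) = F x" "cop x (\<lambda>u v. F u * eps v) = F x"
proof -
  have e: "counit H u = eps u" if "u \<in> cH" for u using that by (simp add: eps_def proj_id)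
  have b: "bilinear_on H H H (\<lambda>x1 x2. sc (counit H x1) x2)" "bilinear_on H H H (\<lambda>x1 x2. sc (counit H x2) x1)"
    using eps_linear
    by (auto simp: bilinear_on_def linear_on_def scalars_def scale_right_distrib scale_left_distrib
        is_vspace_ring(8)[OF Hv] mult.commute)
  have "cop x (\<lambda>u v. eps u * F v) = F (proj x)"
    using sw2_eval[OF Hv b(1) lin_linear_on[OF assms], of "proj x"]
    by (simp add: counit linD[OF assms] e cong: cop_cong)
  moreover have "cop x (\<lambda>u v. F u * eps v) = F (proj x)"
    using sw2_eval[OF Hv b(2) lin_linear_on[OF assms], of "proj x"]
    by (simp add: counit linD[OF assms] e mult.commute cong: cop_cong)
  ultimately show "cop x (\<lambda>u v. eps u * F v) = F x" "cop x (\<lambda>u v. F u * eps v) = F x"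
    by (simp_all add: linD[OF assms])
qed

lemma cop_one [simp]: "bil F \<Longrightarrow> cop one F = F one one"
  using comul_cop[OF one_cH bil_bilinear_on] bil_bilinear_on
  by (simp add: one_def comul_one tens_eval)

lemma cop_tmul:
  assumes "bil F"
  shows "cop (x \<star> y) F = cop x (\<lambda>a b. cop y (\<lambda>c d. F (a \<star> c) (b \<star> d)))"
proof -
  note F = bilD[OF assms]
  have b1: "bil (\<lambda>c d. F (a \<star> c) (b \<star> d))" for a b by (simp add: bil_def lin_def F)
  have b2: "bil (\<lambda>a b. cop y (\<lambda>c d. F (a \<star> c) (b \<star> d)))" by (simp add: bil_def lin_def F)
  have "cop (x \<star> y) F = comul H (mul H (proj x) (proj y)) F"
    by (simp add: comul_cop[OF _ bil_bilinear_on[OF assms]] mul_tmul)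
  also have "\<dots> = comul H (proj x) (\<lambda>a b. comul H (proj y) (\<lambda>c d. F (mul H a c) (mul H b d)))"
    by (simp add: comul_mul tensor_alg_mul_eval[OF Hv mul_bil Hv mul_bil] comul_in
        bil_bilinear_on[OF assms])
  also have "\<dots> = comul H (proj x) (\<lambda>a b. comul H (proj y) (\<lambda>c d. F (a \<star> c) (b \<star> d)))"
    by (intro tspace_eval_cong[OF Hv Hv comul_in]) (simp_all add: mul_tmul)
  also have "\<dots> = cop x (\<lambda>a b. cop y (\<lambda>c d. F (a \<star> c) (b \<star> d)))"
    by (simp add: comul_cop bil_bilinear_on b1 b2)
  finally show ?thesis .
qed

text \<open>The coalgebra axiom yields this for products of linear functionals. Since
  \<open>cop\<close> samples its argument at basis vectors, an arbitrary \<open>F\<close> may be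
  replaced by the trilinear \<open>?X\<close> that agrees with it there, and \<open>?X\<close> is a
  linear combination of such products.\<close>

lemma cop_coassoc: "cop a (\<lambda>x y. cop x (\<lambda>u v. F u v y)) = cop a (\<lambda>u y. cop y (\<lambda>v w. F u v w))"
proof -
  let ?HH = "tspace H H" and ?H3 = "tspace H (tspace H H)"
  note HH = is_vspace_tspace[OF Hv Hv] note H3 = is_vspace_tspace[OF Hv HH]
  have base: "cop a (\<lambda>x y. cop x (\<lambda>u v. f u * (g v * h y))) = cop a (\<lambda>u y. cop y (\<lambda>v w. f u * (g v * h w)))"
    if l: "lin f" "lin g" "lin h" for f g h
  proof -
    \<comment> \<open>The form on \<open>H\<close> and \<open>tspace H H\<close> that takes the
      value f(u) g(v) h(w) on \<open>tens3 H u v w\<close>. Evaluation at it turns the vector-valued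
      coassociativity law into the scalar one.\<close>
    define \<gamma> where "\<gamma> = (\<lambda>x (t :: ('k, 'h, 'h) tensor). f x * t (\<lambda>v w. g v * h w))"
    have gh: "bilinear_on H H scalars (\<lambda>v w. g v * h w)"
      by (intro bilinear_product lin_linear_on l)
    have \<gamma>: "bilinear_on H ?HH scalars \<gamma>" unfolding \<gamma>_def
      by (intro bilinear_product lin_linear_on l linear_eval)
    have ev: "tens3 H x y z \<gamma> = f x * (g y * h z)" for x y z
      unfolding tens3_def by (simp add: tens_eval[OF \<gamma>]) (simp add: \<gamma>_def tens_eval[OF gh])
    have b1: "bilinear_on H H ?H3 (\<lambda>x1 x2. tens3 H x1 x2 x3)" if "x3 \<in> cH" for x3
      using that by (intro bilinear_onI tens3_linear Hv)
    have b2: "bilinear_on H H ?H3 (\<lambda>x2 x3. tens3 H x1 x2 x3)" if "x1 \<in> cH" for x1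
      using that by (intro bilinear_onI tens3_linear Hv)
    have c1: "bilinear_on H H ?H3 (\<lambda>y x3. sw2 H (\<lambda>x1 x2. tens3 H x1 x2 x3) y)"
      by (intro bilinear_onI sw2_linear sw2_param H3 Hv b1 tens3_linear)
    have c2: "bilinear_on H H ?H3 (\<lambda>x1 y. sw2 H (\<lambda>x2 x3. tens3 H x1 x2 x3) y)"
      by (intro bilinear_onI sw2_linear sw2_param H3 Hv b2 tens3_linear)
    have "cop a (\<lambda>x y. cop x (\<lambda>u v. f u * (g v * h y)))
        = sw2 H (\<lambda>y x3. sw2 H (\<lambda>x1 x2. tens3 H x1 x2 x3) y) (proj a) \<gamma>"
      using sw2_eval[OF H3 c1 linear_eval, of "proj a" \<gamma>] sw2_eval[OF H3 b1 linear_eval, of _ _ \<gamma>]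
      by (simp add: ev cong: cop_cong)
    also have "\<dots> = sw2 H (\<lambda>x1 y. sw2 H (\<lambda>x2 x3. tens3 H x1 x2 x3) y) (proj a) \<gamma>"
      by (simp add: coassoc)
    also have "\<dots> = cop a (\<lambda>u y. cop y (\<lambda>v w. f u * (g v * h w)))"
      using sw2_eval[OF H3 c2 linear_eval, of "proj a" \<gamma>] sw2_eval[OF H3 b2 linear_eval, of _ _ \<gamma>]
      by (simp add: ev cong: cop_cong)
    finally show ?thesis .
  qed
  have sum: "(\<Sum>i\<in>I. coord i (e j) * f i) = f j" if "j \<in> I" for f :: "'i \<Rightarrow> 'k" and j
    using that finI by (simp add: coord_e if_distrib[of "\<lambda>c. c * _"] cong: if_cong)
  have X: "F u v y = (\<Sum>i\<in>I. \<Sum>j\<in>I. \<Sum>k\<in>I. coord i u * (coord j v * coord k y) * F (e i) (e j) (e k))"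
    if "u \<in> e ` I" "v \<in> e ` I" "y \<in> e ` I" for u v y
  proof -
    from that obtain i j k where [simp]: "u = e i" "v = e j" "y = e k" "i \<in> I" "j \<in> I" "k \<in> I" by auto
    show ?thesis by (simp add: mult.assoc flip: sum_distrib_left) (simp add: sum)
  qed
  have cong: "cop x G = cop x G'" if "\<And>u v. u \<in> e ` I \<Longrightarrow> v \<in> e ` I \<Longrightarrow> G u v = G' u v" for x G G'
    unfolding cop_def using that by (intro sum.cong) auto
  let ?X = "\<lambda>u v y. \<Sum>i\<in>I. \<Sum>j\<in>I. \<Sum>k\<in>I. coord i u * (coord j v * coord k y) * F (e i) (e j) (e k)"
  have "cop a (\<lambda>x y. cop x (\<lambda>u v. F u v y)) = cop a (\<lambda>x y. cop x (\<lambda>u v. ?X u v y))"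
    by (intro cong X)
  also have "\<dots> = cop a (\<lambda>u y. cop y (\<lambda>v w. ?X u v w))"
    unfolding cop_sum cop_mult by (intro sum.cong refl) (simp only: base lin_coord cop_mult)
  also have "\<dots> = cop a (\<lambda>u y. cop y (\<lambda>v w. F u v w))"
    by (intro cong X[symmetric])
  finally show ?thesis .
qed

text \<open>The rule for \<open>T\<close> is applied at the element \<open>S x\<close>:
  \<open>T (S x)\<close> is \<open>proj x\<close>, and on the legs each \<open>S\<close> cancels a
  \<open>T\<close>.\<close>

lemma cop_S:
  assumes "bil F"
  shows "cop (S x) F = cop x (\<lambda>a b. F (S b) (S a))"
proof -
  have *: "cop (T x) F = cop x (\<lambda>a b. F (T b) (T a))" if x: "x \<in> cH" and F: "bil F" for x F
  proof -
    have b: "bilinear_on H H (tspace H H) (\<lambda>x1 x2. tens H H (T x2) (T x1))"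
      using linear_on_comp[OF bilinear_onD(1)[OF bilinear_tens[OF Hv Hv]] T_linear]
        linear_on_comp[OF bilinear_onD(2)[OF bilinear_tens[OF Hv Hv]] T_linear]
      by (intro bilinear_onI) (simp_all add: T_in)
    show ?thesis
      using sw2_eval[OF is_vspace_tspace[OF Hv Hv] b linear_eval x, of F]
      by (simp add: T_comul[OF x, symmetric] comul_cop T_in x bil_bilinear_on F tens_eval)
  qed
  note F = bilD[OF assms]
  have "cop x (\<lambda>a b. F (S b) (S a)) = cop (T (S x)) (\<lambda>a b. F (S b) (S a))" by (simp add: T_S)
  also have "\<dots> = cop (S x) (\<lambda>a b. F (S (T a)) (S (T b)))"
    by (rule *) (simp_all add: bil_def lin_def F)
  also have "\<dots> = cop (S x) F"
    by (intro cop_cong) (simp add: S_T)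
  finally show ?thesis by simp
qed

section \<open>Regularity, centrality and coperfectness in terms of the inverse antipode\<close>

lemma convol_id_T:
  shows "bilinear_on H H H (\<lambda>x1 x2. mul H (id x1) (T x2))" "linear_on H H (convol H id T)"
    and "bilinear_on H H H (\<lambda>x1 x2. mul H (T x1) (id x2))" "linear_on H H (convol H T id)"
proof -
  note b = bilinear_onD[OF mul_bil]
  show *: "bilinear_on H H H (\<lambda>x1 x2. mul H (id x1) (T x2))"
    using linear_on_comp[OF b(1) T_linear] b by (intro bilinear_onI) (auto simp: T_in)
  show "linear_on H H (convol H id T)"
    unfolding convol_def[abs_def] by (rule sw2_linear[OF Hv *])
  show *: "bilinear_on H H H (\<lambda>x1 x2. mul H (T x1) (id x2))"
    using linear_on_comp[OF b(2) T_linear] b by (intro bilinear_onI) (auto simp: T_in)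
  show "linear_on H H (convol H T id)"
    unfolding convol_def[abs_def] by (rule sw2_linear[OF Hv *])
qed

lemma convol_eval:
  assumes "x \<in> cH" "lin F"
  shows "F (convol H id T x) = cop x (\<lambda>u v. F (u \<star> T v))"
    and "F (convol H T id x) = cop x (\<lambda>u v. F (T u \<star> v))"
  using sw2_eval[OF Hv convol_id_T(1) lin_linear_on[OF assms(2)] assms(1)]
    sw2_eval[OF Hv convol_id_T(3) lin_linear_on[OF assms(2)] assms(1)]
  by (simp_all add: convol_def mul_tmul T_in cong: cop_cong)

text \<open>The image under \<open>S\<close> of the axiom that the convolution of id, T, id is id:
  \<open>S\<close> reverses the three factors and cancels \<open>T\<close>.\<close>

lemma S_id_S: assumes "lin F"
  shows "cop a (\<lambda>x y. cop x (\<lambda>u v. F (S y \<star> (v \<star> S u)))) = F (S a)"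
proof -
  note F = linD[OF assms]
  let ?z = "convol H id T"
  have z: "linear_on H H ?z" by (rule convol_id_T)
  have b: "bilinear_on H H H (\<lambda>x1 x2. mul H (?z x1) (id x2))"
    using linear_on_comp[OF bilinear_onD(2)[OF mul_bil] z] bilinear_onD(1)[OF mul_bil] linear_onD(1)[OF z]
    by (intro bilinear_onI) auto
  have l: "lin (\<lambda>x. F (S x))" by (simp add: lin_def F)
  have "F (S a) = F (S (convol H ?z id (proj a)))"
    by (simp add: convol1)
  also have "\<dots> = cop a (\<lambda>x y. F (S (mul H (?z x) y)))"
    using sw2_eval[OF Hv b lin_linear_on[OF l], of "proj a"] by (simp add: convol_def[of _ ?z])
  also have "\<dots> = cop a (\<lambda>x y. F (S (?z x \<star> y)))"
    by (intro cop_cong) (simp add: mul_tmul linear_onD(1)[OF z])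
  also have "\<dots> = cop a (\<lambda>x y. cop x (\<lambda>u v. F (S (u \<star> T v \<star> y))))"
  proof (intro cop_cong)
    fix x y assume x: "x \<in> cH"
    have "lin (\<lambda>w. F (S (w \<star> y)))" by (simp add: lin_def F)
    from convol_eval(1)[OF x this] show "F (S (?z x \<star> y)) = cop x (\<lambda>u v. F (S (u \<star> T v \<star> y)))" .
  qed
  also have "\<dots> = cop a (\<lambda>x y. cop x (\<lambda>u v. F (S y \<star> (v \<star> S u))))"
    by (intro cop_cong) (simp add: S_T)
  finally show ?thesis by simp
qed

text \<open>The image under \<open>S\<close> of the other regularity axiom, T convolved with id and
  T is T. The right side becomes \<open>a\<close> because \<open>S\<close> cancels
  \<open>T\<close>.\<close>

lemma id_S_id: assumes "lin F"
  shows "cop a (\<lambda>x y. cop x (\<lambda>u v. F (y \<star> (S v \<star> u)))) = F a"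
proof -
  note F = linD[OF assms]
  let ?z = "convol H T id"
  have z: "linear_on H H ?z" by (rule convol_id_T)
  have b: "bilinear_on H H H (\<lambda>x1 x2. mul H (?z x1) (T x2))"
    using linear_on_comp[OF bilinear_onD(2)[OF mul_bil] z]
      linear_on_comp[OF bilinear_onD(1)[OF mul_bil] T_linear] linear_onD(1)[OF z]
    by (intro bilinear_onI) (auto simp: T_in)
  have l: "lin (\<lambda>x. F (S x))" by (simp add: lin_def F)
  have "F a = F (S (convol H ?z T (proj a)))"
    by (simp add: convol2 S_T F)
  also have "\<dots> = cop a (\<lambda>x y. F (S (mul H (?z x) (T y))))"
    using sw2_eval[OF Hv b lin_linear_on[OF l], of "proj a"] by (simp add: convol_def[of _ ?z])
  also have "\<dots> = cop a (\<lambda>x y. F (S (?z x \<star> T y)))"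
    by (intro cop_cong) (simp add: mul_tmul linear_onD(1)[OF z] T_in)
  also have "\<dots> = cop a (\<lambda>x y. cop x (\<lambda>u v. F (S (T u \<star> v \<star> T y))))"
  proof (intro cop_cong)
    fix x y assume x: "x \<in> cH"
    have "lin (\<lambda>w. F (S (w \<star> T y)))" by (simp add: lin_def F)
    from convol_eval(2)[OF x this]
    show "F (S (?z x \<star> T y)) = cop x (\<lambda>u v. F (S (T u \<star> v \<star> T y)))" .
  qed
  also have "\<dots> = cop a (\<lambda>x y. cop x (\<lambda>u v. F (y \<star> (S v \<star> u))))"
    by (intro cop_cong) (simp add: S_T)
  finally show ?thesis by simp
qed

text \<open>The anti-automorphism \<open>S\<close> preserves the centre, and the sum of a'' S(a') is
  the image under \<open>S\<close> of the central element \<open>convol H id T a\<close>.\<close>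

lemma id_S_central: assumes "lin F"
  shows "cop a (\<lambda>u v. F (v \<star> S u \<star> y)) = cop a (\<lambda>u v. F (y \<star> (v \<star> S u)))"
proof -
  note F = linD[OF assms]
  let ?z = "convol H id T (proj a)"
  have z: "?z \<in> cH" using linear_onD(1)[OF convol_id_T(2)] by simp
  have w: "T (proj y) \<in> cH" by (simp add: T_in)
  \<comment> \<open>The central element is commuted with T(y), so that after \<open>S\<close> is
    applied the factor is y itself.\<close>
  have "mul H ?z (T (proj y)) = mul H (T (proj y)) ?z"
    using central[of "proj a"] w by (simp add: center_def)
  then have "F (S (?z \<star> T (proj y))) = F (S (T (proj y) \<star> ?z))"
    by (simp add: mul_tmul z w)
  moreover have l: "lin (\<lambda>z. F (S (z \<star> T (proj y))))" "lin (\<lambda>z. F (S (T (proj y) \<star> z)))"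
    by (simp_all add: lin_def F)
  ultimately have "cop a (\<lambda>u v. F (S (u \<star> T v \<star> T (proj y)))) = cop a (\<lambda>u v. F (S (T (proj y) \<star> (u \<star> T v))))"
    using convol_eval(1)[OF proj_in l(1), of a] convol_eval(1)[OF proj_in l(2), of a] by (simp only: cop_proj)
  then show ?thesis
    by (simp add: S_T cong: cop_cong)
qed

text \<open>Coperfectness, tested on the form that applies \<open>S\<close> to the first tensor
  factor, where x' T(x'') turns into x'' S(x').\<close>

lemma S_coperfect: assumes "bil F"
  shows "cop a (\<lambda>x y. cop x (\<lambda>u v. F (v \<star> S u) y)) = cop a (\<lambda>x y. cop y (\<lambda>u v. F (v \<star> S u) x))"
proof -
  note F = bilD[OF assms]
  let ?G = "\<lambda>z. F (S z)"
  have G: "bilinear_on H H scalars ?G" by (intro bil_bilinear_on) (simp add: bil_def lin_def F)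
  note HH = is_vspace_tspace[OF Hv Hv] and t = bilinear_onD[OF bilinear_tens[OF Hv Hv]]
    and m = bilinear_onD[OF mul_bil]
  have mT: "linear_on H H (\<lambda>y. mul H x (T y))" if "x \<in> cH" for x
    using linear_on_comp[OF m(1)[OF that] T_linear] .
  have mT': "linear_on H H (\<lambda>x. mul H x (T y))" if "y \<in> cH" for y
    using m(2)[OF T_in[OF that]] .
  have l: "linear_on H (tspace H H) (\<lambda>x. tens H H (f x) y)" if "linear_on H H f" "y \<in> cH" for f y
    using linear_on_comp[OF t(2) that(1)] that(2) by blast
  have b1: "bilinear_on H H (tspace H H) (\<lambda>x2 x3. tens H H (mul H x1 (T x2)) x3)" if "x1 \<in> cH" for x1
    using that by (intro bilinear_onI t l mT mul_in T_in)
  have b2: "bilinear_on H H (tspace H H) (\<lambda>x2 x3. tens H H (mul H x2 (T x3)) x1)" if "x1 \<in> cH" for x1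
    using that by (intro bilinear_onI l mT mT')
  have c1: "bilinear_on H H (tspace H H) (\<lambda>x1 y. sw2 H (\<lambda>x2 x3. tens H H (mul H x1 (T x2)) x3) y)"
    by (intro bilinear_onI sw2_linear sw2_param HH Hv b1 l mT' )
  have c2: "bilinear_on H H (tspace H H) (\<lambda>x1 y. sw2 H (\<lambda>x2 x3. tens H H (mul H x2 (T x3)) x1) y)"
    by (intro bilinear_onI sw2_linear sw2_param HH Hv b2 t mul_in T_in)
  have "cop a (\<lambda>x y. cop x (\<lambda>u v. F (v \<star> S u) y)) = cop a (\<lambda>x y. cop y (\<lambda>u v. F (u \<star> S x) v))"
    by (rule cop_coassoc)
  also have "\<dots> = cop a (\<lambda>x y. cop y (\<lambda>u v. ?G (mul H x (T u)) v))"
    by (intro cop_cong) (simp add: mul_tmul T_in S_T)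
  also have "\<dots> = sw3 H (\<lambda>x1 x2 x3. tens H H (mul H x1 (T x2)) x3) (proj a) ?G"
    using sw2_eval[OF HH c1 linear_eval, of "proj a" ?G] sw2_eval[OF HH b1 linear_eval, of _ _ ?G]
    by (simp add: sw3_def tens_eval[OF G] cong: cop_cong)
  also have "\<dots> = sw3 H (\<lambda>x1 x2 x3. tens H H (mul H x2 (T x3)) x1) (proj a) ?G"
    by (simp add: coperf)
  also have "\<dots> = cop a (\<lambda>x y. cop y (\<lambda>u v. ?G (mul H u (T v)) x))"
    using sw2_eval[OF HH c2 linear_eval, of "proj a" ?G] sw2_eval[OF HH b2 linear_eval, of _ _ ?G]
    by (simp add: sw3_def tens_eval[OF G] cong: cop_cong)
  also have "\<dots> = cop a (\<lambda>x y. cop y (\<lambda>u v. F (v \<star> S u) x))"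
    by (intro cop_cong) (simp add: mul_tmul T_in S_T)
  finally show ?thesis .
qed


section \<open>Cancellations between Sweedler legs and the twist by an element\<close>

lemmas multilin = tril_def bil_def lin_def

text \<open>For a Hopf algebra the block x2 S(x1) would simply be the counit. Here \<open>1\<close>
  moves the block beyond the leg x3, \<open>2\<close> moves it to the left of \<open>y\<close>, and
  there \<open>3\<close> absorbs it into the adjacent factor S(x4).\<close>

lemma S_id_S_shift: assumes "bil F"
  shows "cop a (\<lambda>w x4. cop w (\<lambda>v x3. cop v (\<lambda>x1 x2. F (S x4 \<star> (y \<star> (x2 \<star> S x1))) x3)))
    = cop a (\<lambda>x1 x2. F (S x2 \<star> y) x1)"
proof -
  note F = bilD[OF assms]
  have 1: "cop w (\<lambda>v x3. cop v (\<lambda>x1 x2. F (S x4 \<star> (y \<star> (x2 \<star> S x1))) x3))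
      = cop w (\<lambda>x1 v. cop v (\<lambda>x2 x3. F (S x4 \<star> (y \<star> (x3 \<star> S x2))) x1))" for w x4
    by (rule S_coperfect[of "\<lambda>z. F (S x4 \<star> (y \<star> z))"]) (simp add: multilin F)
  have 2: "cop v (\<lambda>x2 x3. F (S x4 \<star> (y \<star> (x3 \<star> S x2))) x1)
      = cop v (\<lambda>x2 x3. F (S x4 \<star> (x3 \<star> S x2 \<star> y)) x1)" for v x1 x4
    by (rule id_S_central[of "\<lambda>z. F (S x4 \<star> z) x1", symmetric]) (simp add: multilin F)
  have 3: "cop w (\<lambda>v x4. cop v (\<lambda>x2 x3. F (S x4 \<star> (x3 \<star> S x2 \<star> y)) x1)) = F (S w \<star> y) x1" for w x1
    using S_id_S[of "\<lambda>z. F (z \<star> y) x1"] by (simp add: multilin F tmul_assoc)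
  have "cop a (\<lambda>w x4. cop w (\<lambda>v x3. cop v (\<lambda>x1 x2. F (S x4 \<star> (y \<star> (x2 \<star> S x1))) x3)))
      = cop a (\<lambda>w x4. cop w (\<lambda>x1 v. cop v (\<lambda>x2 x3. F (S x4 \<star> (x3 \<star> S x2 \<star> y)) x1)))"
    unfolding 1 unfolding 2 ..
  also have "\<dots> = cop a (\<lambda>x1 w. cop w (\<lambda>v x4. cop v (\<lambda>x2 x3. F (S x4 \<star> (x3 \<star> S x2 \<star> y)) x1)))"
    by (rule cop_coassoc)
  finally show ?thesis by (simp only: 3)
qed

text \<open>\<open>twist a x F\<close> is \<open>\<Sum> F (S a''' x a') a''\<close>, the exchange of \<open>a\<close> with a dual element evaluated at \<open>x\<close>
  in the product of the double.\<close>

definition twist :: "'h \<Rightarrow> 'h \<Rightarrow> ('h \<Rightarrow> 'h \<Rightarrow> 'k) \<Rightarrow> 'k" where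
  "twist a x F = cop a (\<lambda>u a3. cop u (\<lambda>a1 a2. F (S a3 \<star> x \<star> a1) a2))"

lemma twist_left [simp]: "twist (a + b) x F = twist a x F + twist b x F" "twist (sc c a) x F = c * twist a x F"
    "twist (proj a) x F = twist a x F"
  by (simp_all add: twist_def)

lemma twist_plus [simp]: "twist a x (\<lambda>z c. F z c + G z c) = twist a x F + twist a x G"
  and twist_mult [simp]: "twist a x (\<lambda>z c. k * F z c) = k * twist a x F" "twist a x (\<lambda>z c. F z c * k) = twist a x F * k"
  by (simp_all add: twist_def)

lemma twist_right [simp]:
  "bil F \<Longrightarrow> twist a (x + y) F = twist a x F + twist a y F" "bil F \<Longrightarrow> twist a (sc c x) F = c * twist a x F"
  "twist a (proj x) F = twist a x F"
  by (simp_all add: twist_def bilD)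

lemma twist_cop: "twist a x (\<lambda>z c. cop y (\<lambda>u v. F z c u v)) = cop y (\<lambda>u v. twist a x (\<lambda>z c. F z c u v))"
  unfolding twist_def by (subst cop_commute, subst (2) cop_commute) (rule refl)

lemma twist_one: "bil F \<Longrightarrow> twist one x F = F x one"
proof -
  assume F: "bil F"
  have "bil (\<lambda>a1 a2. F (S a3 \<star> x \<star> a1) a2)" for a3
    by (simp add: multilin bilD[OF F])
  moreover have "bil (\<lambda>u a3. cop u (\<lambda>a1 a2. F (S a3 \<star> x \<star> a1) a2))"
    by (simp add: multilin bilD[OF F])
  ultimately show ?thesis by (simp add: twist_def bilD[OF F])
qed

lemma twist_eps: "lin G \<Longrightarrow> twist a x (\<lambda>z c. eps z * G c) = eps x * G a"
proof -
  assume G: "lin G"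
  have "twist a x (\<lambda>z c. eps z * G c) = cop a (\<lambda>u a3. cop u (\<lambda>a1 a2. eps a3 * (eps x * (eps a1 * G a2))))"
    by (simp add: twist_def mult.assoc)
  also have "\<dots> = cop a (\<lambda>u a3. (eps x * G u) * eps a3)"
    using counit_cop(1)[OF G] by (simp add: mult.commute)
  also have "\<dots> = eps x * G a"
    by (rule counit_cop) (simp add: multilin linD[OF G] algebra_simps)
  finally show ?thesis .
qed

lemma twist_eps_right: "lin K \<Longrightarrow> twist a x (\<lambda>z c. eps c * K z) = cop a (\<lambda>u v. K (S v \<star> x \<star> u))"
proof -
  assume K: "lin K"
  have "cop u (\<lambda>a1 a2. eps a2 * K (S a3 \<star> x \<star> a1)) = K (S a3 \<star> x \<star> u)" for u a3
    using counit_cop(2)[of "\<lambda>a1. K (S a3 \<star> x \<star> a1)"] by (simp add: multilin linD[OF K] mult.commute)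
  then show ?thesis by (simp add: twist_def)
qed

text \<open>\<open>S\<close> reverses products, so S((ab)''') x (ab)' is S(b''') S(a''') x a' b':
  the twist by \<open>a\<close> is the inner one.\<close>

lemma twist_tmul: assumes "bil F"
  shows "twist (a \<star> b) x F = twist a x (\<lambda>z c. twist b z (\<lambda>w d. F w (c \<star> d)))"
proof -
  note F = bilD[OF assms]
  have 1: "cop (u \<star> v) (\<lambda>c1 c2. F (S b3 \<star> S a3 \<star> x \<star> c1) c2)
      = cop u (\<lambda>a1 a2. cop v (\<lambda>b1 b2. F (S b3 \<star> S a3 \<star> x \<star> (a1 \<star> b1)) (a2 \<star> b2)))" for u v a3 b3
    by (rule cop_tmul) (simp add: multilin F)
  have "twist (a \<star> b) x F = cop a (\<lambda>u a3. cop b (\<lambda>v b3. cop (u \<star> v) (\<lambda>c1 c2. F (S b3 \<star> S a3 \<star> x \<star> c1) c2)))"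
    unfolding twist_def by (subst cop_tmul) (simp_all add: multilin F)
  also have "\<dots> = cop a (\<lambda>u a3. cop u (\<lambda>a1 a2. cop b (\<lambda>v b3. cop v (\<lambda>b1 b2.
      F (S b3 \<star> S a3 \<star> x \<star> (a1 \<star> b1)) (a2 \<star> b2)))))"
    by (simp only: 1 cop_commute[of b])
  also have "\<dots> = twist a x (\<lambda>z c. twist b z (\<lambda>w d. F w (c \<star> d)))"
    by (simp add: twist_def tmul_assoc)
  finally show ?thesis .
qed

text \<open>\<open>S\<close> also reverses coproducts, so the coproduct of S(a''') x a' uses five
  legs of \<open>a\<close> symmetrically around the middle one: S(a5) x' a1 in the first factor,
  S(a4) x'' a2 in the second, a3 left over. This is one twist inside another.\<close>

lemma twist_cop_inner: assumes "tril F"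
  shows "twist a x (\<lambda>z c. cop z (\<lambda>z1 z2. F z1 z2 c))
    = cop x (\<lambda>x1 x2. twist a x1 (\<lambda>z c. twist c x2 (\<lambda>w d. F z w d)))"
proof -
  note F = trilD[OF assms]
  let ?Q = "\<lambda>x1 x2 a1 a2 a3 a4 a5. F (S a5 \<star> x1 \<star> a1) (S a4 \<star> x2 \<star> a2) a3"
  have "cop (S a3 \<star> x \<star> a1) (\<lambda>z1 z2. F z1 z2 a2)
      = cop a3 (\<lambda>s t. cop x (\<lambda>x1 x2. cop a1 (\<lambda>b c. ?Q x1 x2 b c a2 s t)))" for a1 a2 a3
    by (subst cop_tmul, simp add: multilin F, subst cop_tmul, simp add: multilin F,
        subst cop_S, simp add: multilin F, rule refl)
  moreover have sw: "cop u (\<lambda>a1 a2. cop a3 (\<lambda>s t. cop a1 (\<lambda>b c. ?Q x1 x2 b c a2 s t)))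
      = cop a3 (\<lambda>s t. cop u (\<lambda>a1 a2. cop a1 (\<lambda>b c. ?Q x1 x2 b c a2 s t)))" for u a3 x1 x2
    by (rule cop_commute)
  moreover have assoc1: "cop u (\<lambda>a1 a2. cop a1 (\<lambda>b c. ?Q x1 x2 b c a2 s t))
      = cop u (\<lambda>b a2. cop a2 (\<lambda>c d. ?Q x1 x2 b c d s t))" for u s t x1 x2
    by (rule cop_coassoc)
  moreover have assoc2: "cop r (\<lambda>u s. cop u (\<lambda>b a2. cop a2 (\<lambda>c d. ?Q x1 x2 b c d s t)))
      = cop r (\<lambda>a1 a2. cop a2 (\<lambda>v s. cop v (\<lambda>c1 c2. ?Q x1 x2 a1 c1 c2 s t)))" for r t x1 x2
    by (rule cop_coassoc)
  ultimately have "twist a x (\<lambda>z c. cop z (\<lambda>z1 z2. F z1 z2 c)) = cop a (\<lambda>u a3. cop u (\<lambda>a1 a2.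
      cop a3 (\<lambda>s t. cop x (\<lambda>x1 x2. cop a1 (\<lambda>b c. ?Q x1 x2 b c a2 s t)))))"
    by (simp add: twist_def)
  also have "\<dots> = cop x (\<lambda>x1 x2. cop a (\<lambda>u a3. cop a3 (\<lambda>s t. cop u (\<lambda>a1 a2. cop a1 (\<lambda>b c. ?Q x1 x2 b c a2 s t)))))"
    by (simp only: cop_commute[of _ x] sw)
  also have "\<dots> = cop x (\<lambda>x1 x2. cop a (\<lambda>r t. cop r (\<lambda>u s. cop u (\<lambda>a1 a2. cop a1 (\<lambda>b c. ?Q x1 x2 b c a2 s t)))))"
    unfolding cop_coassoc[of a "\<lambda>u s t. cop u (\<lambda>a1 a2. cop a1 (\<lambda>b c. ?Q x1 x2 b c a2 s t))" for x1 x2] ..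
  also have "\<dots> = cop x (\<lambda>x1 x2. cop a (\<lambda>r t. cop r (\<lambda>a1 a2. cop a2 (\<lambda>v s. cop v (\<lambda>c1 c2. ?Q x1 x2 a1 c1 c2 s t)))))"
    unfolding assoc1 unfolding assoc2 ..
  also have "\<dots> = cop x (\<lambda>x1 x2. twist a x1 (\<lambda>z c. twist c x2 (\<lambda>w d. F z w d)))"
    unfolding twist_def ..
  finally show ?thesis .
qed

text \<open>Let a1, a2, a3, b1, b2, b3 be the six legs of \<open>a\<close>. In S(b3) y b1 S(a3) x a1
  the neighbouring legs a3 and b1 meet as the block b1 S(a3), which \<open>S_id_S_shift\<close>
  removes although the leg b2 stands between it and b3.\<close>

lemma twist_TW: assumes "tril G"
  shows "cop a (\<lambda>a1 a2. twist a1 x (\<lambda>z c. twist a2 y (\<lambda>w d. G (w \<star> z) c d)))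
    = twist a (y \<star> x) (\<lambda>z c. cop c (\<lambda>c1 c2. G z c1 c2))"
proof -
  note G = trilD[OF assms]
  let ?Q = "\<lambda>a1 a2 a3 b1 b2 b3. G (S b3 \<star> (y \<star> (b1 \<star> S a3)) \<star> (x \<star> a1)) a2 b2"
  have L: "cop s (\<lambda>w b3. cop w (\<lambda>v b2. cop v (\<lambda>a3 b1. ?Q a1 a2 a3 b1 b2 b3)))
      = cop s (\<lambda>c2 a3. G (S a3 \<star> y \<star> (x \<star> a1)) a2 c2)" for s a1 a2
    by (rule S_id_S_shift[of "\<lambda>m c2. G (m \<star> (x \<star> a1)) a2 c2"]) (simp add: multilin G)
  have last: "cop w (\<lambda>u c2. cop u (\<lambda>a1 a2. G (S a3 \<star> y \<star> (x \<star> a1)) a2 c2))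
      = cop w (\<lambda>a1 m. cop m (\<lambda>c1 c2. G (S a3 \<star> (y \<star> x) \<star> a1) c1 c2))" for w a3
    by (simp only: tmul_assoc cop_coassoc)
  have "cop a (\<lambda>a1 a2. twist a1 x (\<lambda>z c. twist a2 y (\<lambda>w d. G (w \<star> z) c d)))
      = cop a (\<lambda>l r. cop l (\<lambda>u a3. cop u (\<lambda>a1 a2. cop r (\<lambda>v b3. cop v (\<lambda>b1 b2. ?Q a1 a2 a3 b1 b2 b3)))))"
    by (simp add: twist_def tmul_assoc)
  also have "\<dots> = cop a (\<lambda>u s. cop s (\<lambda>a3 r. cop u (\<lambda>a1 a2. cop r (\<lambda>v b3. cop v (\<lambda>b1 b2. ?Q a1 a2 a3 b1 b2 b3)))))"
    by (rule cop_coassoc)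
  also have "\<dots> = cop a (\<lambda>u s. cop u (\<lambda>a1 a2. cop s (\<lambda>a3 r. cop r (\<lambda>v b3. cop v (\<lambda>b1 b2. ?Q a1 a2 a3 b1 b2 b3)))))"
    by (subst cop_commute) (rule refl)
  \<comment> \<open>The legs a3, b1, b2, b3 are bracketed from the left, the shape required by
    \<open>L\<close>; the leg passed over is b2.\<close>
  also have "\<dots> = cop a (\<lambda>u s. cop u (\<lambda>a1 a2. cop s (\<lambda>w b3. cop w (\<lambda>v b2. cop v (\<lambda>a3 b1. ?Q a1 a2 a3 b1 b2 b3)))))"
    by (simp only: cop_coassoc[of _ "\<lambda>a3 v b3. cop v (\<lambda>b1 b2. ?Q _ _ a3 b1 b2 b3)", symmetric]
        cop_coassoc[of _ "\<lambda>a3 b1 b2. ?Q _ _ a3 b1 b2 _", symmetric])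
  also have "\<dots> = cop a (\<lambda>u s. cop u (\<lambda>a1 a2. cop s (\<lambda>c2 a3. G (S a3 \<star> y \<star> (x \<star> a1)) a2 c2)))"
    by (simp only: L)
  also have "\<dots> = cop a (\<lambda>u s. cop s (\<lambda>c2 a3. cop u (\<lambda>a1 a2. G (S a3 \<star> y \<star> (x \<star> a1)) a2 c2)))"
    by (subst cop_commute) (rule refl)
  also have "\<dots> = cop a (\<lambda>w a3. cop w (\<lambda>u c2. cop u (\<lambda>a1 a2. G (S a3 \<star> y \<star> (x \<star> a1)) a2 c2)))"
    by (rule cop_coassoc[symmetric])
  also have "\<dots> = twist a (y \<star> x) (\<lambda>z c. cop c (\<lambda>c1 c2. G z c1 c2))"
    unfolding twist_def last ..
  finally show ?thesis .
qed

text \<open>The left side is the sum produced by the two actions in the product of the double. It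
  arises from \<open>twist_TW\<close> at y = \<open>one\<close> when the counit is applied to the
  middle leg of the first twist.\<close>

lemma twist_twice: assumes "bil G"
  shows "cop a (\<lambda>l r. cop l (\<lambda>u v. twist r one (\<lambda>w d. G (w \<star> (S v \<star> x \<star> u)) d))) = twist a x G"
proof -
  note G = bilD[OF assms]
  have 1: "twist a1 x (\<lambda>z c. eps c * twist a2 one (\<lambda>w d. G (w \<star> z) d))
      = cop a1 (\<lambda>u v. twist a2 one (\<lambda>w d. G (w \<star> (S v \<star> x \<star> u)) d))" for a1 a2
    by (rule twist_eps_right) (simp add: multilin G)
  have t: "tril (\<lambda>z c d. eps c * G z d)" by (simp add: multilin G algebra_simps)
  have 2: "cop c (\<lambda>c1 c2. eps c1 * G z c2) = G z c" for c z
    by (rule counit_cop) (simp add: multilin G)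
  show ?thesis
    using twist_TW[OF t, of a x one] by (simp add: 1 2)
qed

text \<open>The sum to simplify is a4 S(a3) x a1 paired with a2. By \<open>1\<close> the block a4
  S(a3) beside a2 becomes a3 S(a2) beside a4, by \<open>2\<close> the block passes to the right of
  \<open>x\<close>, where it meets a1, and by \<open>3\<close> the product a3 S(a2) a1
  collapses.\<close>

lemma twist_cancel: assumes "bil G"
  shows "cop a (\<lambda>a1 a2. twist a1 x (\<lambda>z c. G (a2 \<star> z) c)) = cop a (\<lambda>a1 a2. G (x \<star> a1) a2)"
proof -
  note G = bilD[OF assms]
  let ?Q = "\<lambda>a1 a2 a3 a4. G (a4 \<star> S a3 \<star> (x \<star> a1)) a2"
  have 1: "cop w (\<lambda>a2 t. cop t (\<lambda>a3 a4. ?Q a1 a2 a3 a4))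
      = cop w (\<lambda>t a4. cop t (\<lambda>a2 a3. G (a3 \<star> S a2 \<star> (x \<star> a1)) a4))" for w a1
    by (rule S_coperfect[of "\<lambda>m c. G (m \<star> (x \<star> a1)) c", symmetric]) (simp add: multilin G)
  have 2: "cop t (\<lambda>a2 a3. G (a3 \<star> S a2 \<star> (x \<star> a1)) a4)
      = cop t (\<lambda>a2 a3. G (x \<star> (a3 \<star> (S a2 \<star> a1))) a4)" for t a1 a4
    using id_S_central[of "\<lambda>m. G (m \<star> a1) a4" t x] by (simp add: multilin G tmul_assoc)
  have 3: "cop s (\<lambda>t a3. cop t (\<lambda>a1 a2. G (x \<star> (a3 \<star> (S a2 \<star> a1))) a4)) = G (x \<star> s) a4" for s a4
    by (rule id_S_id[of "\<lambda>m. G (x \<star> m) a4"]) (simp add: multilin G)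
  have "cop a (\<lambda>a1 a2. twist a1 x (\<lambda>z c. G (a2 \<star> z) c))
      = cop a (\<lambda>w a4. cop w (\<lambda>u a3. cop u (\<lambda>a1 a2. ?Q a1 a2 a3 a4)))"
    by (simp add: twist_def tmul_assoc)
  also have "\<dots> = cop a (\<lambda>a1 w. cop w (\<lambda>a2 t. cop t (\<lambda>a3 a4. ?Q a1 a2 a3 a4)))"
    by (simp only: cop_coassoc)
  also have "\<dots> = cop a (\<lambda>a1 w. cop w (\<lambda>t a4. cop t (\<lambda>a2 a3. G (x \<star> (a3 \<star> (S a2 \<star> a1))) a4)))"
    unfolding 1 unfolding 2 ..
  also have "\<dots> = cop a (\<lambda>s a4. cop s (\<lambda>t a3. cop t (\<lambda>a1 a2. G (x \<star> (a3 \<star> (S a2 \<star> a1))) a4)))"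
    by (simp only: cop_coassoc)
  finally show ?thesis by (simp only: 3)
qed


section \<open>The dual and the two actions\<close>

abbreviation K where "K \<equiv> dual_cop H"

lemma K_carrier: "f \<in> vcarrier K \<longleftrightarrow> linear_on H scalars f \<and> (\<forall>x. x \<notin> cH \<longrightarrow> f x = 0)"
  and K_scale: "vscale K c f = (\<lambda>x. c * f x)"
  by (simp_all add: dual_cop_def dual_space_def)

lemma Kv: "is_vspace K"
  using is_vspace_dual by (subst is_vspace_same[of _ "dual_space H"]) (simp_all add: dual_cop_def)

lemma K_lin: "f \<in> vcarrier K \<Longrightarrow> lin (\<lambda>x. f (proj x))"
  by (simp add: K_carrier lin_proj)

lemma K_add: "f \<in> vcarrier K \<Longrightarrow> x \<in> cH \<Longrightarrow> y \<in> cH \<Longrightarrow> f (x + y) = f x + f y"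
  and K_sc: "f \<in> vcarrier K \<Longrightarrow> x \<in> cH \<Longrightarrow> f (sc c x) = c * f x"
  by (simp_all add: K_carrier linear_on_def scalars_def)

lemma K_eqI:
  assumes "f \<in> vcarrier K" "g \<in> vcarrier K" "\<And>x. x \<in> cH \<Longrightarrow> f x = g x"
  shows "f = g"
proof
  fix x show "f x = g x" using assms by (cases "x \<in> cH") (auto simp: K_carrier)
qed

text \<open>Elements of the dual must vanish off the carrier. Total functionals such as
  \<open>eps\<close> enter the dual through this cut-off.\<close>

definition restrictH :: "('h \<Rightarrow> 'k) \<Rightarrow> 'h \<Rightarrow> 'k" where "restrictH F x = (if x \<in> cH then F x else 0)"

lemma restrictH_K: "lin F \<Longrightarrow> restrictH F \<in> vcarrier K"
  using is_vspace_ring(7,8)[OF Hv] lin_linear_on[of F]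
  by (auto simp: K_carrier linear_on_def restrictH_def)

lemma restrictH_proj [simp]: "x \<in> cH \<Longrightarrow> restrictH F x = F x"
  by (simp add: restrictH_def)

lemma e'_K: "i \<in> I \<Longrightarrow> e' i \<in> vcarrier K"
  using dual by (simp add: is_dual_basis_def dual_cop_def)

lemma eval_linear: "x \<in> cH \<Longrightarrow> linear_on K scalars (\<lambda>f. f x)"
  by (simp add: linear_on_def scalars_def K_scale)

lemma coordinates_K: "coordinates K I e' (\<lambda>i f. f (e i))"
proof -
  have "f = (\<Sum>i\<in>I. vscale K (f (e i)) (e' i))" if f: "f \<in> vcarrier K" for f
  proof (rule K_eqI[OF f])
    show "(\<Sum>i\<in>I. vscale K (f (e i)) (e' i)) \<in> vcarrier K"
      by (intro vspace_sum_closed[OF Kv] is_vspace_ring(8)[OF Kv] e'_K)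
    fix x assume x: "x \<in> cH"
    have "f x = (\<Sum>i\<in>I. coord i x * f (e i))"
      using lin_expand[OF K_lin[OF f], of x] x by (simp add: proj_id proj_e cong: sum.cong)
    then show "f x = (\<Sum>i\<in>I. vscale K (f (e i)) (e' i)) x"
      using x by (simp add: sum_fun_apply K_scale coord_dual mult.commute cong: sum.cong)
  qed
  then show ?thesis
    unfolding coordinates_def using Kv finI e'_K eval_linear e_in by blast
qed

lemma mul_K: "x \<in> cH \<Longrightarrow> f \<in> vcarrier K \<Longrightarrow> g \<in> vcarrier K \<Longrightarrow>
    mul K f g x = cop x (\<lambda>u v. f (proj u) * g (proj v))"
proof -
  assume x: "x \<in> cH" and "f \<in> vcarrier K" "g \<in> vcarrier K"
  then have b: "bilinear_on H H scalars (\<lambda>u v. f u * g v)"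
    by (intro bilinear_product) (simp_all add: K_carrier)
  show ?thesis
    using sw2_eval[OF is_vspace_scalars b linear_on_id x] x
    by (simp add: dual_cop_def proj_id cong: cop_cong)
qed

lemma mul_K_in: assumes "f \<in> vcarrier K" "g \<in> vcarrier K"
  shows "mul K f g \<in> vcarrier K"
proof -
  have "mul K f g = restrictH (\<lambda>x. cop x (\<lambda>u v. f (proj u) * g (proj v)))"
    using assms by (auto simp: restrictH_def mul_K fun_eq_iff) (simp add: dual_cop_def)
  then show ?thesis by (simp add: restrictH_K lin_cop)
qed

lemma mul_K_bilinear: "bilinear_on K K K (mul K)"
proof -
  have [simp]: "(\<lambda>x. c * f x) \<in> vcarrier K" if "f \<in> vcarrier K" for c f
    using is_vspace_ring(8)[OF Kv that, of c] by (simp only: K_scale)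
  note [simp] = mul_K_in is_vspace_ring(7)[OF Kv]
  show ?thesis
    unfolding bilinear_on_def linear_on_def
    by (intro ballI allI conjI; simp?; rule K_eqI) (simp_all add: mul_K K_scale algebra_simps)
qed

section \<open>The opposite coproduct of the dual\<close>

text \<open>The counterpart of \<open>cop\<close> for the dual: the scalar Sweedler sum over the
  coproduct of \<open>f\<close>. The order of the factors in \<open>e j \<star> e i\<close> encodes
  the opposite coproduct, f'(x) f''(y) = f(yx).\<close>

definition cop_dual :: "('h \<Rightarrow> 'k) \<Rightarrow> (('h \<Rightarrow> 'k) \<Rightarrow> ('h \<Rightarrow> 'k) \<Rightarrow> 'k) \<Rightarrow> 'k" where
  "cop_dual f \<beta> = (\<Sum>(i, j)\<in>I \<times> I. f (e j \<star> e i) * \<beta> (e' i) (e' j))"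

lemma cop_dual_mult: "cop_dual f (\<lambda>g h. c * \<beta> g h) = c * cop_dual f \<beta>" "cop_dual f (\<lambda>g h. \<beta> g h * c) = cop_dual f \<beta> * c"
  by (simp_all add: cop_dual_def sum_distrib_left sum_distrib_right ac_simps case_prod_unfold)

lemma cop_dual_cop: "cop_dual f (\<lambda>g h. cop x (\<lambda>u v. \<beta> g h u v)) = cop x (\<lambda>u v. cop_dual f (\<lambda>g h. \<beta> g h u v))"
  unfolding cop_dual_def by (simp add: case_prod_unfold cop_sum)

lemma cop_dual_TW: "cop_dual f (\<lambda>g h. twist a x (\<lambda>u v. \<beta> g h u v)) = twist a x (\<lambda>u v. cop_dual f (\<lambda>g h. \<beta> g h u v))"
  unfolding twist_def by (simp add: cop_dual_cop)

lemma cop_dual_cong: "(\<And>g h. g \<in> vcarrier K \<Longrightarrow> h \<in> vcarrier K \<Longrightarrow> \<beta> g h = \<gamma> g h) \<Longrightarrow> cop_dual f \<beta> = cop_dual f \<gamma>"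
  unfolding cop_dual_def by (intro sum.cong) (auto simp: e'_K)

lemma cop_dual_eval: assumes "f \<in> vcarrier K" "x \<in> cH" "y \<in> cH"
  shows "cop_dual f (\<lambda>g h. g x * h y) = f (y \<star> x)"
proof -
  have l: "lin (\<lambda>x. f (y \<star> x))" "lin (\<lambda>y. f (y \<star> x))" for x y
    by (simp_all add: lin_def K_add K_sc assms)
  have "f (y \<star> x) = (\<Sum>i\<in>I. coord i x * (\<Sum>j\<in>I. coord j y * f (e j \<star> e i)))"
    by (subst lin_expand[OF l(1)], subst lin_expand[OF l(2)]) (rule refl)
  also have "\<dots> = cop_dual f (\<lambda>g h. g x * h y)"
    unfolding cop_dual_def sum.cartesian_product[symmetric] using assms
    by (simp add: coord_dual sum_distrib_left ac_simps cong: sum.cong)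
  finally show ?thesis by simp
qed

text \<open>The coproduct of the dual is a definite description. Existence is witnessed by the
  explicit tensor \<open>?t\<close> over the dual basis; uniqueness holds because evaluations at
  pairs of basis vectors are coordinates on the tensor square.\<close>

lemma comul_K:
  assumes f: "f \<in> vcarrier K"
  shows "comul K f \<in> vcarrier (tspace K K)"
    and "x \<in> cH \<Longrightarrow> y \<in> cH \<Longrightarrow> comul K f (\<lambda>g h. g x * h y) = f (y \<star> x)"
proof -
  let ?KK = "tspace K K"
  let ?P = "\<lambda>t. t \<in> vcarrier ?KK \<and> (\<forall>a\<in>cH. \<forall>b\<in>cH. t (\<lambda>f1 f2. f1 a * f2 b) = f (b \<star> a))"
  let ?t = "\<Sum>q\<in>I \<times> I. vscale ?KK (f (e (snd q) \<star> e (fst q))) (tens K K (e' (fst q)) (e' (snd q)))"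
  note KK = is_vspace_tspace[OF Kv Kv]
  have b: "bilinear_on K K scalars (\<lambda>f1 f2. f1 a * f2 b)" if "a \<in> cH" "b \<in> cH" for a b
    using that by (intro bilinear_product eval_linear)
  have "?P ?t"
  proof (intro conjI ballI)
    show "?t \<in> vcarrier ?KK"
      by (intro vspace_sum_closed[OF KK] is_vspace_ring(8)[OF KK] tens_closed) (auto simp: e'_K)
    fix x y assume xy: "x \<in> cH" "y \<in> cH"
    then show "?t (\<lambda>f1 f2. f1 x * f2 y) = f (y \<star> x)"
      using cop_dual_eval[OF f xy]
      by (simp add: sum_fun_apply tspace_eval tens_eval[OF b] cop_dual_def case_prod_unfold)
  qed
  moreover have "s = t" if "?P s" "?P t" for s t
    using that by (intro tensor_coordinates_eqI[OF coordinates_K coordinates_K, of s t]) (simp_all add: e_in)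
  ultimately have ex1: "\<exists>!t. ?P t" by blast
  have same: "tspace (dual_space H) (dual_space H) = ?KK" "tlift (dual_space H) (dual_space H) = tlift K K"
    by (rule tspace_same; simp add: dual_cop_def)+
  have lift: "tlift K K (\<lambda>f1 f2. f1 a * f2 b) t = t (\<lambda>f1 f2. f1 a * f2 b)"
    if "t \<in> vcarrier ?KK" "a \<in> cH" "b \<in> cH" for t a b
    using tlift_eval[OF Kv Kv is_vspace_scalars b linear_on_id] that by simp
  have "comul K f = (THE t. t \<in> vcarrier ?KK \<and>
        (\<forall>a\<in>cH. \<forall>b\<in>cH. tlift K K (\<lambda>f1 f2. f1 a * f2 b) t = f (mul H b a)))"
    unfolding same[symmetric] by (simp add: dual_cop_def)
  also have "\<dots> = (THE t. ?P t)"
    by (intro arg_cong[where f = The] ext conj_cong refl ball_cong) (simp add: lift mul_tmul)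
  finally have "?P (comul K f)" using theI'[OF ex1] by simp
  then show "comul K f \<in> vcarrier ?KK"
    and "x \<in> cH \<Longrightarrow> y \<in> cH \<Longrightarrow> comul K f (\<lambda>g h. g x * h y) = f (y \<star> x)" by auto
qed

lemma comul_kop:
  assumes "f \<in> vcarrier K" "bilinear_on K K scalars \<beta>"
  shows "comul K f \<beta> = cop_dual f \<beta>"
  using tensor_coordinates[OF coordinates_K coordinates_K assms(2) comul_K(1)[OF assms(1)]]
  by (simp add: comul_K(2)[OF assms(1)] e_in cop_dual_def sum.cartesian_product cong: sum.cong)

lemma comul_K_linear: "linear_on K (tspace K K) (comul K)"
proof -
  note KK = is_vspace_tspace[OF Kv Kv]
  note [simp] = is_vspace_ring(7,8)[OF Kv] is_vspace_ring(7,8)[OF KK] comul_K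
  have "comul K (f + g) = comul K f + comul K g" if "f \<in> vcarrier K" "g \<in> vcarrier K" for f g
    using that by (intro tensor_coordinates_eqI[OF coordinates_K coordinates_K])
      (simp_all add: tspace_eval e_in)
  moreover have "comul K (vscale K c f) = vscale (tspace K K) c (comul K f)" if "f \<in> vcarrier K" for f c
    using that by (intro tensor_coordinates_eqI[OF coordinates_K coordinates_K])
      (simp_all add: tspace_eval e_in, simp add: K_scale)
  ultimately show ?thesis by (simp add: linear_on_def)
qed

lemma sw2K_eval:
  assumes "is_vspace U" "bilinear_on K K U b" "linear_on U scalars \<phi>" "f \<in> vcarrier K"
  shows "\<phi> (sw2 K b f) = cop_dual f (\<lambda>g h. \<phi> (b g h))"
proof -
  have "bilinear_on K K scalars (\<lambda>x y. \<phi> (b x y))"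
    by (intro bilinear_onI linear_on_comp[OF assms(3)] bilinear_onD[OF assms(2)])
  then show ?thesis
    using tlift_eval[OF Kv Kv assms(1,2,3) comul_K(1)[OF assms(4)]] comul_kop[OF assms(4)]
    by (simp add: sw2_def)
qed

lemma sw2K_linear:
  assumes "is_vspace U" "bilinear_on K K U b"
  shows "linear_on K U (sw2 K b)"
  unfolding sw2_def by (rule linear_on_comp[OF linear_tlift[OF Kv Kv assms] comul_K_linear])

lemma sw2K_param:
  assumes U: "is_vspace U" and Z: "is_vspace Z"
    and b: "\<And>z. z \<in> vcarrier Z \<Longrightarrow> bilinear_on K K U (b z)"
    and l: "\<And>x y. x \<in> vcarrier K \<Longrightarrow> y \<in> vcarrier K \<Longrightarrow> linear_on Z U (\<lambda>z. b z x y)"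
    and x: "x \<in> vcarrier K"
  shows "linear_on Z U (\<lambda>z. sw2 K (b z) x)"
  unfolding sw2_def by (rule tlift_linear_param[OF Kv Kv U Z b l comul_K(1)[OF x]])

section \<open>The transposed inverse antipode and the two actions\<close>

lemma lin_KS: "f \<in> vcarrier K \<Longrightarrow> lin (\<lambda>x. f (S x))"
  by (simp add: lin_def K_add K_sc)

definition transposeS :: "('h \<Rightarrow> 'k) \<Rightarrow> 'h \<Rightarrow> 'k" where "transposeS f = restrictH (\<lambda>x. f (S x))"

lemma transposeS_in: "f \<in> vcarrier K \<Longrightarrow> transposeS f \<in> vcarrier K"
  by (simp add: transposeS_def restrictH_K lin_KS)

lemma transpose_inv:
  assumes f: "f \<in> vcarrier K"
  shows "inv_into (vcarrier K) (transpose H T) f = transposeS f"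
proof (rule inv_into_f_eq)
  show "inj_on (transpose H T) (vcarrier K)"
  proof
    fix f g assume fg: "f \<in> vcarrier K" "g \<in> vcarrier K" "transpose H T f = transpose H T g"
    show "f = g"
    proof (rule K_eqI[OF fg(1,2)])
      fix x assume x: "x \<in> cH"
      from fg(3) have "transpose H T f (S x) = transpose H T g (S x)" by simp
      then show "f x = g x" using x by (simp add: transpose_def T_S proj_id)
    qed
  qed
  show "transposeS f \<in> vcarrier K" using f by (rule transposeS_in)
  show "transpose H T (transposeS f) = f"
    using f by (auto simp: fun_eq_iff transpose_def transposeS_def T_in S_T K_carrier)
qed

lemma transposeS_linear: "linear_on K K transposeS"
proof -
  note [simp] = is_vspace_ring(7,8)[OF Kv] transposeS_in
  have "transposeS (f + g) = transposeS f + transposeS g" for f g by (auto simp: transposeS_def restrictH_def fun_eq_iff)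
  moreover have "transposeS (vscale K c f) = vscale K c (transposeS f)" for c f
    by (auto simp: transposeS_def restrictH_def fun_eq_iff K_scale)
  ultimately show ?thesis by (simp add: linear_on_def)
qed

text \<open>At y the legs of \<open>f\<close> contribute f'(a') f''(y) f'''(S(a'')), and the
  opposite coproduct of the dual joins the three arguments in reverse order, giving f(S(a'') y
  a').\<close>

lemma left_act_eq:
  assumes a: "a \<in> cH" and f: "f \<in> vcarrier K"
  shows "left_act H T a f = restrictH (\<lambda>y. cop a (\<lambda>u v. f (S v \<star> y \<star> u)))"
proof -
  let ?B = "\<lambda>f1 f2 f3. vscale K (mul K f1 (transposeS f3) a) f2"
  have cong: "sw3 K (\<lambda>f1 f2 f3. vscale K (mul K f1 (inv_into (vcarrier K) (transpose H T) f3) a) f2) f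
      = sw3 K ?B f"
    unfolding sw3_def sw2_def
    by (intro tlift_cong) (simp add: transpose_inv)
  have m1: "linear_on K scalars (\<lambda>f3. mul K f1 (transposeS f3) a)" if "f1 \<in> vcarrier K" for f1
    using linear_on_comp[OF eval_linear[OF a] linear_on_comp[OF bilinear_onD(1)[OF mul_K_bilinear that] transposeS_linear]] .
  have m2: "linear_on K scalars (\<lambda>f1. mul K f1 (transposeS f3) a)" if "f3 \<in> vcarrier K" for f3
    using linear_on_comp[OF eval_linear[OF a] bilinear_onD(2)[OF mul_K_bilinear transposeS_in[OF that]]] .
  have s1: "linear_on K K (\<lambda>z. vscale K (\<phi> z) g)" if "linear_on K scalars \<phi>" "g \<in> vcarrier K" for \<phi> g
    using that is_vspace_ring[OF Kv] by (simp add: linear_on_def scalars_def)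
  have s2: "linear_on K K (vscale K c)" for c
    using is_vspace_ring[OF Kv] by (simp add: linear_on_def mult.commute)
  have b1: "bilinear_on K K K (\<lambda>f2 f3. ?B f1 f2 f3)" if "f1 \<in> vcarrier K" for f1
    using that by (intro bilinear_onI s1 s2 m1)
  have b2: "bilinear_on K K K (\<lambda>f1 y. sw2 K (\<lambda>f2 f3. ?B f1 f2 f3) y)"
    by (intro bilinear_onI sw2K_linear sw2K_param b1 Kv s1 m2)
  have lF: "lin (\<lambda>y. cop a (\<lambda>u v. f (S v \<star> y \<star> u)))"
    by (simp add: lin_def K_add K_sc f)
  have in_K: "sw3 K ?B f \<in> vcarrier K"
    unfolding sw3_def using linear_onD(1)[OF sw2K_linear[OF Kv b2] f] .
  have "sw3 K ?B f = restrictH (\<lambda>y. cop a (\<lambda>u v. f (S v \<star> y \<star> u)))"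
  proof (rule K_eqI[OF in_K restrictH_K[OF lF]])
    fix y assume y: "y \<in> cH"
    have inner: "sw2 K (\<lambda>f2 f3. ?B f1 f2 f3) h y = cop a (\<lambda>u v. f1 (proj u) * h (S v \<star> y))"
      if f1: "f1 \<in> vcarrier K" and h: "h \<in> vcarrier K" for f1 h
    proof -
      have "sw2 K (\<lambda>f2 f3. ?B f1 f2 f3) h y = cop_dual h (\<lambda>f2 f3. mul K f1 (transposeS f3) a * f2 y)"
        using sw2K_eval[OF Kv b1[OF f1] eval_linear[OF y] h] by (simp add: K_scale)
      also have "\<dots> = cop_dual h (\<lambda>f2 f3. cop a (\<lambda>u v. f1 (proj u) * (f2 y * f3 (S v))))"
        by (intro cop_dual_cong)
          (simp add: mul_K a f1 transposeS_in, simp add: transposeS_def ac_simps flip: cop_mult(2))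
      also have "\<dots> = cop a (\<lambda>u v. f1 (proj u) * h (S v \<star> y))"
        by (simp add: cop_dual_cop cop_dual_mult cop_dual_eval h y)
      finally show ?thesis .
    qed
    have "sw3 K ?B f y = cop_dual f (\<lambda>f1 h. cop a (\<lambda>u v. f1 (proj u) * h (S v \<star> y)))"
      unfolding sw3_def using sw2K_eval[OF Kv b2 eval_linear[OF y] f]
      by (simp add: inner cong: cop_dual_cong)
    also have "\<dots> = cop a (\<lambda>u v. f (S v \<star> y \<star> u))"
      by (simp add: cop_dual_cop cop_dual_eval f)
    finally show "sw3 K ?B f y = restrictH (\<lambda>y. cop a (\<lambda>u v. f (S v \<star> y \<star> u))) y"
      using y by simp
  qed
  then show ?thesis unfolding left_act_def cong .
qed

lemma cH_eqI:
  assumes "x \<in> cH" "y \<in> cH" "\<And>F. lin F \<Longrightarrow> F x = F y"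
  shows "x = y"
proof -
  have "proj x = proj y" unfolding proj_def by (intro sum.cong) (simp_all add: assms(3) lin_coord)
  then show ?thesis using assms by (simp add: proj_id)
qed

text \<open>In f(S(a''') a') nothing stands between the two legs of \<open>a\<close>, so this action
  is a twist at \<open>one\<close>.\<close>

lemma right_act_eq:
  assumes a: "a \<in> cH" and f: "f \<in> vcarrier K"
  shows "right_act H T a f \<in> cH"
    and "lin F \<Longrightarrow> F (right_act H T a f) = twist a one (\<lambda>z c. f (proj z) * F c)"
proof -
  let ?B = "\<lambda>a1 a2 a3. sc (f (S a3 \<star> a1)) a2"
  have inv: "inv_into cH T x = S x" if "x \<in> cH" for x
    using that by (simp add: S_def proj_id)
  have cong: "right_act H T a f = sw3 H ?B a"
    unfolding right_act_def sw3_def sw2_def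
    by (intro tlift_cong) (simp add: inv mul_tmul)
  have m1: "linear_on H scalars (\<lambda>a3. f (S a3 \<star> a1))" for a1
    by (simp add: linear_on_def scalars_def K_add K_sc f)
  have m2: "linear_on H scalars (\<lambda>a1. f (S a3 \<star> a1))" for a3
    by (simp add: linear_on_def scalars_def K_add K_sc f)
  have s1: "linear_on H H (\<lambda>z. sc (\<phi> z) g)" if "linear_on H scalars \<phi>" "g \<in> cH" for \<phi> g
    using that is_vspace_ring[OF Hv] by (simp add: linear_on_def scalars_def)
  have s2: "linear_on H H (sc c)" for c
    using is_vspace_ring[OF Hv] by (simp add: linear_on_def mult.commute)
  have b1: "bilinear_on H H H (\<lambda>a2 a3. ?B a1 a2 a3)" for a1
    by (intro bilinear_onI s1 s2 m1)
  have b2: "bilinear_on H H H (\<lambda>a1 y. sw2 H (\<lambda>a2 a3. ?B a1 a2 a3) y)"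
    by (intro bilinear_onI sw2_linear sw2_param b1 Hv s1 m2)
  show "right_act H T a f \<in> cH"
    unfolding cong sw3_def using linear_onD(1)[OF sw2_linear[OF Hv b2] a] .
  assume F: "lin F"
  have "F (right_act H T a f) = cop a (\<lambda>a1 y. cop y (\<lambda>a2 a3. f (S a3 \<star> a1) * F a2))"
    unfolding cong sw3_def
    using sw2_eval[OF Hv b2 lin_linear_on[OF F] a] sw2_eval[OF Hv b1 lin_linear_on[OF F]]
    by (simp add: linD[OF F] cong: cop_cong)
  also have "\<dots> = twist a one (\<lambda>z c. f (proj z) * F c)"
    by (simp add: twist_def tmul_assoc cop_coassoc)
  finally show "F (right_act H T a f) = twist a one (\<lambda>z c. f (proj z) * F c)" .
qed


section \<open>The algebra structure of the double\<close>

abbreviation V where "V \<equiv> tspace K H"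
abbreviation D where "D \<equiv> quantum_double H T"

lemma Vv: "is_vspace V"
  by (rule is_vspace_tspace[OF Kv Hv])

lemma D_carrier: "vcarrier D = vcarrier V" "vscale D = vscale V"
  by (simp_all add: quantum_double_def Let_def)

lemma Dv: "is_vspace D"
  using Vv by (subst is_vspace_same[of D V]) (simp_all add: D_carrier)

lemma linear_on_D: "linear_on D = linear_on V" "linear_on W D = linear_on W V"
  by (simp_all add: linear_on_def D_carrier fun_eq_iff)

lemma bilinear_on_D: "bilinear_on D D D = bilinear_on V V V"
  by (simp add: bilinear_on_def linear_on_D D_carrier fun_eq_iff)

lemma left_act_in: "a \<in> cH \<Longrightarrow> f \<in> vcarrier K \<Longrightarrow> left_act H T a f \<in> vcarrier K"
  using restrictH_K[of "\<lambda>y. cop a (\<lambda>u v. f (S v \<star> y \<star> u))"]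
  by (simp add: left_act_eq lin_def K_add K_sc)

lemma K_scale_in: "f \<in> vcarrier K \<Longrightarrow> (\<lambda>x. c * f x) \<in> vcarrier K"
  using is_vspace_ring(8)[OF Kv, of f c] by (simp only: K_scale)

lemma left_act_linear:
  shows "f \<in> vcarrier K \<Longrightarrow> linear_on H K (\<lambda>a. left_act H T a f)"
    and "a \<in> cH \<Longrightarrow> linear_on K K (left_act H T a)"
proof -
  note [simp] = is_vspace_ring(7,8)[OF Hv] is_vspace_ring(7)[OF Kv] K_scale_in left_act_in
  show "f \<in> vcarrier K \<Longrightarrow> linear_on H K (\<lambda>a. left_act H T a f)"
    unfolding linear_on_def by (intro conjI ballI allI; simp?) (auto simp: left_act_eq K_scale restrictH_def)
  show "a \<in> cH \<Longrightarrow> linear_on K K (left_act H T a)"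
    unfolding linear_on_def
    by (intro conjI ballI allI; simp?) (auto simp: left_act_eq K_scale restrictH_def)
qed

lemma right_act_linear:
  shows "f \<in> vcarrier K \<Longrightarrow> linear_on H H (\<lambda>a. right_act H T a f)"
    and "a \<in> cH \<Longrightarrow> linear_on K H (right_act H T a)"
proof -
  note [simp] = is_vspace_ring(7,8)[OF Hv] is_vspace_ring(7,8)[OF Kv] right_act_eq(1)
  show "f \<in> vcarrier K \<Longrightarrow> linear_on H H (\<lambda>a. right_act H T a f)"
    unfolding linear_on_def by (intro conjI ballI allI; (rule cH_eqI)?) (simp_all add: right_act_eq(2) linD)
  have *: "vscale K c g (proj z) * y = c * (g (proj z) * y)" for c g z y by (simp add: K_scale)
  show "a \<in> cH \<Longrightarrow> linear_on K H (right_act H T a)"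
    unfolding linear_on_def
    by (intro conjI ballI allI; (rule cH_eqI)?) (simp_all add: right_act_eq(2) linD * distrib_right)
qed

section \<open>Bilinearity of the product of the double\<close>

text \<open>A single term of the product, with the legs of \<open>a\<close> and of \<open>g\<close>
  as free arguments. Linearity in each of the six arguments is what the nested sums in
  \<open>dmul\<close> require.\<close>

definition smash :: "('h \<Rightarrow> 'k) \<Rightarrow> 'h \<Rightarrow> 'h \<Rightarrow> ('h \<Rightarrow> 'k) \<Rightarrow> 'h \<Rightarrow> ('h \<Rightarrow> 'k) \<Rightarrow> ('k, 'h \<Rightarrow> 'k, 'h) tensor" where
  "smash f b a1 g1 a2 g2 = infty H (mul K f (left_act H T a1 g1)) (mul H (right_act H T a2 g2) b)"

definition dmul :: "('h \<Rightarrow> 'k) \<Rightarrow> 'h \<Rightarrow> ('h \<Rightarrow> 'k) \<Rightarrow> 'h \<Rightarrow> ('k, 'h \<Rightarrow> 'k, 'h) tensor" where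
  "dmul f a g b = sw2 H (\<lambda>a1 a2. sw2 K (\<lambda>g1 g2. smash f b a1 g1 a2 g2) g) a"

lemma mul_D: "mul D s t = tlift K H (\<lambda>f a. tlift K H (\<lambda>g b. dmul f a g b) t) s"
  by (simp add: quantum_double_def Let_def dmul_def smash_def)

lemma infty_in: "f \<in> vcarrier K \<Longrightarrow> a \<in> cH \<Longrightarrow> infty H f a \<in> vcarrier V"
  by (simp add: infty_def tens_closed)

lemma linear_infty:
  shows "linear_on Z K \<phi> \<Longrightarrow> b \<in> cH \<Longrightarrow> linear_on Z V (\<lambda>z. infty H (\<phi> z) b)"
    and "linear_on Z H \<psi> \<Longrightarrow> f \<in> vcarrier K \<Longrightarrow> linear_on Z V (\<lambda>z. infty H f (\<psi> z))"
  unfolding infty_def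
  using linear_on_comp[OF bilinear_onD(2)[OF bilinear_tens[OF Kv Hv]]]
    linear_on_comp[OF bilinear_onD(1)[OF bilinear_tens[OF Kv Hv]]] by blast+

lemma linear_mul:
  shows "linear_on Z K \<phi> \<Longrightarrow> g \<in> vcarrier K \<Longrightarrow> linear_on Z K (\<lambda>z. mul K (\<phi> z) g)"
    and "linear_on Z K \<phi> \<Longrightarrow> g \<in> vcarrier K \<Longrightarrow> linear_on Z K (\<lambda>z. mul K g (\<phi> z))"
    and "linear_on Z H \<psi> \<Longrightarrow> b \<in> cH \<Longrightarrow> linear_on Z H (\<lambda>z. mul H (\<psi> z) b)"
    and "linear_on Z H \<psi> \<Longrightarrow> b \<in> cH \<Longrightarrow> linear_on Z H (\<lambda>z. mul H b (\<psi> z))"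
  using linear_on_comp[OF bilinear_onD(2)[OF mul_K_bilinear]] linear_on_comp[OF bilinear_onD(1)[OF mul_K_bilinear]]
    linear_on_comp[OF bilinear_onD(2)[OF mul_bil]] linear_on_comp[OF bilinear_onD(1)[OF mul_bil]] by blast+

lemmas D_linear = linear_infty linear_mul left_act_linear right_act_linear linear_on_id
  mul_K_in mul_in left_act_in right_act_eq(1)

lemma smash_linear:
  assumes "f \<in> vcarrier K" "b \<in> cH" "a1 \<in> cH" "g1 \<in> vcarrier K" "a2 \<in> cH" "g2 \<in> vcarrier K"
  shows "linear_on K V (\<lambda>f. smash f b a1 g1 a2 g2)"
    and "linear_on H V (\<lambda>b. smash f b a1 g1 a2 g2)"
    and "linear_on H V (\<lambda>a1. smash f b a1 g1 a2 g2)"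
    and "linear_on K V (\<lambda>g1. smash f b a1 g1 a2 g2)"
    and "linear_on H V (\<lambda>a2. smash f b a1 g1 a2 g2)"
    and "linear_on K V (\<lambda>g2. smash f b a1 g1 a2 g2)"
  unfolding smash_def by (intro D_linear assms)+

lemma smash_bilinear:
  assumes "f \<in> vcarrier K" "b \<in> cH" "a1 \<in> cH" "a2 \<in> cH"
  shows "bilinear_on K K V (\<lambda>g1 g2. smash f b a1 g1 a2 g2)"
  using assms by (intro bilinear_onI smash_linear)

lemma smash_sw2_bilinear:
  assumes "f \<in> vcarrier K" "b \<in> cH" "g \<in> vcarrier K"
  shows "bilinear_on H H V (\<lambda>a1 a2. sw2 K (\<lambda>g1 g2. smash f b a1 g1 a2 g2) g)"
  using assms by (intro bilinear_onI sw2K_param smash_bilinear smash_linear Vv Hv)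

lemma dmul_linear:
  assumes "f \<in> vcarrier K" "a \<in> cH" "g \<in> vcarrier K" "b \<in> cH"
  shows "linear_on K V (\<lambda>f. dmul f a g b)" "linear_on H V (\<lambda>a. dmul f a g b)"
    and "linear_on K V (\<lambda>g. dmul f a g b)" "linear_on H V (\<lambda>b. dmul f a g b)"
  unfolding dmul_def
  by (intro sw2_linear sw2_param smash_sw2_bilinear sw2K_linear sw2K_param smash_bilinear smash_linear
      Vv Hv Kv assms; assumption?)+

lemma dmul_bilinear:
  shows "f \<in> vcarrier K \<Longrightarrow> a \<in> cH \<Longrightarrow> bilinear_on K H V (\<lambda>g b. dmul f a g b)"
    and "t \<in> vcarrier V \<Longrightarrow> bilinear_on K H V (\<lambda>f a. tlift K H (\<lambda>g b. dmul f a g b) t)"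
proof -
  show 1: "bilinear_on K H V (\<lambda>g b. dmul f a g b)" if "f \<in> vcarrier K" "a \<in> cH" for f a
    using that by (intro bilinear_onI dmul_linear)
  assume "t \<in> vcarrier V"
  then show "bilinear_on K H V (\<lambda>f a. tlift K H (\<lambda>g b. dmul f a g b) t)"
    by (intro bilinear_onI tlift_linear_param 1 Kv Hv Vv dmul_linear)
qed

lemma mul_D_bilinear: "bilinear_on D D D (mul D)"
  unfolding bilinear_on_D mul_D[abs_def]
  by (intro bilinear_onI tlift_linear_param linear_tlift dmul_bilinear Kv Hv Vv)

lemma mul_D_in: "s \<in> vcarrier V \<Longrightarrow> t \<in> vcarrier V \<Longrightarrow> mul D s t \<in> vcarrier V"
  using linear_onD(1)[OF bilinear_onD(1)[OF mul_D_bilinear]] by (simp add: D_carrier)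

lemma mul_D_add:
  assumes "s \<in> vcarrier V" "t \<in> vcarrier V" "r \<in> vcarrier V"
  shows "mul D (s + t) r = mul D s r + mul D t r" "mul D r (s + t) = mul D r s + mul D r t"
    "mul D 0 r = 0" "mul D r 0 = 0"
  using assms linear_onD(2)[OF bilinear_onD(2)[OF mul_D_bilinear]]
    linear_onD(2)[OF bilinear_onD(1)[OF mul_D_bilinear]]
    linear_on_0[OF bilinear_onD(2)[OF mul_D_bilinear] Dv]
    linear_on_0[OF bilinear_onD(1)[OF mul_D_bilinear] Dv]
  by (simp_all only: D_carrier)

lemma mul_D_infty:
  "f \<in> vcarrier K \<Longrightarrow> a \<in> cH \<Longrightarrow> g \<in> vcarrier K \<Longrightarrow> b \<in> cH \<Longrightarrow>
    mul D (infty H f a) (infty H g b) = dmul f a g b"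
  unfolding mul_D
  by (simp add: infty_def tlift_tens[OF Vv dmul_bilinear(2)] tlift_tens[OF Vv dmul_bilinear(1)] tens_closed)

text \<open>The embedding of the double into \<open>End(H)\<close> sending \<open>f \<infinity> a\<close> to \<open>x \<mapsto> f(x) a\<close>.\<close>

definition hat :: "('k, 'h \<Rightarrow> 'k, 'h) tensor \<Rightarrow> 'h \<Rightarrow> 'h" where
  "hat s x = (\<Sum>i\<in>I. sc (s (\<lambda>f b. f (proj x) * coord i b)) (e i))"

lemma hat_left [simp]: "hat (s + t) x = hat s x + hat t x" "hat (vscale V c s) x = sc c (hat s x)" "hat 0 x = 0"
  by (simp_all add: hat_def tspace_eval sum.distrib scale_left_distrib scale_sum_right)

lemma hat_in [simp]: "hat s x \<in> cH"
  unfolding hat_def by (intro vspace_sum_closed[OF Hv] is_vspace_ring(8)[OF Hv] e_in)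

lemma hat_proj [simp]: "proj (hat s x) = hat s x" "hat s (proj x) = hat s x"
  by (simp_all add: proj_id) (simp add: hat_def)

lemma coord_proj: "i \<in> I \<Longrightarrow> coord i (proj x) = coord i x"
  by (rule linD(3)[OF lin_coord])

lemma coord_linear: "linear_on H scalars (coord i)"
  by (simp add: linear_on_def scalars_def)

lemma hat_infty: 
  assumes "f \<in> vcarrier K"
  shows "hat (infty H f a) x = sc (f (proj x)) (proj a)"
proof -
  have "bilinear_on K H scalars (\<lambda>f b. f (proj x) * coord i b)" for i
    by (intro bilinear_product eval_linear coord_linear) simp
  then show ?thesis
    by (simp add: hat_def infty_def tens_eval proj_def[of a] scale_sum_right)
qed

lemma hat_right [simp]:
  assumes "s \<in> vcarrier V"
  shows "hat s (x + y) = hat s x + hat s y" "hat s (sc c x) = sc c (hat s x)"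
proof -
  have "hat s (x + y) = hat s x + hat s y \<and> hat s (sc c x) = sc c (hat s x)"
    using assms
  proof (induction rule: tspace_induct)
    case (pure f a)
    then show ?case
      unfolding infty_def[symmetric] by (simp add: hat_infty K_add K_sc scale_left_distrib)
  qed (simp_all add: algebra_simps scale_right_distrib del: plus_fun_apply zero_fun_apply)
  then show "hat s (x + y) = hat s x + hat s y" "hat s (sc c x) = sc c (hat s x)" by auto
qed

text \<open>The coordinates of \<open>s\<close> with respect to the frame built from
  \<open>e'\<close> and \<open>e\<close> are the matrix entries of \<open>hat s\<close>, so
  \<open>hat\<close> is injective.\<close>

lemma hat_eqI:
  assumes "s \<in> vcarrier V" "t \<in> vcarrier V"
    and "\<And>x F. lin F \<Longrightarrow> F (hat s x) = F (hat t x)"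
  shows "s = t"
proof (rule tensor_coordinates_eqI[OF coordinates_K coordinates_H assms(1,2)])
  fix j l assume jl: "j \<in> I" "l \<in> I"
  have "coord l (hat s (e j)) = coord l (hat t (e j))"
    by (rule assms(3)) (simp add: lin_coord jl)
  then show "s (\<lambda>f b. f (e j) * coord l b) = t (\<lambda>f b. f (e j) * coord l b)"
    using jl finI by (simp add: hat_def coord_e proj_e if_distrib[of "\<lambda>c. _ * c"] cong: if_cong)
qed

lemma hat_linear: "lin F \<Longrightarrow> linear_on V scalars (\<lambda>s. F (hat s x))"
  by (simp add: linear_on_def linD) (simp add: scalars_def)

section \<open>The product in terms of endomorphisms\<close>

text \<open>Here the product defined through two actions takes the form f g(S(a''') ? a') on the
  dual side and a'' b in \<open>H\<close>. The evaluated actions are made explicit term by term in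
  \<open>smash\<close>; their collapse is \<open>twist_twice\<close>.\<close>

lemma hat_dmul:
  assumes f: "f \<in> vcarrier K" and a: "a \<in> cH" and g: "g \<in> vcarrier K" and b: "b \<in> cH" and F: "lin F"
  shows "F (hat (dmul f a g b) x) = cop x (\<lambda>x1 x2. f (proj x1) * twist a x2 (\<lambda>z c. g (proj z) * F (c \<star> b)))"
proof -
  let ?\<phi> = "\<lambda>s. F (hat s x)"
  note \<phi> = hat_linear[OF F, of x]
  have G: "lin (\<lambda>c. F (c \<star> b))" by (simp add: lin_def linD[OF F])
  have smash: "?\<phi> (smash f b a1 g1 a2 g2) = cop x (\<lambda>x1 x2. f (proj x1) *
      cop a1 (\<lambda>u v. twist a2 one (\<lambda>w d. g1 (S v \<star> x2 \<star> u) * g2 (proj w) * F (d \<star> b))))"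
    if "a1 \<in> cH" "a2 \<in> cH" "g1 \<in> vcarrier K" "g2 \<in> vcarrier K" for a1 a2 g1 g2
  proof -
    have 1: "cop a1 (\<lambda>u v. twist a2 one (\<lambda>w d. g1 (S v \<star> x2 \<star> u) * g2 (proj w) * F (d \<star> b)))
        = cop a1 (\<lambda>u v. g1 (S v \<star> x2 \<star> u)) * twist a2 one (\<lambda>w d. g2 (proj w) * F (d \<star> b))" for x2
      by (simp add: mult.assoc)
    have "?\<phi> (smash f b a1 g1 a2 g2) = mul K f (left_act H T a1 g1) (proj x) * F (right_act H T a2 g2 \<star> b)"
      using that f by (simp add: smash_def hat_infty mul_K_in left_act_in linD[OF F] mul_tmul right_act_eq(1) b)
    also have "\<dots> = cop x (\<lambda>x1 x2. f (proj x1) * cop a1 (\<lambda>u v. g1 (S v \<star> x2 \<star> u)))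
        * twist a2 one (\<lambda>w d. g2 (proj w) * F (d \<star> b))"
      using that f by (simp add: mul_K left_act_in right_act_eq(2)[OF _ _ G]) (simp add: left_act_eq)
    finally show ?thesis unfolding 1 by (simp flip: mult.assoc)
  qed
  have G2: "bil (\<lambda>z c. g (proj z) * F (c \<star> b))"
    by (simp add: multilin linD[OF F] K_add K_sc g algebra_simps)
  have "?\<phi> (dmul f a g b) = cop a (\<lambda>a1 a2. cop_dual g (\<lambda>g1 g2. ?\<phi> (smash f b a1 g1 a2 g2)))"
    unfolding dmul_def using f a g b
      sw2_eval[OF Vv smash_sw2_bilinear[OF f b g] \<phi> a] sw2K_eval[OF Vv smash_bilinear[OF f b] \<phi> g]
    by (simp cong: cop_cong)
  also have "\<dots> = cop a (\<lambda>a1 a2. cop_dual g (\<lambda>g1 g2. cop x (\<lambda>x1 x2. f (proj x1) *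
      cop a1 (\<lambda>u v. twist a2 one (\<lambda>w d. g1 (S v \<star> x2 \<star> u) * g2 (proj w) * F (d \<star> b))))))"
    by (simp add: smash cong: cop_cong cop_dual_cong)
  \<comment> \<open>The two legs of \<open>g\<close> are evaluated at S(v) x2 u and at w, so they
    recombine to \<open>g\<close> at the product, with w on the left because the coproduct of the
    dual is opposite.\<close>
  also have "\<dots> = cop a (\<lambda>a1 a2. cop x (\<lambda>x1 x2. f (proj x1) *
      cop a1 (\<lambda>u v. twist a2 one (\<lambda>w d. g (proj (w \<star> (S v \<star> x2 \<star> u))) * F (d \<star> b)))))"
    by (simp add: cop_dual_cop cop_dual_TW cop_dual_mult cop_dual_eval g)
  also have "\<dots> = cop x (\<lambda>x1 x2. f (proj x1) * cop a (\<lambda>a1 a2. 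
      cop a1 (\<lambda>u v. twist a2 one (\<lambda>w d. g (proj (w \<star> (S v \<star> x2 \<star> u))) * F (d \<star> b)))))"
    by (subst cop_commute) (simp only: cop_mult)
  finally show ?thesis using twist_twice[OF G2] by simp
qed

lemma zero_simps: "cop 0 F = 0" "cop x (\<lambda>u v. 0) = 0" "twist 0 x F = 0" "twist a x (\<lambda>u v. 0) = 0" "x \<star> 0 = 0"
  using cop_sc[of 0 0] cop_mult(1)[of _ 0] twist_left(2)[of 0 0] twist_mult(1)[of _ _ 0] tmul_simps(4)[of x 0 0] by simp_all

text \<open>\<open>hat_dmul\<close> for pure tensors, extended additively in both factors.\<close>

lemma hat_mul:
  assumes s: "s \<in> vcarrier V" and t: "t \<in> vcarrier V" and F: "lin F"
  shows "F (hat (mul D s t) x) = cop x (\<lambda>x1 x2. twist (hat s x1) x2 (\<lambda>z c. F (c \<star> hat t z)))"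
  using s
proof (induction rule: tspace_induct)
  case (pure f a)
  show ?case using t
  proof (induction rule: tspace_induct)
    case (pure g b)
    with \<open>f \<in> vcarrier K\<close> \<open>a \<in> cH\<close> show ?case
      unfolding infty_def[symmetric] by (simp add: mul_D_infty hat_dmul F hat_infty linD[OF F])
  next
    case zero
    from pure have "tens K H f a \<in> vcarrier V" by (simp add: tens_closed)
    then show ?case
      by (simp only: mul_D_add hat_left lin_0[OF F] zero_simps)
  next
    case (add s t)
    from pure have "tens K H f a \<in> vcarrier V" by (simp add: tens_closed)
    with add show ?case
      by (simp only: mul_D_add hat_left linD[OF F] tmul_simps twist_plus cop_plus)
  qed
next
  case zero
  show ?case
    using t by (simp only: mul_D_add hat_left lin_0[OF F] zero_simps)
next
  case (add s s')
  with t show ?case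
    by (simp only: mul_D_add hat_left linD[OF F] twist_left cop_plus)
qed

lemma unity_K: "unity K = restrictH eps" "unity K \<in> vcarrier K"
proof -
  show "unity K = restrictH eps" by (auto simp: dual_cop_def restrictH_def fun_eq_iff eps_def proj_id)
  then show "unity K \<in> vcarrier K" by (simp add: restrictH_K lin_eps)
qed

lemma unity_D: "unity D = infty H (unity K) one" "unity D \<in> vcarrier V"
  by (simp_all add: quantum_double_def Let_def one_def infty_in unity_K(2))

lemma hat_unity: "hat (unity D) x = sc (eps x) one"
  by (simp add: unity_D(1) hat_infty[OF unity_K(2)]) (simp add: unity_K(1))

text \<open>For associativity, \<open>1\<close> treats a product standing in the twisting argument
  by \<open>twist_tmul\<close>, and \<open>2\<close> a product evaluated at the twisted point by
  \<open>twist_cop_inner\<close>. Both sides become the same nested twist and differ by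
  coassociativity in x. The unit laws follow from the counit axiom.\<close>

lemma algebra_D: "is_algebra D"
  unfolding is_algebra_def D_carrier
proof (intro conjI ballI)
  show "is_vspace D" "bilinear_on D D D (mul D)" "unity D \<in> vcarrier V"
    by (rule Dv mul_D_bilinear unity_D)+
next
  fix s t r assume str: "s \<in> vcarrier V" "t \<in> vcarrier V" "r \<in> vcarrier V"
  show "mul D (mul D s t) r = mul D s (mul D t r)"
  proof (rule hat_eqI)
    fix x F assume F: "lin F"
    note hm = hat_mul[OF _ _ F] and [simp] = mul_D_in str linD[OF F]
    have 1: "twist (hat (mul D s t) x1) x2 (\<lambda>w d. F (d \<star> hat r w))
        = cop x1 (\<lambda>y1 y2. twist (hat s y1) y2 (\<lambda>z c. twist c x2 (\<lambda>w d. twist (hat t z) w (\<lambda>w' d'. F (d \<star> d' \<star> hat r w')))))"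
      for x1 x2
    proof -
      have b: "bil (\<lambda>w d. F (d \<star> hat r w))" by (simp add: multilin)
      have "twist (hat (mul D s t) x1) x2 (\<lambda>w d. F (d \<star> hat r w))
          = cop x1 (\<lambda>y1 y2. twist (hat s y1) y2 (\<lambda>z c. twist (c \<star> hat t z) x2 (\<lambda>w d. F (d \<star> hat r w))))"
        using str by (intro hat_mul[where F = "\<lambda>v. twist v x2 (\<lambda>w d. F (d \<star> hat r w))"]) (simp_all add: lin_def)
      then show ?thesis by (simp add: twist_tmul[OF b])
    qed
    have 2: "twist a x2 (\<lambda>z c. F (c \<star> hat (mul D t r) z))
        = cop x2 (\<lambda>y1 y2. twist a y1 (\<lambda>z c. twist c y2 (\<lambda>w d. twist (hat t z) w (\<lambda>w' d'. F (d \<star> d' \<star> hat r w')))))"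
      for a x2
    proof -
      have "F (c \<star> hat (mul D t r) z) = cop z (\<lambda>z1 z2. twist (hat t z1) z2 (\<lambda>w d. F (c \<star> (d \<star> hat r w))))" for c z
        using str by (intro hat_mul[where F = "\<lambda>v. F (c \<star> v)"]) (simp_all add: lin_def)
      moreover have "tril (\<lambda>z1 z2 c. twist (hat t z1) z2 (\<lambda>w d. F (c \<star> (d \<star> hat r w))))"
        by (simp add: multilin twist_def)
      ultimately show ?thesis by (simp add: twist_cop_inner tmul_assoc)
    qed
    show "F (hat (mul D (mul D s t) r) x) = F (hat (mul D s (mul D t r)) x)"
      by (simp add: hm 1 2 cop_coassoc)
  qed (simp_all add: mul_D_in str)
next
  fix s assume s: "s \<in> vcarrier V"
  show "mul D (unity D) s = s"
  proof (rule hat_eqI)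
    fix x F assume F: "lin F"
    note [simp] = s linD[OF F]
    have "F (hat (mul D (unity D) s) x) = cop x (\<lambda>x1 x2. eps x1 * F (hat s x2))"
      by (simp add: hat_mul[OF unity_D(2) s F] hat_unity twist_one multilin)
    also have "\<dots> = F (hat s x)" by (rule counit_cop) (simp add: lin_def)
    finally show "F (hat (mul D (unity D) s) x) = F (hat s x)" .
  qed (simp_all add: mul_D_in s unity_D(2))
  show "mul D s (unity D) = s"
  proof (rule hat_eqI)
    fix x F assume F: "lin F"
    note [simp] = s linD[OF F]
    have "F (hat (mul D s (unity D)) x) = cop x (\<lambda>x1 x2. F (hat s x1) * eps x2)"
      by (simp add: hat_mul[OF s unity_D(2) F] hat_unity twist_eps F) (simp add: mult.commute)
    also have "\<dots> = F (hat s x)" by (rule counit_cop) (simp add: lin_def)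
    finally show "F (hat (mul D s (unity D)) x) = F (hat s x)" .
  qed (simp_all add: mul_D_in s unity_D(2))
qed


section \<open>The coalgebra structure of the double\<close>

abbreviation D2 where "D2 \<equiv> tspace D D"
abbreviation D3 where "D3 \<equiv> tspace D D2"

lemma D2v: "is_vspace D2" and D3v: "is_vspace D3"
  by (intro is_vspace_tspace Dv)+

lemma tens_VV: "tens V V = tens D D"
  by (rule tspace_same) (simp_all add: D_carrier)

definition dcomul :: "('h \<Rightarrow> 'k) \<Rightarrow> 'h \<Rightarrow>
    ('k, ('k, 'h \<Rightarrow> 'k, 'h) tensor, ('k, 'h \<Rightarrow> 'k, 'h) tensor) tensor" where
  "dcomul f a = sw2 H (\<lambda>a1 a2. sw2 K (\<lambda>f1 f2. tens D D (infty H f1 a1) (infty H f2 a2)) f) a"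

lemma comul_D: "comul D = tlift K H dcomul"
  by (simp add: quantum_double_def Let_def dcomul_def[abs_def] tens_VV[symmetric, unfolded quantum_double_def Let_def])

lemma linear_tens_D:
  shows "linear_on Z V \<phi> \<Longrightarrow> t \<in> vcarrier V \<Longrightarrow> linear_on Z D2 (\<lambda>z. tens D D (\<phi> z) t)"
    and "linear_on Z V \<phi> \<Longrightarrow> t \<in> vcarrier V \<Longrightarrow> linear_on Z D2 (\<lambda>z. tens D D t (\<phi> z))"
  using linear_on_comp[OF bilinear_onD(2)[OF bilinear_tens[OF Dv Dv]]]
    linear_on_comp[OF bilinear_onD(1)[OF bilinear_tens[OF Dv Dv]]]
  by (simp_all add: D_carrier linear_on_D)

lemma dcomul_bilinear':
  shows "a1 \<in> cH \<Longrightarrow> a2 \<in> cH \<Longrightarrow> bilinear_on K K D2 (\<lambda>f1 f2. tens D D (infty H f1 a1) (infty H f2 a2))"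
    and "f \<in> vcarrier K \<Longrightarrow>
      bilinear_on H H D2 (\<lambda>a1 a2. sw2 K (\<lambda>f1 f2. tens D D (infty H f1 a1) (infty H f2 a2)) f)"
proof -
  show 1: "bilinear_on K K D2 (\<lambda>f1 f2. tens D D (infty H f1 a1) (infty H f2 a2))"
    if "a1 \<in> cH" "a2 \<in> cH" for a1 a2
    using that by (intro bilinear_onI linear_tens_D linear_infty linear_on_id infty_in)
  assume "f \<in> vcarrier K"
  then show "bilinear_on H H D2 (\<lambda>a1 a2. sw2 K (\<lambda>f1 f2. tens D D (infty H f1 a1) (infty H f2 a2)) f)"
    by (intro bilinear_onI sw2K_param 1 linear_tens_D linear_infty linear_on_id infty_in D2v Hv)
qed

lemma dcomul_bilinear: "bilinear_on K H D2 dcomul"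
  unfolding dcomul_def[abs_def]
  by (intro bilinear_onI sw2_linear sw2_param sw2K_linear dcomul_bilinear' D2v Kv)

lemma comul_D_linear: "linear_on D D2 (comul D)"
  unfolding comul_D linear_on_D by (intro linear_tlift Kv Hv D2v dcomul_bilinear)

lemma comul_D_in: "s \<in> vcarrier V \<Longrightarrow> comul D s \<in> vcarrier D2"
  using linear_onD(1)[OF comul_D_linear] by (simp add: D_carrier)

lemma comul_D_infty: "f \<in> vcarrier K \<Longrightarrow> a \<in> cH \<Longrightarrow> comul D (infty H f a) = dcomul f a"
  unfolding comul_D infty_def by (rule tlift_tens[OF D2v dcomul_bilinear])

lemma hat_linear_D: "lin F \<Longrightarrow> linear_on D scalars (\<lambda>s. F (hat s x))"
  by (simp add: linear_on_D hat_linear)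

text \<open>\<open>eval2 A x y F\<close> applies the bilinear form \<open>F\<close> to the image of \<open>A\<close> in \<open>End(H) \<otimes> End(H)\<close> evaluated at
  \<open>x \<otimes> y\<close>; \<open>eval3\<close> is the analogue for three factors.\<close>

definition eval2 :: "('k, ('k, 'h \<Rightarrow> 'k, 'h) tensor, ('k, 'h \<Rightarrow> 'k, 'h) tensor) tensor
    \<Rightarrow> 'h \<Rightarrow> 'h \<Rightarrow> ('h \<Rightarrow> 'h \<Rightarrow> 'k) \<Rightarrow> 'k" where
  "eval2 A x y F = (\<Sum>(i, j)\<in>I \<times> I. A (\<lambda>s t. coord i (hat s x) * coord j (hat t y)) * F (e i) (e j))"

definition eval3 :: "('k, ('k, 'h \<Rightarrow> 'k, 'h) tensor, ('k, ('k, 'h \<Rightarrow> 'k, 'h) tensor, ('k, 'h \<Rightarrow> 'k, 'h) tensor) tensor) tensor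
    \<Rightarrow> 'h \<Rightarrow> 'h \<Rightarrow> 'h \<Rightarrow> ('h \<Rightarrow> 'h \<Rightarrow> 'h \<Rightarrow> 'k) \<Rightarrow> 'k" where
  "eval3 A x y z F = (\<Sum>(i, j, k)\<in>I \<times> I \<times> I.
    A (\<lambda>s B. coord i (hat s x) * B (\<lambda>t u. coord j (hat t y) * coord k (hat u z))) * F (e i) (e j) (e k))"

section \<open>Separating double and triple tensors by their values\<close>

lemma coord_hat_linear: "linear_on D scalars (\<lambda>s. coord i (hat s x))"
  by (simp add: linear_on_def scalars_def D_carrier)

lemma eval2_form: "bilinear_on D D scalars (\<lambda>s t. coord i (hat s x) * coord j (hat t y))"
  by (intro bilinear_product coord_hat_linear)

lemma eval3_form: "bilinear_on D D2 scalars
    (\<lambda>s B. coord i (hat s x) * B (\<lambda>t u. coord j (hat t y) * coord k (hat u z)))"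
  by (intro bilinear_product coord_hat_linear linear_eval)

lemma bil_expand: assumes "bil F"
  shows "F u v = (\<Sum>(i, j)\<in>I \<times> I. coord i u * coord j v * F (e i) (e j))"
proof -
  have l: "lin (\<lambda>x. F x v)" "lin (F x)" for x v using assms by (simp_all add: bil_def)
  show ?thesis
    unfolding sum.cartesian_product[symmetric]
    by (subst lin_expand[OF l(1)], subst lin_expand[OF l(2)]) (simp add: sum_distrib_left mult.assoc)
qed

lemma tril_expand: assumes "tril F"
  shows "F u v w = (\<Sum>(i, j, k)\<in>I \<times> I \<times> I. coord i u * (coord j v * coord k w) * F (e i) (e j) (e k))"
proof -
  have l: "lin (\<lambda>x. F x v w)" "bil (F x)" for x v w using assms by (simp_all add: tril_def)
  show ?thesis
    unfolding sum.cartesian_product[symmetric]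
    by (subst lin_expand[OF l(1)], subst bil_expand[OF l(2)])
      (simp add: sum.cartesian_product case_prod_unfold sum_distrib_left mult.assoc)
qed

lemma eval2_tens: "bil F \<Longrightarrow> eval2 (tens D D s t) x y F = F (hat s x) (hat t y)"
  by (simp add: eval2_def tens_eval[OF eval2_form] bil_expand[of F "hat s x"])

lemma eval3_tens3: "tril F \<Longrightarrow> eval3 (tens3 D s t u) x y z F = F (hat s x) (hat t y) (hat u z)"
  by (simp add: eval3_def tens3_def tens_eval[OF eval3_form] tens_eval[OF eval2_form] tril_expand[of F "hat s x"])

lemma eval2_left [simp]: "eval2 (A + B) x y F = eval2 A x y F + eval2 B x y F" "eval2 0 x y F = 0"
    "eval2 (vscale D2 c A) x y F = c * eval2 A x y F"
  by (simp_all add: eval2_def tspace_eval sum.distrib distrib_right case_prod_unfold sum_distrib_left mult.assoc)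

lemma eval3_left [simp]: "eval3 (A + B) x y z F = eval3 A x y z F + eval3 B x y z F" "eval3 0 x y z F = 0"
    "eval3 (vscale D3 c A) x y z F = c * eval3 A x y z F"
  by (simp_all add: eval3_def tspace_eval sum.distrib distrib_right case_prod_unfold sum_distrib_left mult.assoc)

lemma eval2_plus [simp]: "eval2 A x y (\<lambda>u v. F u v + G u v) = eval2 A x y F + eval2 A x y G"
  "eval2 A x y (\<lambda>u v. c * F u v) = c * eval2 A x y F" "eval2 A x y (\<lambda>u v. 0) = 0"
  by (simp_all add: eval2_def sum.distrib algebra_simps case_prod_unfold sum_distrib_left)

lemma eval3_plus [simp]: "eval3 A x y z (\<lambda>u v w. F u v w + G u v w) = eval3 A x y z F + eval3 A x y z G"
  "eval3 A x y z (\<lambda>u v w. c * F u v w) = c * eval3 A x y z F" "eval3 A x y z (\<lambda>u v w. 0) = 0"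
  by (simp_all add: eval3_def sum.distrib algebra_simps case_prod_unfold sum_distrib_left)

lemma eval2_linear: "linear_on D2 scalars (\<lambda>A. eval2 A x y F)"
  by (simp add: linear_on_def scalars_def)

lemma eval3_linear: "linear_on D3 scalars (\<lambda>A. eval3 A x y z F)"
  by (simp add: linear_on_def scalars_def)

lemma D2_induct [consumes 1, case_names pure zero add]:
  assumes "A \<in> vcarrier D2"
    and "\<And>s t. s \<in> vcarrier V \<Longrightarrow> t \<in> vcarrier V \<Longrightarrow> P (tens D D s t)"
    and "P 0"
    and "\<And>A B. A \<in> vcarrier D2 \<Longrightarrow> B \<in> vcarrier D2 \<Longrightarrow> P A \<Longrightarrow> P B \<Longrightarrow> P (A + B)"
  shows "P A"
  using assms(1) by (induction rule: tspace_induct) (use assms(2-4) D_carrier in blast)+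

lemma tens3_in: "s \<in> vcarrier V \<Longrightarrow> t \<in> vcarrier V \<Longrightarrow> u \<in> vcarrier V \<Longrightarrow> tens3 D s t u \<in> vcarrier D3"
  by (simp add: tens3_def tens_closed D_carrier)

lemma D3_induct [consumes 1, case_names pure zero add]:
  assumes "A \<in> vcarrier D3"
    and pure: "\<And>s t u. s \<in> vcarrier V \<Longrightarrow> t \<in> vcarrier V \<Longrightarrow> u \<in> vcarrier V \<Longrightarrow> P (tens3 D s t u)"
    and zero: "P 0"
    and add: "\<And>A B. A \<in> vcarrier D3 \<Longrightarrow> B \<in> vcarrier D3 \<Longrightarrow> P A \<Longrightarrow> P B \<Longrightarrow> P (A + B)"
  shows "P A"
  using assms(1)
proof (induction rule: tspace_induct)
  case (pure s B)
  note b = bilinear_onD(1)[OF bilinear_tens[OF Dv D2v] pure(1)]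
  show ?case using pure(2)
  proof (induction rule: D2_induct)
    case (pure t u)
    with \<open>s \<in> _\<close> show ?case using assms(2) by (simp add: tens3_def D_carrier)
  next
    case zero
    show ?case using assms(3) by (simp only: linear_on_0[OF b D2v])
  next
    case (add A B)
    then show ?case using linear_onD(1)[OF b] by (simp only: linear_onD(2)[OF b] assms(4))
  qed
qed (use assms(3,4) in blast)+

lemma eval2_eval:
  assumes "A \<in> vcarrier D2" "bil F"
  shows "A (\<lambda>s t. F (hat s x) (hat t y)) = eval2 A x y F"
proof -
  note F = bilD[OF assms(2)]
  have "bilinear_on D D scalars (\<lambda>s t. F (hat s x) (hat t y))"
    by (simp add: bilinear_on_def linear_on_def scalars_def D_carrier F)
  with assms(1) show ?thesis
    by (induction rule: D2_induct) (simp_all add: tens_eval eval2_tens assms(2) del: plus_fun_apply zero_fun_apply,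
      simp_all)
qed

lemma coordinates_D: "coordinates D (I \<times> I) (\<lambda>(i, j). infty H (e' i) (e j)) (\<lambda>(i, j) s. coord j (hat s (e i)))"
proof -
  have "coord j (hat s (e i)) = s (\<lambda>f b. f (e i) * coord j b)" if "i \<in> I" "j \<in> I" for s i j
    using that finI by (simp add: hat_def coord_e proj_e if_distrib[of "\<lambda>c. _ * c"] cong: if_cong)
  then have "(\<Sum>q\<in>I \<times> I. vscale V ((\<lambda>(j, l) t. t (\<lambda>x y. x (e j) * coord l y)) q s) ((\<lambda>(j, l). tens K H (e' j) (e l)) q))
      = (\<Sum>q\<in>I \<times> I. vscale D ((\<lambda>(i, j) s. coord j (hat s (e i))) q s) ((\<lambda>(i, j). infty H (e' i) (e j)) q))" for s
    by (intro sum.cong) (auto simp: D_carrier infty_def)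
  then show ?thesis
    using coordinates_tspace[OF coordinates_K coordinates_H] Dv
    by (auto simp: coordinates_def D_carrier infty_in e'_K e_in coord_hat_linear)
qed

text \<open>The coordinate functionals of the double are entries of \<open>hat\<close>, so their
  products are values of \<open>eval2\<close> at basis vectors for a suitable bilinear
  \<open>F\<close>.\<close>

lemma eval2_eqI:
  assumes "A \<in> vcarrier D2" "B \<in> vcarrier D2"
    and "\<And>x y F. bil F \<Longrightarrow> eval2 A x y F = eval2 B x y F"
  shows "A = B"
proof (rule tensor_coordinates_eqI[OF coordinates_D coordinates_D assms(1,2)])
  fix q r assume "q \<in> I \<times> I" "r \<in> I \<times> I"
  then obtain i j k l where [simp]: "q = (i, j)" "r = (k, l)" "i \<in> I" "j \<in> I" "k \<in> I" "l \<in> I" by auto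
  have b: "bil (\<lambda>u v. coord j u * coord l v)"
    using lin_coord by (simp add: multilin algebra_simps)
  show "A (\<lambda>s t. (case q of (i, j) \<Rightarrow> \<lambda>s. coord j (hat s (e i))) s * (case r of (i, j) \<Rightarrow> \<lambda>s. coord j (hat s (e i))) t)
      = B (\<lambda>s t. (case q of (i, j) \<Rightarrow> \<lambda>s. coord j (hat s (e i))) s * (case r of (i, j) \<Rightarrow> \<lambda>s. coord j (hat s (e i))) t)"
    using eval2_eval[OF assms(1) b, of "e i" "e k"] eval2_eval[OF assms(2) b, of "e i" "e k"] assms(3)[OF b]
    by simp
qed

lemma eval3_eqI:
  assumes "A \<in> vcarrier D3" "B \<in> vcarrier D3"
    and "\<And>x y z F. tril F \<Longrightarrow> eval3 A x y z F = eval3 B x y z F"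
  shows "A = B"
proof (rule tensor_coordinates_eqI[OF coordinates_D coordinates_tspace[OF coordinates_D coordinates_D] assms(1,2)])
  fix q r assume "q \<in> I \<times> I" "r \<in> (I \<times> I) \<times> (I \<times> I)"
  then obtain i j k l m n where [simp]: "q = (i, j)" "r = ((k, l), m, n)"
    and "i \<in> I" "k \<in> I" "m \<in> I" and jln: "j \<in> I" "l \<in> I" "n \<in> I" by auto
  \<comment> \<open>Each coordinate functional is 1 at one basis vector and 0 at the others, so the
    threefold sum in \<open>eval3\<close> keeps a single term.\<close>
  have pick: "eval3 A (e i) (e k) (e m) (\<lambda>u v w. coord j u * (coord l v * coord n w))
      = A (\<lambda>s B. coord j (hat s (e i)) * B (\<lambda>t u. coord l (hat t (e k)) * coord n (hat u (e m))))" for A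
  proof -
    have "eval3 A (e i) (e k) (e m) (\<lambda>u v w. coord j u * (coord l v * coord n w))
        = (\<Sum>a\<in>I. if j = a then \<Sum>b\<in>I. if l = b then \<Sum>c\<in>I. if n = c then
            A (\<lambda>s B. coord a (hat s (e i)) * B (\<lambda>t u. coord b (hat t (e k)) * coord c (hat u (e m)))) else 0 else 0 else 0)"
      unfolding eval3_def sum.cartesian_product[symmetric]
      by (auto simp: coord_e intro!: sum.cong)
    then show ?thesis using jln finI by simp
  qed
  have b: "tril (\<lambda>u v w. coord j u * (coord l v * coord n w))"
    using lin_coord jln by (simp add: multilin algebra_simps)
  show "A (\<lambda>s t. (case q of (i, j) \<Rightarrow> \<lambda>s. coord j (hat s (e i))) s * (case r of (q, r) \<Rightarrow> \<lambda>t.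
        t (\<lambda>x y. (case q of (i, j) \<Rightarrow> \<lambda>s. coord j (hat s (e i))) x * (case r of (i, j) \<Rightarrow> \<lambda>s. coord j (hat s (e i))) y)) t)
      = B (\<lambda>s t. (case q of (i, j) \<Rightarrow> \<lambda>s. coord j (hat s (e i))) s * (case r of (q, r) \<Rightarrow> \<lambda>t.
        t (\<lambda>x y. (case q of (i, j) \<Rightarrow> \<lambda>s. coord j (hat s (e i))) x * (case r of (i, j) \<Rightarrow> \<lambda>s. coord j (hat s (e i))) y)) t)"
    using assms(3)[OF b, of "e i" "e k" "e m"] by (simp add: pick)
qed

lemma eval2_tlift:
  assumes "is_vspace U" "bilinear_on D D U b" "linear_on U scalars \<phi>" "A \<in> vcarrier D2" "bil F"
    and "\<And>s t. s \<in> vcarrier V \<Longrightarrow> t \<in> vcarrier V \<Longrightarrow> \<phi> (b s t) = F (hat s x) (hat t y)"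
  shows "\<phi> (tlift D D b A) = eval2 A x y F"
proof -
  have "\<phi> (tlift D D b A) = A (\<lambda>s t. \<phi> (b s t))"
    by (rule tlift_eval[OF Dv Dv assms(1-4)])
  also have "\<dots> = A (\<lambda>s t. F (hat s x) (hat t y))"
    using assms(6) by (intro tspace_eval_cong[OF Dv Dv assms(4)]) (simp add: D_carrier)
  finally show ?thesis by (simp add: eval2_eval assms(4,5))
qed

section \<open>The coproduct and the counit in terms of endomorphisms\<close>

text \<open>The legs of the dual factor satisfy f'(x) f''(y) = f(yx), which accounts for the
  reversed product under \<open>hat s\<close>; the legs of the other factor give the coproduct of
  the value.\<close>

lemma eval2_comul:
  assumes s: "s \<in> vcarrier V" and F: "bil F"
  shows "eval2 (comul D s) x y F = cop (hat s (y \<star> x)) F"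
  using s
proof (induction rule: tspace_induct)
  case (pure f a)
  note \<phi> = eval2_linear[of x y F]
  have "eval2 (dcomul f a) x y F = cop a (\<lambda>a1 a2. cop_dual f (\<lambda>f1 f2. F (hat (infty H f1 a1) x) (hat (infty H f2 a2) y)))"
    unfolding dcomul_def
    using sw2_eval[OF D2v dcomul_bilinear'(2)[OF pure(1)] \<phi> pure(2)]
      sw2K_eval[OF D2v dcomul_bilinear'(1) \<phi> pure(1)]
    by (simp add: eval2_tens F cong: cop_cong)
  also have "\<dots> = cop a (\<lambda>a1 a2. cop_dual f (\<lambda>f1 f2. f1 (proj x) * f2 (proj y) * F a1 a2))"
    by (intro cop_cong cop_dual_cong) (simp add: hat_infty bilD[OF F] ac_simps)
  also have "\<dots> = f (y \<star> x) * cop a F"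
    by (simp add: cop_dual_mult cop_dual_eval pure)
  finally show ?case
    unfolding infty_def[symmetric] using pure by (simp add: comul_D_infty hat_infty)
next
  case zero
  show ?case by (simp only: linear_on_0[OF comul_D_linear Dv] eval2_left hat_left zero_simps)
next
  case (add s t)
  then show ?case by (simp only: linear_onD(2)[OF comul_D_linear] D_carrier eval2_left hat_left cop_add)
qed

lemma sw2D_eval:
  assumes "is_vspace U" "bilinear_on D D U b" "linear_on U scalars \<phi>" "s \<in> vcarrier V" "bil F"
    and "\<And>s t. s \<in> vcarrier V \<Longrightarrow> t \<in> vcarrier V \<Longrightarrow> \<phi> (b s t) = F (hat s x) (hat t y)"
  shows "\<phi> (sw2 D b s) = cop (hat s (y \<star> x)) F"
  unfolding sw2_def eval2_comul[OF assms(4,5), symmetric]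
  by (rule eval2_tlift[OF assms(1-3) comul_D_in[OF assms(4)] assms(5,6)])

lemma sw2D_linear:
  assumes "is_vspace U" "bilinear_on D D U b"
  shows "linear_on D U (sw2 D b)"
  unfolding sw2_def by (rule linear_on_comp[OF linear_tlift[OF Dv Dv assms] comul_D_linear])

lemma sw2D_param:
  assumes U: "is_vspace U" and Z: "is_vspace Z"
    and b: "\<And>z. z \<in> vcarrier Z \<Longrightarrow> bilinear_on D D U (b z)"
    and l: "\<And>x y. x \<in> vcarrier D \<Longrightarrow> y \<in> vcarrier D \<Longrightarrow> linear_on Z U (\<lambda>z. b z x y)"
    and x: "x \<in> vcarrier D"
  shows "linear_on Z U (\<lambda>z. sw2 D (b z) x)"
  unfolding sw2_def by (rule tlift_linear_param[OF Dv Dv U Z b l]) (use x comul_D_in D_carrier in auto)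

lemma counit_D_linear: "linear_on D scalars (counit D)"
  and counit_D: "s \<in> vcarrier V \<Longrightarrow> counit D s = eps (hat s one)"
proof -
  have c: "counit D = tlift K H (\<lambda>f a. f one * counit H a)"
    by (simp add: quantum_double_def Let_def one_def)
  have b: "bilinear_on K H scalars (\<lambda>f a. f one * counit H a)"
    by (intro bilinear_product eval_linear eps_linear one_cH)
  have l: "linear_on V scalars (counit D)"
    unfolding c by (intro linear_tlift Kv Hv is_vspace_scalars b)
  then show "linear_on D scalars (counit D)" by (simp add: linear_on_D)
  assume s: "s \<in> vcarrier V"
  show "counit D s = eps (hat s one)"
  proof (rule tspace_linear_unique[OF Kv Hv is_vspace_scalars l hat_linear[OF lin_eps] _ s])
    fix f a assume "f \<in> vcarrier K" "a \<in> cH"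
    then show "counit D (tens K H f a) = eps (hat (tens K H f a) one)"
      using tlift_tens[OF is_vspace_scalars b]
      by (simp add: c hat_infty[unfolded infty_def]) (simp add: eps_def proj_id)
  qed
qed

lemma tens3_bilinear:
  "r \<in> vcarrier V \<Longrightarrow> bilinear_on D D D3 (\<lambda>s t. tens3 D s t r)"
  "r \<in> vcarrier V \<Longrightarrow> bilinear_on D D D3 (\<lambda>s t. tens3 D r s t)"
  "r \<in> vcarrier V \<Longrightarrow> bilinear_on D D D3 (\<lambda>s t. tens3 D s r t)"
  unfolding D_carrier[symmetric] by (intro bilinear_onI tens3_linear Dv; assumption)+

lemma sw2_tens3_bilinear:
  "bilinear_on D D D3 (\<lambda>y x3. sw2 D (\<lambda>x1 x2. tens3 D x1 x2 x3) y)"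
  "bilinear_on D D D3 (\<lambda>x1 y. sw2 D (\<lambda>x2 x3. tens3 D x1 x2 x3) y)"
  by (intro bilinear_onI sw2D_linear sw2D_param D3v Dv tens3_bilinear[folded D_carrier] tens3_linear; assumption)+

lemma eval3_sw2_tens3:
  assumes "s \<in> vcarrier V" "r \<in> vcarrier V" "tril F"
  shows "eval3 (sw2 D (\<lambda>x1 x2. tens3 D x1 x2 r) s) x y z F = cop (hat s (y \<star> x)) (\<lambda>u v. F u v (hat r z))"
    and "eval3 (sw2 D (\<lambda>x2 x3. tens3 D r x2 x3) s) x y z F = cop (hat s (z \<star> y)) (\<lambda>u v. F (hat r x) u v)"
  using assms
  by (intro sw2D_eval[OF D3v tens3_bilinear(1) eval3_linear] sw2D_eval[OF D3v tens3_bilinear(2) eval3_linear];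
    simp add: eval3_tens3 multilin)+

text \<open>Both sides of coassociativity evaluate \<open>hat s\<close> at z y x, with a bracketing
  that depends on the grouping, so associativity and coassociativity of \<open>H\<close> are
  combined. For the counit laws one point is \<open>one\<close>, which leaves the counit axiom of
  \<open>H\<close> at \<open>hat s x\<close>.\<close>

lemma coalgebra_D: "is_coalgebra D"
  unfolding is_coalgebra_def D_carrier
proof (intro conjI ballI)
  show "is_vspace D" "linear_on D D2 (comul D)" "linear_on D scalars (counit D)"
    by (rule Dv comul_D_linear counit_D_linear)+
next
  fix s assume s: "s \<in> vcarrier V"
  show "sw2 D (\<lambda>y x3. sw2 D (\<lambda>x1 x2. tens3 D x1 x2 x3) y) s = sw2 D (\<lambda>x1 y. sw2 D (\<lambda>x2 x3. tens3 D x1 x2 x3) y) s"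
  proof (rule eval3_eqI)
    fix x y z F assume F: "tril F"
    have "eval3 (sw2 D (\<lambda>y x3. sw2 D (\<lambda>x1 x2. tens3 D x1 x2 x3) y) s) x y z F
        = cop (hat s (z \<star> (y \<star> x))) (\<lambda>c w. cop c (\<lambda>u v. F u v w))"
      by (rule sw2D_eval[OF D3v sw2_tens3_bilinear(1) eval3_linear s])
        (simp_all add: eval3_sw2_tens3 F, simp add: multilin trilD[OF F])
    moreover have "eval3 (sw2 D (\<lambda>x1 y. sw2 D (\<lambda>x2 x3. tens3 D x1 x2 x3) y) s) x y z F
        = cop (hat s (z \<star> y \<star> x)) (\<lambda>u c. cop c (\<lambda>v w. F u v w))"
      by (rule sw2D_eval[OF D3v sw2_tens3_bilinear(2) eval3_linear s])
        (simp_all add: eval3_sw2_tens3 F, simp add: multilin trilD[OF F])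
    ultimately show "eval3 (sw2 D (\<lambda>y x3. sw2 D (\<lambda>x1 x2. tens3 D x1 x2 x3) y) s) x y z F
        = eval3 (sw2 D (\<lambda>x1 y. sw2 D (\<lambda>x2 x3. tens3 D x1 x2 x3) y) s) x y z F"
      by (simp add: tmul_assoc cop_coassoc)
  qed (use s linear_onD(1)[OF sw2D_linear[OF D3v sw2_tens3_bilinear(1)]]
      linear_onD(1)[OF sw2D_linear[OF D3v sw2_tens3_bilinear(2)]] D_carrier in auto)
  have sl: "linear_on D D (\<lambda>s. vscale V (counit D s) t)" "linear_on D D (vscale V c)"
    if "t \<in> vcarrier V" for t c
    using that counit_D_linear is_vspace_ring[OF Vv]
    by (simp_all add: linear_on_def D_carrier scalars_def mult.commute)
  have b: "bilinear_on D D D (\<lambda>s t. vscale V (counit D s) t)" "bilinear_on D D D (\<lambda>s t. vscale V (counit D t) s)"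
    using sl is_vspace_ring(6)[OF Vv] by (auto intro!: bilinear_onI simp: D_carrier)
  show "sw2 D (\<lambda>x1 x2. vscale V (counit D x1) x2) s = s"
  proof (rule hat_eqI)
    show "sw2 D (\<lambda>x1 x2. vscale V (counit D x1) x2) s \<in> vcarrier V"
      using linear_onD(1)[OF sw2D_linear[OF Dv b(1)]] s by (simp add: D_carrier)
    fix x F assume F: "lin F"
    have "F (hat (sw2 D (\<lambda>x1 x2. vscale V (counit D x1) x2) s) x) = cop (hat s (x \<star> one)) (\<lambda>u v. eps u * F v)"
      by (rule sw2D_eval[OF Dv b(1) hat_linear_D[OF F] s])
        (simp_all add: counit_D linD[OF F] multilin algebra_simps)
    then show "F (hat (sw2 D (\<lambda>x1 x2. vscale V (counit D x1) x2) s) x) = F (hat s x)"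
      by (simp add: F)
  qed (rule s)
  show "sw2 D (\<lambda>x1 x2. vscale V (counit D x2) x1) s = s"
  proof (rule hat_eqI)
    show "sw2 D (\<lambda>x1 x2. vscale V (counit D x2) x1) s \<in> vcarrier V"
      using linear_onD(1)[OF sw2D_linear[OF Dv b(2)]] s by (simp add: D_carrier)
    fix x F assume F: "lin F"
    have "F (hat (sw2 D (\<lambda>x1 x2. vscale V (counit D x2) x1) s) x) = cop (hat s (one \<star> x)) (\<lambda>u v. F u * eps v)"
      by (rule sw2D_eval[OF Dv b(2) hat_linear_D[OF F] s])
        (simp_all add: counit_D linD[OF F] multilin algebra_simps)
    then show "F (hat (sw2 D (\<lambda>x1 x2. vscale V (counit D x2) x1) s) x) = F (hat s x)"
      by (simp add: F)
  qed (rule s)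
qed


section \<open>Multiplicativity of the coproduct and the quasi-R-matrix\<close>

abbreviation mul2 where "mul2 \<equiv> mul (tensor_alg D D)"

lemma tensor_alg_simps:
  "vcarrier (tensor_alg A B) = vcarrier (tspace A B)" "vscale (tensor_alg A B) = vscale (tspace A B)"
  by (simp_all add: tensor_alg_def)

lemma tspace_tensor_alg: "tspace D (tensor_alg D D) = D3" "tens D (tensor_alg D D) = tens D D2"
  by (rule tspace_same; simp add: tensor_alg_simps)+

lemmas mul2_bilinear = tensor_alg_bilinear[OF Dv mul_D_bilinear Dv mul_D_bilinear]
lemmas mul2_add = bilinear_mul[OF mul2_bilinear(1,3), unfolded tensor_alg_simps]
lemmas mul2_pure = mul2_bilinear(2)[unfolded D_carrier]

lemmas mul3_bilinear = tensor_alg_bilinear[OF Dv mul_D_bilinear mul2_bilinear(3,1), folded mul3_def]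
lemmas mul3_add = bilinear_mul[OF mul3_bilinear(1,3), unfolded tensor_alg_simps tspace_tensor_alg]

lemma mul3_pure:
  assumes "r \<in> vcarrier V" "s \<in> vcarrier V" "t \<in> vcarrier V" "r' \<in> vcarrier V" "s' \<in> vcarrier V" "t' \<in> vcarrier V"
  shows "mul3 D (tens3 D r s t) (tens3 D r' s' t') = tens3 D (mul D r r') (mul D s s') (mul D t t')"
  using assms mul3_bilinear(2)[unfolded tspace_tensor_alg D_carrier tensor_alg_simps]
  by (simp add: tens3_def mul2_pure tens_closed D_carrier)

lemma mul3_assoc:
  assumes "A \<in> vcarrier D3" "B \<in> vcarrier D3" "C \<in> vcarrier D3"
  shows "mul3 D (mul3 D A B) C = mul3 D A (mul3 D B C)"
proof -
  have a: "mul D (mul D x y) z = mul D x (mul D y z)"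
    if "x \<in> vcarrier D" "y \<in> vcarrier D" "z \<in> vcarrier D" for x y z
    using algebra_D that by (simp add: is_algebra_def)
  show ?thesis
    unfolding mul3_def using assms
    by (intro tensor_alg_assoc[OF Dv mul_D_bilinear mul2_bilinear(3,1) a]
        tensor_alg_assoc[OF Dv mul_D_bilinear Dv mul_D_bilinear a a])
      (simp_all add: tensor_alg_simps tspace_tensor_alg)
qed

section \<open>Products in the tensor powers of the double\<close>

text \<open>Factorwise use of \<open>hat_mul\<close>: each factor contributes its own coproduct and
  its own twist. Stating the right side through \<open>eval2\<close> of A and B makes it additive in
  both, so pure tensors suffice.\<close>

lemma eval2_mul:
  assumes A: "A \<in> vcarrier D2" and B: "B \<in> vcarrier D2" and F: "bil F"
  shows "eval2 (mul2 A B) x y F = cop x (\<lambda>x1 x2. cop y (\<lambda>y1 y2. eval2 A x1 y1 (\<lambda>a b.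
    twist a x2 (\<lambda>z c. twist b y2 (\<lambda>w d. eval2 B z w (\<lambda>u v. F (c \<star> u) (d \<star> v)))))))"
    (is "?P A B")
  using A
proof (induction A rule: D2_induct[where P = "\<lambda>A. ?P A B"])
  case (pure s s')
  note [simp] = bilD[OF F]
  show ?case using B
  proof (induction B rule: D2_induct[where P = "?P (tens D D s s')"])
    case (pure t t')
    have 1: "F (hat (mul D s t) x) v = cop x (\<lambda>x1 x2. twist (hat s x1) x2 (\<lambda>z c. F (c \<star> hat t z) v))" for v
      using pure(1) \<open>s \<in> _\<close> by (intro hat_mul[where F = "\<lambda>u. F u v"]) (simp_all add: multilin)
    have 2: "F u (hat (mul D s' t') y) = cop y (\<lambda>y1 y2. twist (hat s' y1) y2 (\<lambda>w d. F u (d \<star> hat t' w)))" for u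
      using pure(2) \<open>s' \<in> _\<close> by (intro hat_mul) (simp_all add: multilin)
    have "eval2 (mul2 (tens D D s s') (tens D D t t')) x y F = F (hat (mul D s t) x) (hat (mul D s' t') y)"
      using pure \<open>s \<in> _\<close> \<open>s' \<in> _\<close> by (simp add: mul2_pure eval2_tens F)
    also have "\<dots> = cop x (\<lambda>x1 x2. cop y (\<lambda>y1 y2. twist (hat s x1) x2 (\<lambda>z c. twist (hat s' y1) y2 (\<lambda>w d.
        F (c \<star> hat t z) (d \<star> hat t' w)))))"
      unfolding 1 unfolding 2 unfolding twist_cop ..
    also have "\<dots> = cop x (\<lambda>x1 x2. cop y (\<lambda>y1 y2. eval2 (tens D D s s') x1 y1 (\<lambda>a b.
        twist a x2 (\<lambda>z c. twist b y2 (\<lambda>w d. eval2 (tens D D t t') z w (\<lambda>u v. F (c \<star> u) (d \<star> v)))))))"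
      by (simp add: eval2_tens multilin)
    finally show ?case .
  next
    case zero
    from pure have "tens D D s s' \<in> vcarrier D2" by (simp add: tens_closed D_carrier)
    then show ?case by (simp only: mul2_add eval2_left eval2_plus zero_simps)
  next
    case (add A B)
    from pure have "tens D D s s' \<in> vcarrier D2" by (simp add: tens_closed D_carrier)
    with add show ?case by (simp only: mul2_add eval2_left eval2_plus twist_plus cop_plus)
  qed
next
  case zero
  show ?case by (simp only: mul2_add B eval2_left zero_simps)
next
  case (add A A')
  then show ?case by (simp only: mul2_add B eval2_left cop_plus)
qed

lemma eval3_mul:
  assumes A: "A \<in> vcarrier D3" and B: "B \<in> vcarrier D3" and F: "tril F"
  shows "eval3 (mul3 D A B) x y z F = cop x (\<lambda>x1 x2. cop y (\<lambda>y1 y2. cop z (\<lambda>z1 z2. eval3 A x1 y1 z1 (\<lambda>a b c.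
    twist a x2 (\<lambda>l a'. twist b y2 (\<lambda>m b'. twist c z2 (\<lambda>n c'.
      eval3 B l m n (\<lambda>u v w. F (a' \<star> u) (b' \<star> v) (c' \<star> w)))))))))"
proof -
  let ?P = "\<lambda>A B. eval3 (mul3 D A B) x y z F = cop x (\<lambda>x1 x2. cop y (\<lambda>y1 y2. cop z (\<lambda>z1 z2.
    eval3 A x1 y1 z1 (\<lambda>a b c. twist a x2 (\<lambda>l a'. twist b y2 (\<lambda>m b'. twist c z2 (\<lambda>n c'.
      eval3 B l m n (\<lambda>u v w. F (a' \<star> u) (b' \<star> v) (c' \<star> w)))))))))"
  show ?thesis using A
proof (induction A rule: D3_induct[where P = "\<lambda>A. ?P A B"])
  case (pure r s t)
  note [simp] = trilD[OF F]
  show ?case using B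
  proof (induction B rule: D3_induct[where P = "?P (tens3 D r s t)"])
    case (pure r' s' t')
    have 1: "F (hat (mul D r r') x) v w = cop x (\<lambda>x1 x2. twist (hat r x1) x2 (\<lambda>l a. F (a \<star> hat r' l) v w))" for v w
      using pure \<open>r \<in> _\<close> by (intro hat_mul[where F = "\<lambda>u. F u v w"]) (simp_all add: multilin)
    have 2: "F u (hat (mul D s s') y) w = cop y (\<lambda>y1 y2. twist (hat s y1) y2 (\<lambda>m b. F u (b \<star> hat s' m) w))" for u w
      using pure \<open>s \<in> _\<close> by (intro hat_mul[where F = "\<lambda>v. F u v w"]) (simp_all add: multilin)
    have 3: "F u v (hat (mul D t t') z) = cop z (\<lambda>z1 z2. twist (hat t z1) z2 (\<lambda>n c. F u v (c \<star> hat t' n)))" for u v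
      using pure \<open>t \<in> _\<close> by (intro hat_mul) (simp_all add: multilin)
    have "eval3 (mul3 D (tens3 D r s t) (tens3 D r' s' t')) x y z F
        = F (hat (mul D r r') x) (hat (mul D s s') y) (hat (mul D t t') z)"
      using pure \<open>r \<in> _\<close> \<open>s \<in> _\<close> \<open>t \<in> _\<close> by (simp add: mul3_pure eval3_tens3 F)
    also have "\<dots> = cop x (\<lambda>x1 x2. cop y (\<lambda>y1 y2. cop z (\<lambda>z1 z2. twist (hat r x1) x2 (\<lambda>l a.
        twist (hat s y1) y2 (\<lambda>m b. twist (hat t z1) z2 (\<lambda>n c. F (a \<star> hat r' l) (b \<star> hat s' m) (c \<star> hat t' n)))))))"
      unfolding 1 unfolding 2 unfolding 3 unfolding twist_cop ..
    also have "\<dots> = cop x (\<lambda>x1 x2. cop y (\<lambda>y1 y2. cop z (\<lambda>z1 z2. eval3 (tens3 D r s t) x1 y1 z1 (\<lambda>a b c.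
        twist a x2 (\<lambda>l a'. twist b y2 (\<lambda>m b'. twist c z2 (\<lambda>n c'.
          eval3 (tens3 D r' s' t') l m n (\<lambda>u v w. F (a' \<star> u) (b' \<star> v) (c' \<star> w)))))))))"
      by (simp add: eval3_tens3 multilin)
    finally show ?case .
  next
    case zero
    from pure show ?case by (simp only: mul3_add tens3_in eval3_left eval3_plus zero_simps)
  next
    case (add A B)
    with pure show ?case by (simp only: mul3_add tens3_in eval3_left eval3_plus twist_plus cop_plus)
  qed
next
  case zero
  show ?case by (simp only: mul3_add B eval3_left zero_simps)
next
  case (add A A')
  then show ?case by (simp only: mul3_add B eval3_left cop_plus)
qed
qed

lemma almost_bialgebra_D: "almost_bialgebra D"
  unfolding almost_bialgebra_def
proof (intro conjI ballI algebra_D coalgebra_D)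
  fix s t assume "s \<in> vcarrier D" "t \<in> vcarrier D"
  then have st: "s \<in> vcarrier V" "t \<in> vcarrier V" by (simp_all add: D_carrier)
  show "comul D (mul D s t) = mul2 (comul D s) (comul D t)"
  proof (rule eval2_eqI)
    show "comul D (mul D s t) \<in> vcarrier D2" "mul2 (comul D s) (comul D t) \<in> vcarrier D2"
      using st by (auto intro: comul_D_in mul_D_in mul2_add)
    fix x y F assume F: "bil F"
    note [simp] = bilD[OF F]
    have t: "bil (\<lambda>u v. F (c \<star> u) (d \<star> v))" for c d by (simp add: multilin)
    have G: "tril (\<lambda>z c d. cop (hat t z) (\<lambda>u v. F (c \<star> u) (d \<star> v)))" by (simp add: multilin st)
    have b: "bil (\<lambda>a b. twist a x2 (\<lambda>z c. twist b y2 (\<lambda>w d. cop (hat t (w \<star> z)) (\<lambda>u v. F (c \<star> u) (d \<star> v)))))" for x2 y2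
      by (simp add: multilin)
    have "eval2 (comul D (mul D s t)) x y F = cop (hat (mul D s t) (y \<star> x)) F"
      by (rule eval2_comul[OF mul_D_in[OF st] F])
    also have "\<dots> = cop (y \<star> x) (\<lambda>w1 w2. twist (hat s w1) w2 (\<lambda>z c. cop (c \<star> hat t z) F))"
      by (rule hat_mul[OF st lin_cop])
    also have "\<dots> = cop y (\<lambda>y1 y2. cop x (\<lambda>x1 x2. twist (hat s (y1 \<star> x1)) (y2 \<star> x2) (\<lambda>z c. cop (c \<star> hat t z) F)))"
      by (rule cop_tmul) (simp add: multilin twist_def cop_tmul F st)
    \<comment> \<open>\<open>twist_TW\<close> is read from right to left: one twist of the product
      y2 x2 becomes two separate twists by the legs of \<open>hat s (y1 \<star> x1)\<close>.\<close>
    also have "\<dots> = cop y (\<lambda>y1 y2. cop x (\<lambda>x1 x2. cop (hat s (y1 \<star> x1)) (\<lambda>a b.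
        twist a x2 (\<lambda>z c. twist b y2 (\<lambda>w d. cop (hat t (w \<star> z)) (\<lambda>u v. F (c \<star> u) (d \<star> v)))))))"
      by (simp add: twist_TW[OF G] cop_tmul[OF F])
    also have "\<dots> = eval2 (mul2 (comul D s) (comul D t)) x y F"
      by (simp add: eval2_mul comul_D_in st F eval2_comul t b) (rule cop_commute)
    finally show "eval2 (comul D (mul D s t)) x y F = eval2 (mul2 (comul D s) (comul D t)) x y F" .
  qed
qed

section \<open>The quasi-R-matrix\<close>

definition R where
  "R = (\<Sum>i\<in>I. tens D D (infty H (unity K) (e i)) (infty H (e' i) one))"

lemma R_in: "R \<in> vcarrier D2"
  unfolding R_def
  by (intro vspace_sum_closed[OF D2v] tens_closed) (auto simp: D_carrier infty_in unity_K(2) e'_K e_in)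

text \<open>The term of index i contributes eps(x) \<open>e i\<close> in the first factor and the
  i-th coordinate of y times \<open>one\<close> in the second; the sum over I reassembles y.\<close>

lemma eval2_R: assumes "bil F"
  shows "eval2 R x y F = eps x * F y one"
proof -
  have "eval2 R x y F = (\<Sum>i\<in>I. F (sc (eps x) (e i)) (sc (coord i y) one))"
    unfolding R_def
    using linear_on_sum(2)[OF eval2_linear D2v, of I "\<lambda>i. tens D D (infty H (unity K) (e i)) (infty H (e' i) one)" x y F]
    by (simp add: eval2_tens assms hat_infty unity_K(2) e'_K tens_closed D_carrier infty_in e_in proj_e
        coord_dual coord_proj cong: sum.cong) (simp add: unity_K(1))
  also have "\<dots> = eps x * (\<Sum>i\<in>I. coord i y * F (e i) one)"
    by (simp add: bilD[OF assms] sum_distrib_left)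
  also have "(\<Sum>i\<in>I. coord i y * F (e i) one) = F y one"
    using lin_expand[of "\<lambda>x. F x one" y] assms by (simp add: bil_def)
  finally show ?thesis .
qed

lemma eval3_R:
  assumes F: "tril F"
  shows "eval3 (R12 D R) x y z F = eps x * (eps z * F y one one)"
    and "eval3 (R13 D R) x y z F = eps x * (eps y * F z one one)"
    and "eval3 (R23 D R) x y z F = eps x * (eps y * F one z one)"
proof -
  note [simp] = trilD[OF F] eval3_tens3[OF F] hat_unity
  note b = tens3_bilinear[OF unity_D(2)]
  have "eval3 (R12 D R) x y z F = eval2 R x y (\<lambda>u v. eps z * F u v one)" unfolding R12_def
    by (rule eval2_tlift[OF D3v b(1) eval3_linear R_in]) (simp_all add: multilin algebra_simps)
  then show "eval3 (R12 D R) x y z F = eps x * (eps z * F y one one)"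
    by (simp add: eval2_R multilin algebra_simps)
  have "eval3 (R13 D R) x y z F = eval2 R x z (\<lambda>u w. eps y * F u one w)" unfolding R13_def
    by (rule eval2_tlift[OF D3v b(3) eval3_linear R_in]) (simp_all add: multilin algebra_simps)
  then show "eval3 (R13 D R) x y z F = eps x * (eps y * F z one one)"
    by (simp add: eval2_R multilin algebra_simps)
  have "eval3 (R23 D R) x y z F = eval2 R y z (\<lambda>v w. eps x * F one v w)" unfolding R23_def
    by (rule eval2_tlift[OF D3v b(2) eval3_linear R_in]) (simp_all add: multilin algebra_simps)
  then show "eval3 (R23 D R) x y z F = eps x * (eps y * F one z one)"
    by (simp add: eval2_R multilin algebra_simps)
qed

lemma R3_in: "R12 D R \<in> vcarrier D3" "R13 D R \<in> vcarrier D3" "R23 D R \<in> vcarrier D3"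
  unfolding R12_def R13_def R23_def
  by (rule linear_onD(1)[OF linear_tlift[OF Dv Dv D3v tens3_bilinear(1)[OF unity_D(2)]] R_in]
      linear_onD(1)[OF linear_tlift[OF Dv Dv D3v tens3_bilinear(3)[OF unity_D(2)]] R_in]
      linear_onD(1)[OF linear_tlift[OF Dv Dv D3v tens3_bilinear(2)[OF unity_D(2)]] R_in])+


text \<open>Linearity in the points rests on linearity of \<open>hat s\<close>, which is available
  for elements of the double; this is why \<open>B\<close> is required to be a tensor over it. It
  allows \<open>eval2 B\<close> to stand as a form under \<open>cop\<close> and
  \<open>twist\<close>.\<close>

lemma eval2_right [simp]:
  assumes "B \<in> vcarrier D2"
  shows "eval2 B (x + x') y F = eval2 B x y F + eval2 B x' y F" "eval2 B (sc k x) y F = k * eval2 B x y F"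
    "eval2 B x (y + y') F = eval2 B x y F + eval2 B x y' F" "eval2 B x (sc k y) F = k * eval2 B x y F"
proof -
  let ?w = "\<lambda>B x y i j. B (\<lambda>s t. coord i (hat s x) * coord j (hat t y))"
  let ?P = "\<lambda>i j B. ?w B (x + x') y i j = ?w B x y i j + ?w B x' y i j
    \<and> ?w B (sc k x) y i j = k * ?w B x y i j
    \<and> ?w B x (y + y') i j = ?w B x y i j + ?w B x y' i j \<and> ?w B x (sc k y) i j = k * ?w B x y i j"
  have "?P i j B" for i j
    using assms
  proof (induction B rule: D2_induct[where P = "?P i j"])
    case (pure s t)
    then show ?case by (simp add: tens_eval[OF eval2_form]) (simp add: algebra_simps)
  next
    case zero
    show ?case by (simp only: tspace_eval add_0 mult_zero_right simp_thms)
  next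
    case (add A B)
    then show ?case by (simp only: tspace_eval distrib_left add_ac simp_thms)
  qed
  then show "eval2 B (x + x') y F = eval2 B x y F + eval2 B x' y F" "eval2 B (sc k x) y F = k * eval2 B x y F"
    "eval2 B x (y + y') F = eval2 B x y F + eval2 B x y' F" "eval2 B x (sc k y) F = k * eval2 B x y F"
    by (simp_all add: eval2_def distrib_right sum.distrib sum_distrib_left mult.assoc case_prod_unfold)
qed

lemma eval3_right [simp]:
  assumes "B \<in> vcarrier D3"
  shows "eval3 B (x + x') y z F = eval3 B x y z F + eval3 B x' y z F" "eval3 B (sc k x) y z F = k * eval3 B x y z F"
    "eval3 B x (y + y') z F = eval3 B x y z F + eval3 B x y' z F" "eval3 B x (sc k y) z F = k * eval3 B x y z F"
    "eval3 B x y (z + z') F = eval3 B x y z F + eval3 B x y z' F" "eval3 B x y (sc k z) F = k * eval3 B x y z F"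
proof -
  let ?w = "\<lambda>B x y z i j k. B (\<lambda>s C. coord i (hat s x) * C (\<lambda>t u. coord j (hat t y) * coord k (hat u z)))"
  let ?P = "\<lambda>i j l B. ?w B (x + x') y z i j l = ?w B x y z i j l + ?w B x' y z i j l
    \<and> ?w B (sc k x) y z i j l = k * ?w B x y z i j l
    \<and> ?w B x (y + y') z i j l = ?w B x y z i j l + ?w B x y' z i j l
    \<and> ?w B x (sc k y) z i j l = k * ?w B x y z i j l
    \<and> ?w B x y (z + z') i j l = ?w B x y z i j l + ?w B x y z' i j l
    \<and> ?w B x y (sc k z) i j l = k * ?w B x y z i j l"
  have "?P i j l B"
    for i j l
    using assms
  proof (induction B rule: D3_induct[where P = "?P i j l"])
    case (pure s t u)
    then show ?case
      by (simp add: tens3_def tens_eval[OF eval2_form] tens_eval[OF eval3_form]) (simp add: algebra_simps)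
  next
    case zero
    show ?case by (simp only: tspace_eval add_0 mult_zero_right simp_thms)
  next
    case (add A B)
    then show ?case by (simp only: tspace_eval distrib_left add_ac simp_thms)
  qed
  then show "eval3 B (x + x') y z F = eval3 B x y z F + eval3 B x' y z F" "eval3 B (sc k x) y z F = k * eval3 B x y z F"
    "eval3 B x (y + y') z F = eval3 B x y z F + eval3 B x y' z F" "eval3 B x (sc k y) z F = k * eval3 B x y z F"
    "eval3 B x y (z + z') F = eval3 B x y z F + eval3 B x y z' F" "eval3 B x y (sc k z) F = k * eval3 B x y z F"
    by (simp_all add: eval3_def distrib_right sum.distrib sum_distrib_left mult.assoc case_prod_unfold)
qed

lemma E_proj [simp]: "eval2 B (proj x) y F = eval2 B x y F" "eval2 B x (proj y) F = eval2 B x y F"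
  "eval3 C (proj x) y z G = eval3 C x y z G" "eval3 C x (proj y) z G = eval3 C x y z G" "eval3 C x y (proj z) G = eval3 C x y z G"
  by (simp_all add: eval2_def eval3_def)

text \<open>In the first factor R contributes a counit, which absorbs the splitting of x; in the
  second it contributes \<open>one\<close>, whose twist is trivial. What remains is the twist of x
  by the first leg of y.\<close>

lemma eval2_R_mul:
  assumes B: "B \<in> vcarrier D2" and F: "bil F"
  shows "eval2 (mul2 R B) x y F = cop y (\<lambda>y1 y2. twist y1 x (\<lambda>z c. eval2 B z y2 (\<lambda>u v. F (c \<star> u) v)))"
proof -
  note [simp] = bilD[OF F] B
  have "eval2 (mul2 R B) x y F = cop x (\<lambda>x1 x2. cop y (\<lambda>y1 y2. eps x1 *
      twist y1 x2 (\<lambda>z c. twist one y2 (\<lambda>w d. eval2 B z w (\<lambda>u v. F (c \<star> u) (d \<star> v))))))"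
    by (simp add: eval2_mul R_in F eval2_R multilin)
  also have "\<dots> = cop y (\<lambda>y1 y2. cop x (\<lambda>x1 x2. eps x1 *
      twist y1 x2 (\<lambda>z c. eval2 B z y2 (\<lambda>u v. F (c \<star> u) v))))"
    by (subst cop_commute) (simp add: twist_one multilin)
  also have "\<dots> = cop y (\<lambda>y1 y2. twist y1 x (\<lambda>z c. eval2 B z y2 (\<lambda>u v. F (c \<star> u) v)))"
    by (simp add: multilin)
  finally show ?thesis .
qed

lemma eval3_R_mul:
  assumes B: "B \<in> vcarrier D3" and F: "tril F"
  shows "eval3 (mul3 D (R12 D R) B) x y z F
      = cop y (\<lambda>y1 y2. twist y1 x (\<lambda>l c. eval3 B l y2 z (\<lambda>u v w. F (c \<star> u) v w)))"
    and "eval3 (mul3 D (R13 D R) B) x y z F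
      = cop z (\<lambda>z1 z2. twist z1 x (\<lambda>l c. eval3 B l y z2 (\<lambda>u v w. F (c \<star> u) v w)))"
    and "eval3 (mul3 D (R23 D R) B) x y z F
      = cop z (\<lambda>z1 z2. twist z1 y (\<lambda>m c. eval3 B x m z2 (\<lambda>u v w. F u (c \<star> v) w)))"
proof -
  note [simp] = trilD[OF F] B
  have "eval3 (mul3 D (R12 D R) B) x y z F = cop x (\<lambda>x1 x2. cop y (\<lambda>y1 y2. cop z (\<lambda>z1 z2. eps x1 * (eps z1 *
      twist y1 x2 (\<lambda>l a. twist one y2 (\<lambda>m b. twist one z2 (\<lambda>n c.
        eval3 B l m n (\<lambda>u v w. F (a \<star> u) (b \<star> v) (c \<star> w)))))))))"
    by (simp add: eval3_mul R3_in F eval3_R multilin)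
  also have "\<dots> = cop y (\<lambda>y1 y2. cop x (\<lambda>x1 x2. eps x1 * cop z (\<lambda>z1 z2. eps z1 *
      twist y1 x2 (\<lambda>l a. eval3 B l y2 z2 (\<lambda>u v w. F (a \<star> u) v w)))))"
    by (subst cop_commute) (simp add: twist_one multilin)
  also have "\<dots> = cop y (\<lambda>y1 y2. twist y1 x (\<lambda>l c. eval3 B l y2 z (\<lambda>u v w. F (c \<star> u) v w)))"
    by (simp add: multilin)
  finally show "eval3 (mul3 D (R12 D R) B) x y z F
      = cop y (\<lambda>y1 y2. twist y1 x (\<lambda>l c. eval3 B l y2 z (\<lambda>u v w. F (c \<star> u) v w)))" .
  have "eval3 (mul3 D (R13 D R) B) x y z F = cop x (\<lambda>x1 x2. cop y (\<lambda>y1 y2. cop z (\<lambda>z1 z2. eps x1 * (eps y1 *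
      twist z1 x2 (\<lambda>l a. twist one y2 (\<lambda>m b. twist one z2 (\<lambda>n c.
        eval3 B l m n (\<lambda>u v w. F (a \<star> u) (b \<star> v) (c \<star> w)))))))))"
    by (simp add: eval3_mul R3_in F eval3_R multilin)
  also have "\<dots> = cop x (\<lambda>x1 x2. eps x1 * cop y (\<lambda>y1 y2. eps y1 * cop z (\<lambda>z1 z2. 
      twist z1 x2 (\<lambda>l a. eval3 B l y2 z2 (\<lambda>u v w. F (a \<star> u) v w)))))"
    by (simp add: twist_one multilin)
  also have "\<dots> = cop z (\<lambda>z1 z2. twist z1 x (\<lambda>l c. eval3 B l y z2 (\<lambda>u v w. F (c \<star> u) v w)))"
    by (simp add: multilin)
  finally show "eval3 (mul3 D (R13 D R) B) x y z F
      = cop z (\<lambda>z1 z2. twist z1 x (\<lambda>l c. eval3 B l y z2 (\<lambda>u v w. F (c \<star> u) v w)))" .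
  have "eval3 (mul3 D (R23 D R) B) x y z F = cop x (\<lambda>x1 x2. cop y (\<lambda>y1 y2. cop z (\<lambda>z1 z2. eps x1 * (eps y1 *
      twist one x2 (\<lambda>l a. twist z1 y2 (\<lambda>m b. twist one z2 (\<lambda>n c.
        eval3 B l m n (\<lambda>u v w. F (a \<star> u) (b \<star> v) (c \<star> w)))))))))"
    by (simp add: eval3_mul R3_in F eval3_R multilin)
  also have "\<dots> = cop x (\<lambda>x1 x2. eps x1 * cop y (\<lambda>y1 y2. eps y1 * cop z (\<lambda>z1 z2. 
      twist z1 y2 (\<lambda>m b. eval3 B x2 m z2 (\<lambda>u v w. F u (b \<star> v) w)))))"
    by (simp add: twist_one multilin)
  also have "\<dots> = cop z (\<lambda>z1 z2. twist z1 y (\<lambda>m c. eval3 B x m z2 (\<lambda>u v w. F u (c \<star> v) w)))"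
    by (simp add: multilin)
  finally show "eval3 (mul3 D (R23 D R) B) x y z F
      = cop z (\<lambda>z1 z2. twist z1 y (\<lambda>m c. eval3 B x m z2 (\<lambda>u v w. F u (c \<star> v) w)))" .
qed

section \<open>Coproducts of R, commutation with the coproduct, and the Yang-Baxter equation\<close>

text \<open>\<open>R23\<close> depends on its first point only through the counit, so the twist left
  over from \<open>R13\<close> dissolves by \<open>twist_eps\<close>.\<close>

lemma eval3_R13_R23: assumes F: "tril F"
  shows "eval3 (mul3 D (R13 D R) (R23 D R)) x y z F = eps x * (eps y * cop z (\<lambda>u v. F u v one))"
proof -
  note [simp] = trilD[OF F]
  have "eval3 (mul3 D (R13 D R) (R23 D R)) x y z F
      = cop z (\<lambda>z1 z2. twist z1 x (\<lambda>l c. eps l * (eps y * F c z2 one)))"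
    by (simp add: eval3_R_mul R3_in F eval3_R multilin)
  also have "\<dots> = cop z (\<lambda>z1 z2. eps x * (eps y * F z1 z2 one))"
    by (intro arg_cong[of _ _ "cop z"] ext twist_eps) (simp add: multilin algebra_simps)
  finally show ?thesis by simp
qed

lemma eval3_R13_R12: assumes F: "tril F"
  shows "eval3 (mul3 D (R13 D R) (R12 D R)) x y z F = eps x * F (z \<star> y) one one"
proof -
  note [simp] = trilD[OF F]
  have "eval3 (mul3 D (R13 D R) (R12 D R)) x y z F
      = cop z (\<lambda>z1 z2. twist z1 x (\<lambda>l c. eps l * (eps z2 * F (c \<star> y) one one)))"
    by (simp add: eval3_R_mul R3_in F eval3_R multilin)
  also have "\<dots> = cop z (\<lambda>z1 z2. eps x * (eps z2 * F (z1 \<star> y) one one))"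
    by (intro arg_cong[of _ _ "cop z"] ext twist_eps) (simp add: multilin algebra_simps)
  also have "\<dots> = eps x * cop z (\<lambda>z1 z2. F (z1 \<star> y) one one * eps z2)"
    by (simp only: cop_mult mult.commute)
  also have "\<dots> = eps x * F (z \<star> y) one one"
    by (subst counit_cop(2)) (simp_all add: multilin)
  finally show ?thesis .
qed

text \<open>With h the endomorphism of the given element, both sides of the commutation relation are
  the sum of y'' h(xy')' in the first factor and h(xy')'' in the second. The two coproduct formulas
  for R come from evaluating R at (yx, z) and at (x, zy).\<close>

lemma quasi_braided_R: "quasi_braided D R"
  unfolding quasi_braided_def D_carrier
proof (intro conjI ballI almost_bialgebra_D R_in)
  fix s assume s: "s \<in> vcarrier V"
  have sw: "bilinear_on D D D2 (\<lambda>x1 x2. tens D D x2 x1)"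
    using bilinear_onD[OF bilinear_tens[OF Dv Dv]] by (intro bilinear_onI) auto
  have op_in: "comul_op D s \<in> vcarrier D2"
    unfolding comul_op_def using linear_onD(1)[OF sw2D_linear[OF D2v sw]] s by (simp add: D_carrier)
  have op: "eval2 (comul_op D s) x y F = cop (hat s (x \<star> y)) (\<lambda>u v. F v u)" if "bil F" for x y F
    unfolding comul_op_def using that
    by (intro sw2D_eval[OF D2v sw eval2_linear s]) (simp_all add: eval2_tens bil_def)
  show "mul2 (comul_op D s) R = mul2 R (comul D s)"
  proof (rule eval2_eqI)
    show "mul2 (comul_op D s) R \<in> vcarrier D2" "mul2 R (comul D s) \<in> vcarrier D2"
      using s by (auto intro: mul2_add op_in R_in comul_D_in)
    fix x y F assume F: "bil F"
    note [simp] = bilD[OF F] s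
    have t: "twist v x2 (\<lambda>z c. eps z * twist u y2 (\<lambda>w d. F (c \<star> w) d)) = eps x2 * twist u y2 (\<lambda>w d. F (v \<star> w) d)"
      for v x2 u y2
      by (rule twist_eps) (simp add: multilin)
    have "eval2 (mul2 (comul_op D s) R) x y F = cop x (\<lambda>x1 x2. cop y (\<lambda>y1 y2.
        cop (hat s (x1 \<star> y1)) (\<lambda>u v. eps x2 * twist u y2 (\<lambda>w d. F (v \<star> w) d))))"
      by (simp add: eval2_mul op_in R_in F eval2_R op multilin t)
    also have "\<dots> = cop y (\<lambda>y1 y2. cop x (\<lambda>x1 x2.
        cop (hat s (x1 \<star> y1)) (\<lambda>u v. twist u y2 (\<lambda>w d. F (v \<star> w) d)) * eps x2))"
      by (subst cop_commute) (simp add: mult.commute)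
    also have "\<dots> = cop y (\<lambda>y1 y2. cop (hat s (x \<star> y1)) (\<lambda>u v. twist u y2 (\<lambda>w d. F (v \<star> w) d)))"
      by (subst counit_cop(2)) (simp_all add: multilin)
    \<comment> \<open>Here \<open>twist_cancel\<close> is applied to the coproduct of the value
      \<open>hat s (x \<star> y1)\<close>.\<close>
    also have "\<dots> = cop y (\<lambda>y1 y2. cop (hat s (x \<star> y1)) (\<lambda>u v. F (y2 \<star> u) v))"
      by (simp add: twist_cancel F)
    finally have L: "eval2 (mul2 (comul_op D s) R) x y F
      = cop y (\<lambda>y1 y2. cop (hat s (x \<star> y1)) (\<lambda>u v. F (y2 \<star> u) v))" .
    have "eval2 (mul2 R (comul D s)) x y F
        = cop y (\<lambda>y1 y2. twist y1 x (\<lambda>z c. cop (hat s (y2 \<star> z)) (\<lambda>u v. F (c \<star> u) v)))"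
      by (simp add: eval2_R_mul comul_D_in F eval2_comul multilin)
    \<comment> \<open>On this side \<open>twist_cancel\<close> is applied to the coproduct of the
      point y.\<close>
    also have "\<dots> = cop y (\<lambda>y1 y2. cop (hat s (x \<star> y1)) (\<lambda>u v. F (y2 \<star> u) v))"
      by (rule twist_cancel) (simp add: multilin)
    finally show "eval2 (mul2 (comul_op D s) R) x y F = eval2 (mul2 R (comul D s)) x y F"
      using L by simp
  qed
next
  show "tlift D D (\<lambda>r s. sw2 D (\<lambda>r1 r2. tens3 D r1 r2 s) r) R = mul3 D (R13 D R) (R23 D R)"
  proof (rule eval3_eqI)
    fix x y z F assume F: "tril F"
    note [simp] = trilD[OF F]
    have "eval3 (tlift D D (\<lambda>r s. sw2 D (\<lambda>r1 r2. tens3 D r1 r2 s) r) R) x y z F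
        = eval2 R (y \<star> x) z (\<lambda>c w. cop c (\<lambda>u v. F u v w))"
      by (rule eval2_tlift[OF D3v sw2_tens3_bilinear(1) eval3_linear R_in]) (simp_all add: eval3_sw2_tens3 F multilin)
    then show "eval3 (tlift D D (\<lambda>r s. sw2 D (\<lambda>r1 r2. tens3 D r1 r2 s) r) R) x y z F
        = eval3 (mul3 D (R13 D R) (R23 D R)) x y z F"
      by (simp add: eval2_R eval3_R13_R23 F multilin)
  qed (auto intro: linear_onD(1)[OF linear_tlift[OF Dv Dv D3v sw2_tens3_bilinear(1)] R_in] mul3_add R3_in)
  show "tlift D D (\<lambda>r s. sw2 D (\<lambda>s1 s2. tens3 D r s1 s2) s) R = mul3 D (R13 D R) (R12 D R)"
  proof (rule eval3_eqI)
    fix x y z F assume F: "tril F"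
    note [simp] = trilD[OF F]
    have "eval3 (tlift D D (\<lambda>r s. sw2 D (\<lambda>s1 s2. tens3 D r s1 s2) s) R) x y z F
        = eval2 R x (z \<star> y) (\<lambda>u c. cop c (\<lambda>v w. F u v w))"
      by (rule eval2_tlift[OF D3v sw2_tens3_bilinear(2) eval3_linear R_in]) (simp_all add: eval3_sw2_tens3 F multilin)
    then show "eval3 (tlift D D (\<lambda>r s. sw2 D (\<lambda>s1 s2. tens3 D r s1 s2) s) R) x y z F
        = eval3 (mul3 D (R13 D R) (R12 D R)) x y z F"
      by (simp add: eval2_R eval3_R13_R12 F multilin)
  qed (auto intro: linear_onD(1)[OF linear_tlift[OF Dv Dv D3v sw2_tens3_bilinear(2)] R_in] mul3_add R3_in)
qed

text \<open>Rebracketing puts the computed products of R13 with R23 and with R12 on the right. Both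
  sides then evaluate to eps(x) times the sum of \<open>F\<close> at y z', z'' and
  \<open>one\<close>: on the left by \<open>twist_eps\<close>, on the right by
  \<open>twist_cancel\<close> applied to z.\<close>

lemma yang_baxter_R: "yang_baxter D R"
  unfolding yang_baxter_def mul3_assoc[OF R3_in] mul3_assoc[OF R3_in(3,2,1)]
proof (rule eval3_eqI)
  note c = mul3_add(1)[OF R3_in(2,3)] mul3_add(1)[OF R3_in(2,1)]
  fix x y z F assume F: "tril F"
  note [simp] = trilD[OF F]
  have "eval3 (mul3 D (R12 D R) (mul3 D (R13 D R) (R23 D R))) x y z F
      = cop y (\<lambda>y1 y2. twist y1 x (\<lambda>l c. eps l * (eps y2 * cop z (\<lambda>u v. F (c \<star> u) v one))))"
    by (simp add: eval3_R_mul c F eval3_R13_R23 multilin)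
  also have "\<dots> = cop y (\<lambda>y1 y2. eps x * (eps y2 * cop z (\<lambda>u v. F (y1 \<star> u) v one)))"
    by (intro arg_cong[of _ _ "cop y"] ext twist_eps) (simp add: multilin algebra_simps)
  also have "\<dots> = eps x * cop y (\<lambda>y1 y2. cop z (\<lambda>u v. F (y1 \<star> u) v one) * eps y2)"
    by (simp only: cop_mult mult.commute)
  also have "\<dots> = eps x * cop z (\<lambda>u v. F (y \<star> u) v one)"
    by (subst counit_cop(2)) (simp_all add: multilin)
  also have "\<dots> = eps x * cop z (\<lambda>z1 z2. twist z1 y (\<lambda>m c. F (z2 \<star> m) c one))"
    by (subst twist_cancel[of "\<lambda>u v. F u v one"]) (simp_all add: multilin)
  also have "\<dots> = eval3 (mul3 D (R23 D R) (mul3 D (R13 D R) (R12 D R))) x y z F"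
    by (simp add: eval3_R_mul c F eval3_R13_R12 multilin)
  finally show "eval3 (mul3 D (R12 D R) (mul3 D (R13 D R) (R23 D R))) x y z F
      = eval3 (mul3 D (R23 D R) (mul3 D (R13 D R) (R12 D R))) x y z F" .
qed (intro mul3_add R3_in)+

end

theorem mainTheorem2:
  fixes H :: "('k::field, 'h::ab_group_add) bialg"
    and T :: "'h \<Rightarrow> 'h"
    and I :: "'i set"
    and e :: "'i \<Rightarrow> 'h"
    and e' :: "'i \<Rightarrow> 'h \<Rightarrow> 'k"
  assumes "finite_dim H"
    and "biperfect H T"
    and "bij_betw T (vcarrier H) (vcarrier H)"
    and "is_basis H I e"
    and "is_dual_basis H I e e'"
  shows "let D = quantum_double H T;
             R = (\<Sum>i\<in>I. tens D D (infty H (unity (dual_cop H)) (e i)) (infty H (e' i) (unity H)))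
         in quasi_braided D R \<and> yang_baxter D R"
proof -
  interpret double_setup H T I e e'
    by unfold_locales (rule assms)+
  show ?thesis
    using quasi_braided_R yang_baxter_R by (simp only: Let_def R_def one_def)
qed

end
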